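(* Let $\mathcal{K}$ be one of the classes $Nil$, $Sol$, $Fin$, $Alt$, $Sym$. Then a group $G$ is $\mathcal{K}$-approximable if and only if every system $\bar w\in Sys(\mathcal{K})$ is solvable over $G$.
   Context: $Nil$, $Sol$, $Fin$, $Alt$, $Sym$ are the classes of finite nilpotent, finite solvable, all finite, finite alternating, and finite symmetric groups, respectively. For a group $H$, $X\subseteq H$ and $n\in\mathbb{N}$, put $C_n(X,H)=\{x_1^{g_1}\cdots x_n^{g_n} : x_i\in X\text{ or }x_i^{-1}\in X,\ g_i\in H\}$, where $x^g=g^{-1}xg$. A set $Y\subseteq H$ is $n$-separated from $X$ in $H$ if $Y\cap C_n(X,H)=\emptyset$. A group $G$ is $\mathcal{K}$-approximable if for every finite $\Phi\subset G$ and every $n\in\mathbb{N}$ there exist $H\in\mathcal{K}$ and a map $\phi:\Phi\to H$ such that $\phi(1)=1$ (when $1\in\Phi$) and $\phi(\Phi\setminus\{1\})$ is $n$-separated in $H$ from $\{\phi(g)\phi(h)(\phi(gh))^{-1} : g,h,gh\in\Phi\}$. A finite system of equations is a finite tuple $\bar w=(w_1,\dots,w_n)$ of elements of the free group on symbols $\bar a=(a_1,\dots,a_r)$ (constants) and $\bar x=(x_1,\dots,x_k)$ (variables). It is solvable in a group $G$ if for all $\bar a\in G^r$ there is $\bar x\in G^k$ with $w_i(\bar a,\bar x)=1$ for all $i$. It is solvable over $G$ if there is a group $H$ containing $G$ as a subgroup such that for all $\bar a\in G^r$ there is $\bar x\in H^k$ with $w_i(\bar a,\bar x)=1$ for all $i$.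 $Sys(G)$ is the set of all finite systems solvable in $G$, and $Sys(\mathcal{K})=\bigcap_{G\in\mathcal{K}}Sys(G)$. *)

theory Defs
  imports
    "HOL-Algebra.Solvable_Groups"
    "HOL-Algebra.Sym_Groups"
    "HOL-Algebra.Weak_Morphisms"
begin

section \<open>The classes of finite groups\<close>

text \<open>
  All five classes are closed under isomorphism within the carrier type. They are used at type
  \<open>nat\<close>, where every finite group has an isomorphic copy.
\<close>

primrec lower_central :: "('b, 'm) monoid_scheme \<Rightarrow> nat \<Rightarrow> 'b set" where
  "lower_central H 0 = carrier H"
| "lower_central H (Suc n) =
     generate H {x \<otimes>\<^bsub>H\<^esub> y \<otimes>\<^bsub>H\<^esub> inv\<^bsub>H\<^esub> x \<otimes>\<^bsub>H\<^esub> inv\<^bsub>H\<^esub> y | x y. x \<in> lower_central H n \<and> y \<in> carrier H}"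

definition nilpotent :: "('b, 'm) monoid_scheme \<Rightarrow> bool" where
  "nilpotent H \<longleftrightarrow> (\<exists>n. lower_central H n = {\<one>\<^bsub>H\<^esub>})"

definition Fin_groups :: "'b monoid set" where
  "Fin_groups = {H. group H \<and> finite (carrier H)}"

definition Nil_groups :: "'b monoid set" where
  "Nil_groups = {H. group H \<and> finite (carrier H) \<and> nilpotent H}"

definition Sol_groups :: "'b monoid set" where
  "Sol_groups = {H. group H \<and> finite (carrier H) \<and> solvable H}"

definition Alt_groups :: "'b monoid set" where
  "Alt_groups = {H. group H \<and> (\<exists>n. H \<cong> alt_group n)}"

definition Sym_groups :: "'b monoid set" where
  "Sym_groups = {H. group H \<and> (\<exists>n. H \<cong> sym_group n)}"

section \<open>Approximability\<close>

text \<open>\<open>conj_products H X n\<close> is the set $C_n(X,H)$ of products of exactly \<open>n\<close> conjugates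
  $g^{-1} x g$ with \<open>x\<close> or its inverse in \<open>X\<close>.\<close>

primrec conj_products :: "('b, 'm) monoid_scheme \<Rightarrow> 'b set \<Rightarrow> nat \<Rightarrow> 'b set" where
  "conj_products H X 0 = {\<one>\<^bsub>H\<^esub>}"
| "conj_products H X (Suc n) =
     {(inv\<^bsub>H\<^esub> g \<otimes>\<^bsub>H\<^esub> x \<otimes>\<^bsub>H\<^esub> g) \<otimes>\<^bsub>H\<^esub> y | g x y.
        g \<in> carrier H \<and> x \<in> carrier H \<and> (x \<in> X \<or> inv\<^bsub>H\<^esub> x \<in> X) \<and> y \<in> conj_products H X n}"

definition separated :: "('b, 'm) monoid_scheme \<Rightarrow> nat \<Rightarrow> 'b set \<Rightarrow> 'b set \<Rightarrow> bool" where
  "separated H n Y X \<longleftrightarrow> Y \<inter> conj_products H X n = {}"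

definition approximable :: "'b monoid set \<Rightarrow> ('a, 'm) monoid_scheme \<Rightarrow> bool" where
  "approximable K G \<longleftrightarrow>
    (\<forall>\<Phi> n. finite \<Phi> \<and> \<Phi> \<subseteq> carrier G \<longrightarrow>
      (\<exists>H\<in>K. \<exists>\<phi>. \<phi> \<in> \<Phi> \<rightarrow> carrier H \<and>
         (\<one>\<^bsub>G\<^esub> \<in> \<Phi> \<longrightarrow> \<phi> \<one>\<^bsub>G\<^esub> = \<one>\<^bsub>H\<^esub>) \<and>
         separated H n (\<phi> ` (\<Phi> - {\<one>\<^bsub>G\<^esub>}))
           {\<phi> g \<otimes>\<^bsub>H\<^esub> \<phi> h \<otimes>\<^bsub>H\<^esub> inv\<^bsub>H\<^esub> (\<phi> (g \<otimes>\<^bsub>G\<^esub> h)) | g h.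
              g \<in> \<Phi> \<and> h \<in> \<Phi> \<and> g \<otimes>\<^bsub>G\<^esub> h \<in> \<Phi>}))"

section \<open>Systems of equations\<close>

datatype symbol = Const nat | Var nat

text \<open>The letter \<open>(s, True)\<close> stands for \<open>s\<close> and \<open>(s, False)\<close> for its inverse. The free group on
  the symbols is modelled by its reduced words.\<close>

type_synonym 's word = "('s \<times> bool) list"

definition reduced :: "'s word \<Rightarrow> bool" where
  "reduced w \<longleftrightarrow> successively (\<lambda>(s, d) (t, e). \<not> (s = t \<and> d \<noteq> e)) w"

definition free_group_elems :: "nat \<Rightarrow> nat \<Rightarrow> symbol word set" where
  "free_group_elems r k = {w. reduced w \<and> fst ` set w \<subseteq> Const ` {..<r} \<union> Var ` {..<k}}"

primrec word_val :: "('b, 'm) monoid_scheme \<Rightarrow> ('s \<Rightarrow> 'b) \<Rightarrow> 's word \<Rightarrow> 'b" where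
  "word_val H v [] = \<one>\<^bsub>H\<^esub>"
| "word_val H v (l # w) = (if snd l then v (fst l) else inv\<^bsub>H\<^esub> (v (fst l))) \<otimes>\<^bsub>H\<^esub> word_val H v w"

text \<open>A triple \<open>(r, k, ws)\<close>: \<open>r\<close> constants, \<open>k\<close> variables, and the tuple of words \<open>ws\<close>.\<close>

type_synonym system = "nat \<times> nat \<times> symbol word list"

definition systems :: "system set" where
  "systems = {(r, k, ws). set ws \<subseteq> free_group_elems r k}"

definition solvable_in :: "('b, 'm) monoid_scheme \<Rightarrow> system \<Rightarrow> bool" where
  "solvable_in G = (\<lambda>(r, k, ws).
     \<forall>a \<in> {..<r} \<rightarrow> carrier G. \<exists>x \<in> {..<k} \<rightarrow> carrier G.
       \<forall>w \<in> set ws. word_val G (case_symbol a x) w = \<one>\<^bsub>G\<^esub>)"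

text \<open>An overgroup of \<open>G\<close> is given by an injective homomorphism \<open>\<iota>\<close> from \<open>G\<close>. HOL cannot quantify
  over the carrier type of the overgroup; \<open>'a + nat\<close> is large enough, as lemma
  \<open>solvable_overI\<close> below shows: an overgroup with any other carrier type can be replaced by
  one of this type.\<close>

definition solvable_over :: "('a, 'm) monoid_scheme \<Rightarrow> system \<Rightarrow> bool" where
  "solvable_over G = (\<lambda>(r, k, ws).
     \<exists>(H :: ('a + nat) monoid) \<iota>. group H \<and> \<iota> \<in> mon G H \<and>
       (\<forall>a \<in> {..<r} \<rightarrow> carrier G. \<exists>x \<in> {..<k} \<rightarrow> carrier H.
          \<forall>w \<in> set ws. word_val H (case_symbol (\<iota> \<circ> a) x) w = \<one>\<^bsub>H\<^esub>))"

definition Sys :: "('b, 'm) monoid_scheme \<Rightarrow> system set" where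
  "Sys G = {S \<in> systems. solvable_in G S}"

definition Sys_class :: "'b monoid set \<Rightarrow> system set" where
  "Sys_class K = (\<Inter>G\<in>K. Sys G)"

section \<open>Independence of the carrier type of the overgroup\<close>

lemma word_val_closed:
  assumes "group H" "\<And>s. s \<in> fst ` set w \<Longrightarrow> v s \<in> carrier H"
  shows "word_val H v w \<in> carrier H"
  using assms(2) by (induction w) (auto intro: group.is_monoid[OF assms(1)] monoid.m_closed group.inv_closed[OF assms(1)])

lemma word_val_cong:
  assumes "\<And>s. s \<in> fst ` set w \<Longrightarrow> v s = v' s"
  shows "word_val H v w = word_val H v' w"
  using assms by (induction w) auto

lemma word_val_hom:
  assumes "group_hom G H h" "\<And>s. s \<in> fst ` set w \<Longrightarrow> v s \<in> carrier G"
  shows "word_val H (h \<circ> v) w = h (word_val G v w)"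
proof -
  interpret group_hom G H h by fact
  show ?thesis
    using assms(2)
  proof (induction w)
    case (Cons l w)
    have "word_val G v w \<in> carrier G"
      using Cons.prems by (intro word_val_closed) auto
    with Cons show ?case by auto
  qed auto
qed

lemma word_val_append:
  assumes "group H" "range v \<subseteq> carrier H"
  shows "word_val H v (u @ w) = word_val H v u \<otimes>\<^bsub>H\<^esub> word_val H v w"
proof -
  interpret group H by fact
  have c: "v s \<in> carrier H" for s using assms(2) by auto
  have "word_val H v u' \<in> carrier H" for u'
    by (rule word_val_closed[OF assms(1)]) (rule c)
  then show ?thesis
    by (induction u) (auto simp: c m_assoc)
qed

lemma word_val_inverse:
  assumes "group H" "range v \<subseteq> carrier H"
  shows "word_val H v (rev (map (map_prod id Not) w)) = inv\<^bsub>H\<^esub> (word_val H v w)"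
proof -
  interpret group H by fact
  have c: "v s \<in> carrier H" for s using assms(2) by auto
  have "word_val H v u' \<in> carrier H" for u'
    by (rule word_val_closed[OF assms(1)]) (rule c)
  then show ?thesis
    by (induction w) (auto simp: c inv_mult_group word_val_append[OF assms])
qed

lemma ex_inj_prod:
  assumes "infinite (UNIV :: 'c set)"
  shows "\<exists>p :: 'c \<times> 'c \<Rightarrow> 'c. inj p"
proof -
  obtain p :: "'c \<times> 'c \<Rightarrow> 'c" where "bij_betw p (UNIV \<times> UNIV) (UNIV :: 'c set)"
    using card_of_ordIso[THEN iffD2, OF card_of_Times_same_infinite[OF assms]] by blast
  then show ?thesis
    by (auto simp: bij_betw_def)
qed

lemma ex_inj_list:
  assumes "infinite (UNIV :: 'c set)"
  shows "\<exists>e :: 'c list \<Rightarrow> 'c. inj e"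
proof -
  obtain p :: "'c \<times> 'c \<Rightarrow> 'c" where p: "inj p"
    using ex_inj_prod[OF assms] by blast
  obtain q :: "nat \<Rightarrow> 'c" where q: "inj q"
    using infinite_countable_subset[OF assms] by blast
  define F where "F xs = foldr (\<lambda>x y. p (x, y)) xs (q 0)" for xs
  have F: "xs = ys" if "length xs = length ys" "F xs = F ys" for xs ys
    using that by (induction rule: list_induct2) (auto simp: F_def dest: injD[OF p])
  have "inj (\<lambda>xs. p (q (length xs), F xs))"
    by (rule injI) (auto dest!: injD[OF p] injD[OF q] intro: F)
  then show ?thesis by blast
qed

lemma ex_inj_words:
  "\<exists>e :: ('a + 'a list \<times> nat) word \<Rightarrow> 'a + nat. inj e"
proof -
  have inf: "infinite (UNIV :: ('a + nat) set)"
    by (metis finite_Plus_UNIV_iff infinite_UNIV_nat)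
  obtain p :: "('a + nat) \<times> ('a + nat) \<Rightarrow> 'a + nat" where p: "inj p"
    using ex_inj_prod[OF inf] by blast
  obtain e :: "('a + nat) list \<Rightarrow> 'a + nat" where e: "inj e"
    using ex_inj_list[OF inf] by blast
  define b where
    "b = (\<lambda>(s :: 'a + 'a list \<times> nat, d :: bool). case s of
        Inl g \<Rightarrow> p (p (Inl g, Inr 0), Inr (if d then 1 else 0))
      | Inr (l, i) \<Rightarrow> p (p (e (map Inl l), Inr (Suc i)), Inr (if d then 1 else 0)))"
  have inj_Inl: "map Inl l = (map Inl l' :: ('a + nat) list) \<Longrightarrow> l = l'" for l l'
    by (metis inj_Inl inj_map_eq_map)
  have "inj b"
    by (rule injI)
       (auto simp: b_def split: sum.splits if_splits dest!: injD[OF p] injD[OF e] intro: inj_Inl)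
  then have "inj (e \<circ> map b)"
    using e by (intro inj_compose) auto
  then show ?thesis by blast
qed

lemma solvable_overI:
  fixes G :: "('a, 'm) monoid_scheme" and H :: "('h, 'n) monoid_scheme"
  assumes "(r, k, ws) \<in> systems" "group G" "group H" "\<iota> \<in> mon G H"
    and sol: "\<And>a. a \<in> {..<r} \<rightarrow> carrier G \<Longrightarrow> \<exists>x \<in> {..<k} \<rightarrow> carrier H.
        \<forall>w \<in> set ws. word_val H (case_symbol (\<iota> \<circ> a) x) w = \<one>\<^bsub>H\<^esub>"
  shows "solvable_over G (r, k, ws)"
proof -
  interpret G: group G by fact
  interpret H: group H by fact
  have \<iota>: "\<iota> \<in> hom G H" "inj_on \<iota> (carrier G)"
    using assms(4) by (auto simp: mon_def)
  define tup where "tup l \<longleftrightarrow> length l = r \<and> set l \<subseteq> carrier G" for l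
  have "\<exists>x \<in> {..<k} \<rightarrow> carrier H.
      \<forall>w \<in> set ws. word_val H (case_symbol (\<iota> \<circ> (!) l) x) w = \<one>\<^bsub>H\<^esub>" if "tup l" for l
    using that by (intro sol) (auto simp: tup_def)
  then obtain X where X: "\<And>l. tup l \<Longrightarrow> X l \<in> {..<k} \<rightarrow> carrier H"
    "\<And>l w. tup l \<Longrightarrow> w \<in> set ws \<Longrightarrow> word_val H (case_symbol (\<iota> \<circ> (!) l) (X l)) w = \<one>\<^bsub>H\<^esub>"
    by metis
  define v where "v s = (case s of
      Inl g \<Rightarrow> if g \<in> carrier G then \<iota> g else \<one>\<^bsub>H\<^esub>
    | Inr (l, i) \<Rightarrow> if tup l \<and> i < k then X l i else \<one>\<^bsub>H\<^esub>)" for s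
  have Xc: "X l i \<in> carrier H" if "tup l" "i < k" for l i
    using X(1)[OF that(1)] that(2) by auto
  have v: "range v \<subseteq> carrier H"
    using Xc hom_in_carrier[OF \<iota>(1)] by (auto simp: v_def split: sum.splits)
  define S where "S = range (word_val H v)"
  have vS: "v s \<in> S" for s
    using v by (auto simp: S_def image_iff range_subsetD intro!: exI[of _ "[(s, True)]"])
  have \<iota>S: "\<iota> g \<in> S" if "g \<in> carrier G" for g
    using vS[of "Inl g"] that by (simp add: v_def)
  have XS: "X l i \<in> S" if "tup l" "i < k" for l i
    using vS[of "Inr (l, i)"] that by (simp add: v_def)
  have "subgroup S H"
  proof (rule H.subgroupI)
    show "S \<subseteq> carrier H"
      using v by (auto simp: S_def intro!: word_val_closed[OF assms(3)])
    show "S \<noteq> {}" by (auto simp: S_def)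
    show "inv\<^bsub>H\<^esub> a \<in> S" if "a \<in> S" for a
      using that word_val_inverse[OF assms(3) v] by (auto simp: S_def) (metis rangeI)
    show "a \<otimes>\<^bsub>H\<^esub> b \<in> S" if "a \<in> S" "b \<in> S" for a b
      using that word_val_append[OF assms(3) v] by (auto simp: S_def) (metis rangeI)
  qed
  define HS where "HS = H\<lparr>carrier := S\<rparr>"
  have HS: "group HS"
    unfolding HS_def using \<open>subgroup S H\<close> by (rule H.subgroup_imp_group)
  have incl: "group_hom HS H id"
    using HS assms(3) subgroup.subset[OF \<open>subgroup S H\<close>]
    by (auto simp: group_hom_def group_hom_axioms_def hom_def HS_def)
  obtain e :: "('a + 'a list \<times> nat) word \<Rightarrow> 'a + nat" where e: "inj e"
    using ex_inj_words by blast
  define j where "j s = e (inv_into UNIV (word_val H v) s)" for s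
  have j: "inj_on j (carrier HS)"
    unfolding HS_def j_def S_def using e
    by (auto intro!: inj_onI dest!: injD) (metis f_inv_into_f rangeI)
  define H' where "H' = image_group j HS"
  have H': "group H'"
    unfolding H'_def by (rule group.inj_imp_image_group_is_group[OF HS j])
  have jiso: "j \<in> iso HS H'"
    unfolding H'_def by (rule inj_imp_image_group_iso[OF j])
  then have jhom: "group_hom HS H' j"
    using HS H' by (auto simp: group_hom_def group_hom_axioms_def iso_def)
  have "\<iota> \<in> hom G HS"
    using \<iota>(1) \<iota>S by (auto simp: hom_def HS_def)
  then have "j \<circ> \<iota> \<in> hom G H'"
    using group_hom.homh[OF jhom] by (rule hom_compose)
  moreover have "inj_on (j \<circ> \<iota>) (carrier G)"
    using \<iota>(2) by (rule comp_inj_on) (auto intro: inj_on_subset[OF j] simp: HS_def \<iota>S)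
  ultimately have "j \<circ> \<iota> \<in> mon G H'" by (simp add: mon_def)
  moreover have "\<exists>x \<in> {..<k} \<rightarrow> carrier H'.
      \<forall>w \<in> set ws. word_val H' (case_symbol (j \<circ> \<iota> \<circ> a) x) w = \<one>\<^bsub>H'\<^esub>"
    if a: "a \<in> {..<r} \<rightarrow> carrier G" for a
  proof (intro bexI ballI)
    define l where "l = map a [0..<r]"
    have l: "tup l" using a by (auto simp: tup_def l_def)
    show "j \<circ> X l \<in> {..<k} \<rightarrow> carrier H'"
      using XS[OF l] by (auto simp: H'_def image_group_carrier HS_def)
    fix w assume w: "w \<in> set ws"
    let ?u = "case_symbol (\<iota> \<circ> (!) l) (X l)"
    have sub: "fst ` set w \<subseteq> Const ` {..<r} \<union> Var ` {..<k}"
      using w assms(1) by (auto simp: systems_def free_group_elems_def)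
    have uS: "?u s \<in> carrier HS" if "s \<in> fst ` set w" for s
      using subsetD[OF sub that] a XS[OF l] by (auto simp: HS_def l_def intro!: \<iota>S)
    have "word_val H' (case_symbol (j \<circ> \<iota> \<circ> a) (j \<circ> X l)) w = word_val H' (j \<circ> ?u) w"
    proof (rule word_val_cong)
      fix s assume "s \<in> fst ` set w"
      then show "case_symbol (j \<circ> \<iota> \<circ> a) (j \<circ> X l) s = (j \<circ> ?u) s"
        using sub by (force simp: l_def)
    qed
    also have "\<dots> = j (word_val HS ?u w)"
      by (rule word_val_hom[OF jhom uS])
    also have "word_val HS ?u w = word_val H ?u w"
      using word_val_hom[OF incl uS, of w] by simp
    also have "\<dots> = \<one>\<^bsub>HS\<^esub>" using X(2)[OF l w] by (simp add: HS_def)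
    also have "j \<one>\<^bsub>HS\<^esub> = \<one>\<^bsub>H'\<^esub>" by (rule group_hom.hom_one[OF jhom])
    finally show "word_val H' (case_symbol (j \<circ> \<iota> \<circ> a) (j \<circ> X l)) w = \<one>\<^bsub>H'\<^esub>" .
  qed
  ultimately show ?thesis
    unfolding solvable_over_def prod.case using H'
    by (intro exI[of _ H'] exI[of _ "j \<circ> \<iota>"] conjI ballI)
qed

end

theory Submission
  imports Defs "HOL-Algebra.Product_Groups"
begin

text \<open>
  If \<open>G\<close> is approximable, it embeds into the quotient of the product of all the approximating groups
  by the elements that are eventually products of boundedly many conjugates of defects
  \<open>\<phi>(g) \<phi>(h) \<phi>(gh)\<inverse>\<close>. Solvability of a system passes to products and, solving for lifts of the
  constants, to quotients.

  Conversely, the condition that \<open>\<phi>(k)\<close> is a product of conjugates of defects following a fixed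
  pattern \<open>s\<close> is a single equation with a constant for each element of \<open>\<Phi>\<close>. It has no solution over
  \<open>G\<close> if \<open>k \<noteq> 1\<close>, since in \<open>G\<close> the defects are trivial. So some \<open>H \<in> K\<close> and \<open>\<phi>\<close> violate it, and it remains to
  violate finitely many such equations by the same map. For nilpotent, solvable and finite groups a direct
  product does this. For alternating and symmetric groups, \<open>\<phi>(k)\<close> of even sign which moves at most \<open>L\<close>
  times as many points as \<open>x\<close> is a product of \<open>O(L)\<close> elements \<open>x\<^sup>-\<^sup>z x\<^sup>y\<close>; choosing the pattern accordingly,
  its violation forces \<open>\<phi>(k)\<close> to move far more points than every defect, and such maps are combined
  by a disjoint sum with suitable multiplicities. Degrees below 15, and the sign, are treated separately: the
  product of all maps to groups of small degree either yields one pattern that works for all of them, or a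
  finite quotient in which all defects vanish and \<open>\<phi>(k)\<close> does not.
\<close>

section \<open>Bounded generation in alternating groups\<close>

text \<open>A direct product of alternating or symmetric groups is in general not a group of the
  same kind, and embedding it into one adds conjugators, which may destroy the violation of an
  equation. The number of moved points survives: it is invariant under conjugation and inversion and
  subadditive under composition. So an element that moves more than \<open>n\<close> times as many
  points as any defect avoids all patterns of length \<open>n\<close>, in whatever larger finite
  permutation group the conjugators are taken. Bounded generation serves to turn a violated equation
  into such a gap. It uses the products \<open>x\<^sup>-\<^sup>z x\<^sup>y\<close> instead of
  conjugates of \<open>x\<close> because they are even also for odd \<open>x\<close> and include the
  identity, so that short products can be padded to a fixed length. Since they are even, the sign of
  \<open>\<phi>(k)\<close> has to be supplied by another part of the pattern.\<close>

definition even_perms :: "'b set \<Rightarrow> ('b \<Rightarrow> 'b) set" where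
  "even_perms \<Omega> = {p. p permutes \<Omega> \<and> evenperm p}"

definition moved :: "('b \<Rightarrow> 'b) \<Rightarrow> 'b set" where
  "moved p = {a. p a \<noteq> a}"

text \<open>Even conjugators are available in the alternating and in the symmetric group, so one
  bound serves both.\<close>

definition conj_pairs :: "'b set \<Rightarrow> ('b \<Rightarrow> 'b) \<Rightarrow> ('b \<Rightarrow> 'b) set" where
  "conj_pairs \<Omega> x = {inv' z \<circ> inv' x \<circ> z \<circ> (inv' y \<circ> x \<circ> y) | y z. y \<in> even_perms \<Omega> \<and> z \<in> even_perms \<Omega>}"

primrec prods :: "('b \<Rightarrow> 'b) set \<Rightarrow> nat \<Rightarrow> ('b \<Rightarrow> 'b) set" where
  "prods T 0 = {id}"
| "prods T (Suc n) = {t \<circ> p | t p. t \<in> T \<and> p \<in> prods T n}"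

text \<open>\<open>distinct (pts ps)\<close> expresses in one condition that the transpositions in
  \<open>ps\<close> are nontrivial and pairwise disjoint.\<close>

definition pts :: "('b \<times> 'b) list \<Rightarrow> 'b list" where
  "pts ps = map fst ps @ map snd ps"

lemma length_pts [simp]: "length (pts ps) = 2 * length ps"
  by (simp add: pts_def)

lemma prods_append: "a \<in> prods T m \<Longrightarrow> b \<in> prods T n \<Longrightarrow> a \<circ> b \<in> prods T (m + n)"
proof (induction m arbitrary: a)
  case (Suc m)
  then obtain t p where "a = t \<circ> p" "t \<in> T" "p \<in> prods T m" by auto
  then have "a \<circ> b = t \<circ> (p \<circ> b)" "p \<circ> b \<in> prods T (m + n)"
    using Suc.IH[of p] Suc.prems by (auto simp only: comp_assoc)
  then show ?case using \<open>t \<in> T\<close> by (auto simp only: prods.simps add_Suc)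
qed auto

lemma prods_mono:
  assumes "id \<in> T" "m \<le> n" "a \<in> prods T m"
  shows "a \<in> prods T n"
proof -
  have "id \<in> prods T k" for k
  proof (induction k)
    case (Suc k)
    with assms(1) have "id \<circ> id \<in> prods T (Suc k)" unfolding prods.simps by blast
    then show ?case by (simp only: comp_id)
  qed (simp only: prods.simps singletonI)
  from prods_append[OF assms(3) this[of "n - m"]] assms(2) show ?thesis by simp
qed

lemma prods_one: "t \<in> T \<Longrightarrow> t \<in> prods T (Suc 0)"
  by auto

lemma even_perms_comp:
  assumes "finite \<Omega>" "p \<in> even_perms \<Omega>" "q \<in> even_perms \<Omega>"
  shows "p \<circ> q \<in> even_perms \<Omega>"
  using assms by (auto simp: even_perms_def permutes_compose evenperm_comp permutes_imp_permutation)

lemma even_perms_inv: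
  assumes "finite \<Omega>" "p \<in> even_perms \<Omega>"
  shows "inv' p \<in> even_perms \<Omega>"
  using assms by (auto simp: even_perms_def permutes_inv evenperm_inv permutes_imp_permutation)

lemma id_even_perms [simp]: "id \<in> even_perms \<Omega>"
  by (simp add: even_perms_def)

lemma conj_pairs_id:
  assumes "x permutes \<Omega>"
  shows "id \<in> conj_pairs \<Omega> x"
  unfolding conj_pairs_def using permutes_inv_o[OF assms] by (force intro!: exI[of _ id])

lemma commutator_in_conj_pairs:
  assumes "u \<in> even_perms \<Omega>"
  shows "inv' x \<circ> inv' u \<circ> x \<circ> u \<in> conj_pairs \<Omega> x"
proof -
  have "inv' x \<circ> inv' u \<circ> x \<circ> u = inv' id \<circ> inv' x \<circ> id \<circ> (inv' u \<circ> x \<circ> u)"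
    by (simp add: fun_eq_iff)
  then show ?thesis
    unfolding conj_pairs_def using assms id_even_perms by blast
qed

lemma conj_pairs_conj:
  assumes "finite \<Omega>" "x permutes \<Omega>" "t \<in> conj_pairs \<Omega> x" "g \<in> even_perms \<Omega>"
  shows "g \<circ> t \<circ> inv' g \<in> conj_pairs \<Omega> x"
proof -
  obtain y z where t: "t = inv' z \<circ> inv' x \<circ> z \<circ> (inv' y \<circ> x \<circ> y)"
    and yz: "y \<in> even_perms \<Omega>" "z \<in> even_perms \<Omega>"
    using assms(3) by (auto simp: conj_pairs_def)
  have b: "bij g" "bij y" "bij z"
    using yz assms(4) by (auto simp: even_perms_def intro: permutes_bij)
  then have i: "inv' (h \<circ> inv' g) = g \<circ> inv' h" if "bij h" for h
    using that by (simp add: o_inv_distrib bij_imp_bij_inv inv_inv_eq)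
  have "g \<circ> t \<circ> inv' g = inv' (z \<circ> inv' g) \<circ> inv' x \<circ> (z \<circ> inv' g) \<circ> (inv' (y \<circ> inv' g) \<circ> x \<circ> (y \<circ> inv' g))"
    unfolding i[OF b(2)] i[OF b(3)] t using b(1) by (auto simp: fun_eq_iff bij_is_inj)
  then show ?thesis
    unfolding conj_pairs_def using yz assms(1,4) by (blast intro: even_perms_comp even_perms_inv)
qed

section \<open>Conjugating lists of transpositions\<close>

lemma conj_apply_transps:
  assumes "bij g"
  shows "g \<circ> apply_transps xs \<circ> inv' g = apply_transps (map (map_prod g g) xs)"
proof (induction xs)
  case Nil
  then show ?case using assms by (simp add: fun_eq_iff bij_is_surj surj_f_inv_f)
next
  case (Cons p xs)
  have "g \<circ> apply_transps (p # xs) \<circ> inv' g =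
      (g \<circ> Transposition.transpose (fst p) (snd p) \<circ> inv' g) \<circ> (g \<circ> apply_transps xs \<circ> inv' g)"
    using assms by (auto simp: fun_eq_iff bij_is_inj)
  also have "g \<circ> Transposition.transpose (fst p) (snd p) \<circ> inv' g = Transposition.transpose (g (fst p)) (g (snd p))"
    using assms transpose_apply_commute[OF assms]
    by (intro ext) (simp only: comp_apply, metis bij_inv_eq_iff)
  finally show ?case by (simp only: Cons.IH list.map apply_transps_Cons fst_map_prod snd_map_prod)
qed

lemma inv_apply_transps: "inv' (apply_transps xs) = apply_transps (rev xs)"
proof (induction xs)
  case (Cons p xs)
  have "bij (apply_transps xs)" by (simp add: permutation_bijective)
  then have "inv' (apply_transps (p # xs)) =
      inv' (apply_transps xs) \<circ> inv' (Transposition.transpose (fst p) (snd p))"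
    unfolding apply_transps_Cons by (intro o_inv_distrib) auto
  then show ?case by (simp only: Cons.IH apply_transps_append apply_transps_Cons apply_transps_Nil rev.simps comp_id inv_transpose_eq)
qed simp

lemma ex_perm_move_list:
  assumes "finite \<Omega>" "distinct l" "distinct l'" "set l \<subseteq> \<Omega>" "set l' \<subseteq> \<Omega>" "length l = length l'"
  shows "\<exists>g. g permutes \<Omega> \<and> map g l = l'"
  using assms(6,2-5)
proof (induction l l' rule: list_induct2)
  case Nil
  then show ?case by (auto intro: permutes_id)
next
  case (Cons a l b l')
  then obtain g where g: "g permutes \<Omega>" "map g l = l'" by auto
  \<comment> \<open>By injectivity and distinctness, \<open>g a\<close> and \<open>b\<close> both
    lie outside \<open>l'\<close>, so correcting the image of \<open>a\<close> does not disturb the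
    images of \<open>l\<close>.\<close>
  define h where "h = Transposition.transpose (g a) b \<circ> g"
  have "g a \<noteq> g c" "g c \<noteq> b" if "c \<in> set l" for c
    using that Cons.prems g permutes_inj[OF g(1)] by (auto dest: injD)
  then have "map h l = map g l"
    by (intro map_cong refl) (metis comp_apply h_def transpose_apply_other)
  then have "map h l = l'" using g(2) by simp
  moreover have "h a = b" by (simp add: h_def)
  moreover have "h permutes \<Omega>"
    unfolding h_def using Cons.prems g(1)
    by (intro permutes_compose permutes_swap_id) (auto simp: permutes_in_image)
  ultimately show ?case by auto
qed

text \<open>The two points in reserve carry a transposition that corrects the sign without touching
  \<open>l\<close>.\<close>

lemma ex_even_perm_move_list:
  assumes "finite \<Omega>" "distinct l" "distinct l'" "set l \<subseteq> \<Omega>" "set l' \<subseteq> \<Omega>" "length l = length l'"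
    "length l + 2 \<le> card \<Omega>"
  shows "\<exists>g \<in> even_perms \<Omega>. map g l = l'"
proof -
  obtain g where g: "g permutes \<Omega>" "map g l = l'"
    using ex_perm_move_list[OF assms(1-6)] by blast
  show ?thesis
  proof (cases "evenperm g")
    case True
    with g have "g \<in> even_perms \<Omega>" by (simp add: even_perms_def)
    with g(2) show ?thesis by (intro bexI[of _ g])
  next
    case False
    have two: "2 \<le> card (\<Omega> - set l)"
      using card_Diff_subset[OF finite_set assms(4)] distinct_card[OF assms(2)] assms(7) by linarith
    have "finite (\<Omega> - set l)" using assms(1) by simp
    then obtain p q where pq: "p \<in> \<Omega> - set l" "q \<in> \<Omega> - set l" "p \<noteq> q"
      using two card_le_Suc0_iff_eq[of "\<Omega> - set l"] by fastforce
    have "evenperm (g \<circ> Transposition.transpose p q)"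
      using False pq(3) evenperm_comp[OF permutes_imp_permutation[OF assms(1) g(1)] permutation_swap_id]
      by (simp only: evenperm_swap)
    moreover have "g \<circ> Transposition.transpose p q permutes \<Omega>"
      using pq g(1) by (intro permutes_compose permutes_swap_id) auto
    ultimately have "g \<circ> Transposition.transpose p q \<in> even_perms \<Omega>"
      by (simp only: even_perms_def mem_Collect_eq)
    moreover have "map (g \<circ> Transposition.transpose p q) l = map g l"
      using pq by (intro map_cong refl) (metis DiffD2 comp_apply transpose_apply_other)
    ultimately show ?thesis using g(2) by metis
  qed
qed

lemma map_prod_eq_if_map_pts_eq:
  assumes "map g (pts ps) = pts qs" "length ps = length qs"
  shows "map (map_prod g g) ps = qs"
proof -
  have "map (g \<circ> fst) ps = map fst qs" "map (g \<circ> snd) ps = map snd qs"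
    using assms by (auto simp: pts_def)
  with assms(2) show ?thesis
    by (induction ps qs rule: list_induct2) auto
qed

text \<open>Products of equally many disjoint transpositions are conjugate by an even permutation
  once two points are spare, so a single such element in \<open>conj_pairs\<close> brings in its
  whole cycle type.\<close>

lemma conj_pairs_transps_transfer:
  assumes "finite \<Omega>" "x permutes \<Omega>" "apply_transps ps \<in> conj_pairs \<Omega> x"
    "distinct (pts ps)" "set (pts ps) \<subseteq> \<Omega>" "distinct (pts qs)" "set (pts qs) \<subseteq> \<Omega>"
    "length ps = length qs" "2 * length ps + 2 \<le> card \<Omega>"
  shows "apply_transps qs \<in> conj_pairs \<Omega> x"
proof -
  obtain g where g: "g \<in> even_perms \<Omega>" "map g (pts ps) = pts qs"
    using ex_even_perm_move_list[of \<Omega> "pts ps" "pts qs"] assms by auto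
  have "bij g" using g(1) permutes_bij[of g \<Omega>] by (simp add: even_perms_def)
  then have "g \<circ> apply_transps ps \<circ> inv' g = apply_transps (map (map_prod g g) ps)"
    by (rule conj_apply_transps)
  also have "map (map_prod g g) ps = qs"
    by (rule map_prod_eq_if_map_pts_eq[OF g(2) assms(8)])
  finally have "g \<circ> apply_transps ps \<circ> inv' g = apply_transps qs" .
  then show ?thesis
    by (rule subst[where P = "\<lambda>t. t \<in> _"]) (rule conj_pairs_conj[OF assms(1-3) g(1)])
qed

section \<open>Permutations as products of two involutions\<close>

lemma moved_subset: "p permutes S \<Longrightarrow> moved p \<subseteq> S"
  using permutes_not_in[of p S] by (auto simp: moved_def)

text \<open>Splitting off the transposition of a moved point with its image leaves an involution
  that moves two points fewer.\<close>

lemma involution_transps: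
  assumes "finite S" "w permutes S" "w \<circ> w = id"
  shows "\<exists>ps. w = apply_transps ps \<and> distinct (pts ps) \<and> set (pts ps) \<subseteq> moved w"
  using assms
proof (induction "card (moved w)" arbitrary: w rule: less_induct)
  case less
  have fin: "finite (moved w)"
    using moved_subset[OF less.prems(2)] less.prems(1) by (rule finite_subset)
  have ww: "w (w c) = c" for c
    using fun_cong[OF less.prems(3), of c] by (simp only: comp_apply id_apply)
  show ?case
  proof (cases "moved w = {}")
    case True
    then have "w = apply_transps []" by (auto simp: moved_def fun_eq_iff)
    moreover have "distinct (pts [])" "set (pts []) \<subseteq> moved w" by (auto simp: pts_def)
    ultimately show ?thesis by blast
  next
    case False
    then obtain a where a: "w a \<noteq> a" by (auto simp: moved_def)
    define b where "b = w a"
    have ab: "w a = b" "w b = a" "a \<noteq> b" using a ww by (auto simp: b_def)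
    define v where "v = Transposition.transpose a b \<circ> w"
    have inS: "a \<in> S" "b \<in> S"
      using permutes_not_in[OF less.prems(2), of a] permutes_not_in[OF less.prems(2), of b] ab by auto
    have iff: "w c = a \<longleftrightarrow> c = b" "w c = b \<longleftrightarrow> c = a" for c
      by (metis ab(1,2) ww)+
    have vap: "v c = (if c = a \<or> c = b then c else w c)" for c
      using ab iff[of c] by (auto simp: v_def transpose_def)
    have mv: "moved v = moved w - {a, b}"
      using ab by (auto simp: moved_def vap)
    have "v permutes S"
      unfolding v_def using less.prems(2) inS by (intro permutes_compose permutes_swap_id)
    moreover have "v \<circ> v = id"
      using ww iff by (auto simp: fun_eq_iff vap)
    moreover have "card (moved v) < card (moved w)"
      unfolding mv using fin a by (intro psubset_card_mono) (auto simp: moved_def)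
    ultimately obtain ps where ps: "v = apply_transps ps" "distinct (pts ps)" "set (pts ps) \<subseteq> moved v"
      using less.hyps less.prems(1) by blast
    have "w = Transposition.transpose a b \<circ> v"
      by (auto simp: v_def fun_eq_iff)
    then have "w = apply_transps ((a, b) # ps)" using ps by simp
    moreover have "distinct (pts ((a, b) # ps))" "set (pts ((a, b) # ps)) \<subseteq> moved w"
      using ps ab mv by (auto simp: pts_def moved_def)
    ultimately show ?thesis by blast
  qed
qed

lemma inv_funpow_cancel:
  assumes "bij w"
  shows "(inv' w ^^ k) ((w ^^ k) a) = a" "(w ^^ k) ((inv' w ^^ k) a) = a"
proof -
  have "bij (w ^^ k)" using assms by (rule bij_betw_funpow)
  then show "(inv' w ^^ k) ((w ^^ k) a) = a" "(w ^^ k) ((inv' w ^^ k) a) = a"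
    using inv_fn[OF assms, of k] inv_f_f[OF bij_is_inj, of "w ^^ k" a] surj_f_inv_f[OF bij_is_surj, of "w ^^ k" a]
    by simp_all
qed

lemma funpow_add_apply: "(f ^^ (m + n)) a = (f ^^ m) ((f ^^ n) a)"
  by (simp add: funpow_add)

text \<open>Makes the reflection of a cycle, defined through some exponent that leads from the base
  point to \<open>a\<close>, independent of that exponent.\<close>

lemma perm_funpow_cong_inv:
  assumes "bij w" "(w ^^ k) c = (w ^^ l) c"
  shows "(inv' w ^^ k) c = (inv' w ^^ l) c"
proof -
  have "(inv' w ^^ k) c = (inv' w ^^ k) ((inv' w ^^ l) ((w ^^ l) c))"
    by (simp only: inv_funpow_cancel[OF assms(1)])
  also have "\<dots> = (inv' w ^^ l) ((inv' w ^^ k) ((w ^^ k) c))"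
    unfolding assms(2)[symmetric] funpow_add_apply[symmetric] by (simp only: add.commute)
  also have "\<dots> = (inv' w ^^ l) c"
    by (simp only: inv_funpow_cancel[OF assms(1)])
  finally show ?thesis .
qed

text \<open>On each cycle, \<open>w\<close> is a rotation, hence a product of two reflections: \<open>j\<close> maps
  \<open>w\<^sup>k c\<close> to \<open>w\<^sup>-\<^sup>k c\<close> for a chosen base point \<open>c\<close> of the cycle.\<close>

lemma perm_eq_two_involutions:
  assumes "finite S" "w permutes S"
  shows "\<exists>i j. i permutes S \<and> j permutes S \<and> i \<circ> i = id \<and> j \<circ> j = id \<and> w = i \<circ> j"
proof -
  have b: "bij w" using assms(2) by (rule permutes_bij)
  have perm: "permutation w" using assms permutation_permutes by blast
  define R where "R a b \<longleftrightarrow> (\<exists>k. (w ^^ k) a = b)" for a b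
  have Rrefl: "R a a" for a unfolding R_def by (intro exI[of _ 0]) simp
  have Rtrans: "R a c" if R: "R a b" "R b c" for a b c
  proof -
    obtain k l where "(w ^^ k) a = b" "(w ^^ l) b = c" using R by (auto simp: R_def)
    then have "(w ^^ (l + k)) a = c" by (simp add: funpow_add)
    then show ?thesis by (auto simp: R_def)
  qed
  have cyc: "\<exists>n>0. (w ^^ n) a = a" for a
    using permutation_self[OF perm, of a] by metis
  have Rinv: "R a (inv' w a)" for a
  proof -
    obtain n where n: "n > 0" "(w ^^ n) a = a" using cyc by blast
    then have "w ((w ^^ (n - 1)) a) = a" by (cases n) simp_all
    then have "(w ^^ (n - 1)) a = inv' w a" using b by (metis bij_inv_eq_iff)
    then show ?thesis unfolding R_def by blast
  qed
  \<comment> \<open>Orbits are finite, so inverse powers are also natural powers; this makes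
    \<open>R\<close> symmetric although it is defined with natural exponents.\<close>
  have Rinvs: "R a ((inv' w ^^ k) a)" for a k
  proof (induction k)
    case (Suc k)
    then show ?case using Rtrans[OF _ Rinv] by simp
  qed (simp add: Rrefl)
  note invk = inv_funpow_cancel(1)[OF b]
  have Rsym: "R b a" if R: "R a b" for a b
  proof -
    obtain k where "(w ^^ k) a = b" using R by (auto simp: R_def)
    then show ?thesis using Rinvs[of b k] invk[of k a] by simp
  qed
  define base where "base a = (SOME c. R a c)" for a
  have base: "R a (base a)" for a
    unfolding base_def by (rule someI[of _ a]) (rule Rrefl)
  have base_eq: "base a = base b" if "R a b" for a b
  proof -
    have "R a c = R b c" for c using Rtrans[of b a c] Rtrans[of a b c] Rsym that by blast
    then show ?thesis by (simp add: base_def)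
  qed
  define j where "j a = (inv' w ^^ (SOME k. (w ^^ k) (base a) = a)) (base a)" for a
  have j: "j a = (inv' w ^^ k) (base a)" if "(w ^^ k) (base a) = a" for a k
    unfolding j_def using someI[of "\<lambda>k. (w ^^ k) (base a) = a", OF that] that
    by (intro perm_funpow_cong_inv[OF b]) (simp only:)
  have ex: "\<exists>k. (w ^^ k) (base a) = a" for a
    using Rsym[OF base[of a]] by (auto simp: R_def)
  have jj: "j (j a) = a" for a
  proof -
    obtain k where k: "(w ^^ k) (base a) = a" using ex by blast
    have ja: "j a = (inv' w ^^ k) (base a)" using j[OF k] .
    have "R a (j a)"
      unfolding ja using Rtrans[OF base Rinvs] .
    then have bj: "base (j a) = base a" by (rule base_eq[symmetric])
    obtain l where l: "(w ^^ l) (base a) = j a"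
      using ex[of "j a"] bj by auto
    have "j (j a) = (inv' w ^^ l) (base a)"
      using j[of l "j a"] l bj by simp
    also have "\<dots> = (w ^^ k) (base a)"
    proof -
      have "(w ^^ k) ((w ^^ l) (base a)) = base a"
        unfolding l ja by (rule inv_funpow_cancel(2)[OF b])
      then have "(w ^^ l) ((w ^^ k) (base a)) = base a"
        unfolding funpow_add_apply[symmetric] by (simp only: add.commute)
      then show ?thesis using invk[of l "(w ^^ k) (base a)"] by simp
    qed
    finally show ?thesis using k by simp
  qed
  \<comment> \<open>On a cycle, \<open>j\<close> negates the position relative to the base point and
    \<open>w\<close> shifts it by one, so \<open>w \<circ> j\<close> is a reflection as
    well.\<close>
  have wjw: "w (j (w a)) = j a" for a
  proof -
    obtain k where k: "(w ^^ k) (base a) = a" using ex by blast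
    have "R a (w a)" unfolding R_def by (intro exI[of _ 1]) simp
    then have bw: "base (w a) = base a" by (rule base_eq[symmetric])
    have "(w ^^ Suc k) (base (w a)) = w a" using k bw by simp
    then have "j (w a) = (inv' w ^^ Suc k) (base a)" using j[of "Suc k" "w a"] bw by (simp only:)
    then show ?thesis using j[OF k] b by (simp add: bij_is_surj surj_f_inv_f)
  qed
  have jout: "j a = a" if "a \<notin> S" for a
  proof -
    have "(w ^^ n) a = a" for n
      by (induction n) (use permutes_not_in[OF assms(2) that] in auto)
    then have "base a = a" using base[of a] by (auto simp: R_def)
    then show ?thesis using j[of 0 a] by simp
  qed
  have jp: "j permutes S"
    unfolding permutes_def using jout jj by metis
  show ?thesis
  proof (intro exI conjI)
    show "w \<circ> j permutes S" using jp assms(2) by (rule permutes_compose)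
    show "j permutes S" by fact
    show "w \<circ> j \<circ> (w \<circ> j) = id" using wjw jj by (auto simp: fun_eq_iff)
    show "j \<circ> j = id" using jj by (auto simp: fun_eq_iff)
    show "w = (w \<circ> j) \<circ> j" using jj by (auto simp: fun_eq_iff)
  qed
qed

section \<open>Absorbing disjoint transpositions\<close>

lemma ex_third_disjoint_from_image:
  assumes "finite S" "x permutes S"
  shows "\<exists>B \<subseteq> moved x. B \<inter> x ` B = {} \<and> card (moved x) \<le> 3 * card B"
proof -
  have mS: "moved x \<subseteq> S" using assms(2) by (rule moved_subset)
  have fin: "finite (moved x)" using mS assms(1) by (rule finite_subset)
  define F where "F = {B. B \<subseteq> moved x \<and> B \<inter> x ` B = {}}"
  have "finite F" "{} \<in> F" using fin by (auto simp: F_def)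
  then have "Max (card ` F) \<in> card ` F" by (intro Max_in) auto
  then obtain B where B: "B \<in> F" "card B = Max (card ` F)" by auto
  then have max: "card B' \<le> card B" if "B' \<in> F" for B'
    using that \<open>finite F\<close> by simp
  have finB: "finite B" using B(1) fin finite_subset by (auto simp: F_def)
  \<comment> \<open>A moved point outside these three sets could be added to \<open>B\<close>,
    against maximality; each of the sets has at most \<open>card B\<close> points.\<close>
  have "moved x \<subseteq> B \<union> x ` B \<union> inv' x ` B"
  proof (rule ccontr)
    assume "\<not> ?thesis"
    then obtain p where p: "p \<in> moved x" "p \<notin> B" "p \<notin> x ` B" "p \<notin> inv' x ` B" by blast
    have "x p \<notin> B"
    proof
      assume "x p \<in> B"
      then have "inv' x (x p) \<in> inv' x ` B" by (rule imageI)
      then show False using p(4) by (simp only: permutes_inverses(2)[OF assms(2)])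
    qed
    moreover have "x p \<noteq> p" using p(1) by (simp add: moved_def)
    moreover have "B \<inter> x ` B = {}" "B \<subseteq> moved x" using B(1) by (simp_all add: F_def)
    ultimately have "insert p B \<in> F"
      using p(1,3) by (simp add: F_def)
    then have "card (insert p B) \<le> card B" by (rule max)
    then show False using p(2) finB by simp
  qed
  then have "card (moved x) \<le> card (B \<union> x ` B \<union> inv' x ` B)"
    using finB by (intro card_mono) auto
  moreover have "card (B \<union> x ` B \<union> inv' x ` B) \<le> 3 * card B"
    using card_Un_le[of "B \<union> x ` B" "inv' x ` B"] card_Un_le[of B "x ` B"]
      card_image_le[OF finB, of x] card_image_le[OF finB, of "inv' x"] by linarith
  ultimately have "card (moved x) \<le> 3 * card B" by (rule order.trans)
  then show ?thesis using B(1) unfolding F_def by blast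
qed

lemma pts_append:
  "distinct (pts (xs @ ys)) \<longleftrightarrow> distinct (pts xs) \<and> distinct (pts ys) \<and> set (pts xs) \<inter> set (pts ys) = {}"
  "set (pts (xs @ ys)) = set (pts xs) \<union> set (pts ys)"
  by (auto simp: pts_def)

lemma pts_rev:
  "distinct (pts (rev xs)) \<longleftrightarrow> distinct (pts xs)" "set (pts (rev xs)) = set (pts xs)"
  by (auto simp: pts_def rev_map[symmetric])

lemma pts_map_prod: "pts (map (map_prod g g) xs) = map g (pts xs)"
  by (simp add: pts_def)

lemma pts_pairD:
  assumes "(a, b) \<in> set ps"
  shows "a \<in> set (pts ps)" "b \<in> set (pts ps)" "distinct (pts ps) \<Longrightarrow> a \<noteq> b"
proof -
  have "a \<in> fst ` set ps" "b \<in> snd ` set ps" using assms by force+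
  then show "a \<in> set (pts ps)" "b \<in> set (pts ps)" "distinct (pts ps) \<Longrightarrow> a \<noteq> b"
    by (auto simp: pts_def)
qed

lemma apply_transps_permutes_pts:
  assumes "set (pts ps) \<subseteq> \<Omega>"
  shows "apply_transps ps permutes \<Omega>"
proof (rule permutes_apply_transps, clarify)
  fix a b assume "(a, b) \<in> set ps"
  from pts_pairD(1,2)[OF this] show "a \<in> \<Omega> \<and> b \<in> \<Omega>" using assms by blast
qed

lemma apply_transps_even:
  assumes "distinct (pts ps)" "set (pts ps) \<subseteq> \<Omega>" "even (length ps)"
  shows "apply_transps ps \<in> even_perms \<Omega>"
proof -
  have "\<forall>(a, b)\<in>set ps. a \<noteq> b" using pts_pairD(3)[OF _ assms(1)] by blast
  then have "evenperm (apply_transps ps)"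
    using assms(3) by (simp add: evenperm_apply_transps_iff)
  then show ?thesis
    using apply_transps_permutes_pts[OF assms(2)] by (simp add: even_perms_def)
qed

lemma ex_distinct_list:
  assumes "finite B" "n \<le> card B"
  shows "\<exists>l. length l = n \<and> distinct l \<and> set l \<subseteq> B"
proof -
  obtain l where l: "set l = B" "distinct l" using finite_distinct_list[OF assms(1)] by blast
  have "length l = card B" using distinct_card[OF l(2)] l(1) by simp
  then have "length (take n l) = n" using assms(2) by simp
  moreover have "distinct (take n l)" "set (take n l) \<subseteq> B"
    using l set_take_subset[of n l] by simp_all
  ultimately show ?thesis by blast
qed

lemma ex_distinct_pts:
  assumes "finite B" "2 * n \<le> card B"
  shows "\<exists>ps. length ps = n \<and> distinct (pts ps) \<and> set (pts ps) \<subseteq> B"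
proof -
  obtain l where l: "length l = 2 * n" "distinct l" "set l \<subseteq> B"
    using ex_distinct_list[OF assms] by blast
  define ps where "ps = zip (take n l) (drop n l)"
  have "length ps = n" using l(1) by (simp add: ps_def)
  moreover have "pts ps = l"
    using l(1) unfolding pts_def ps_def by (simp add: map_fst_zip map_snd_zip)
  ultimately show ?thesis using l by blast
qed

lemma commutator_transps:
  assumes "x permutes \<Omega>"
  shows "inv' x \<circ> inv' (apply_transps ps) \<circ> x \<circ> apply_transps ps =
    apply_transps (map (map_prod (inv' x) (inv' x)) (rev ps) @ ps)"
proof -
  have "bij (inv' x)" using permutes_bij[OF permutes_inv[OF assms]] .
  from conj_apply_transps[OF this, of "rev ps"] show ?thesis
    by (simp only: apply_transps_append inv_apply_transps permutes_inv_inv[OF assms])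
qed

text \<open>Lengths divisible by 4 arise because a commutator of \<open>x\<close> duplicates an even
  number of transpositions. Four factors are the cost when \<open>x\<close> moves few points; with a
  large support one factor suffices.\<close>

definition absorbs :: "'b set \<Rightarrow> ('b \<Rightarrow> 'b) \<Rightarrow> nat \<Rightarrow> bool" where
  "absorbs \<Omega> x j \<longleftrightarrow> (\<forall>qs. distinct (pts qs) \<longrightarrow> set (pts qs) \<subseteq> \<Omega> \<longrightarrow> 4 dvd length qs \<longrightarrow>
     length qs \<le> j \<longrightarrow> apply_transps qs \<in> prods (conj_pairs \<Omega> x) 4)"

lemma absorbsD:
  assumes "absorbs \<Omega> x j" "distinct (pts qs)" "set (pts qs) \<subseteq> \<Omega>" "4 dvd length qs" "length qs \<le> j"
  shows "apply_transps qs \<in> prods (conj_pairs \<Omega> x) 4"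
  using assms by (simp add: absorbs_def)

text \<open>If \<open>B\<close> is disjoint from its image under \<open>x\<close>, the commutator of \<open>x\<close> with a product \<open>u\<close> of
  disjoint transpositions inside \<open>B\<close> is the product of \<open>u\<close> and a disjoint copy of it.\<close>

lemma absorbs_large_support:
  assumes fin: "finite \<Omega>" and x: "x permutes \<Omega>" and large: "13 \<le> card (moved x)"
  shows "\<exists>j. 4 dvd j \<and> 4 \<le> j \<and> card (moved x) \<le> 20 * j \<and> absorbs \<Omega> x j"
proof -
  obtain B where B: "B \<subseteq> moved x" "B \<inter> x ` B = {}" "card (moved x) \<le> 3 * card B"
    using ex_third_disjoint_from_image[OF fin x] by blast
  have B\<Omega>: "B \<subseteq> \<Omega>" using B(1) moved_subset[OF x] by (rule order.trans)
  then have finB: "finite B" using fin by (rule finite_subset)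
  have "card (B \<union> x ` B) = card B + card (x ` B)"
    using finB B(2) by (intro card_Un_disjoint) auto
  moreover have "card (x ` B) = card B"
    by (rule card_image) (rule permutes_inj_on[OF x])
  moreover have "x ` B \<subseteq> \<Omega>" using B\<Omega> permutes_image[OF x] by blast
  then have "card (B \<union> x ` B) \<le> card \<Omega>" using B\<Omega> fin by (intro card_mono) auto
  ultimately have card\<Omega>: "2 * card B \<le> card \<Omega>" by linarith
  \<comment> \<open>Subtracting 1 pays for the two spare points of the transfer:
    \<open>2 * (4 * s) + 2 \<le> 2 * card B \<le> card \<Omega>\<close>. With 13 moved points
    \<open>card B\<close> is at least 5, so \<open>s\<close> is positive.\<close>
  define s where "s = (card B - 1) div 4"
  have s: "4 * s + 1 \<le> card B" "card B \<le> 4 * s + 4" "1 \<le> s"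
    using B(3) large unfolding s_def by linarith+
  have main: "apply_transps qs \<in> prods (conj_pairs \<Omega> x) 4"
    if qs: "distinct (pts qs)" "set (pts qs) \<subseteq> \<Omega>" "4 dvd length qs" "length qs \<le> 4 * s" for qs
  proof -
    obtain a where a: "length qs = 4 * a" using qs(3) by (elim dvdE)
    have "2 * (2 * a) \<le> card B" using a qs(4) s(1) by linarith
    then obtain ps where ps: "length ps = 2 * a" "distinct (pts ps)" "set (pts ps) \<subseteq> B"
      using ex_distinct_pts[OF finB] by blast
    have ps\<Omega>: "set (pts ps) \<subseteq> \<Omega>" using ps(3) B\<Omega> by (rule order.trans)
    define rs where "rs = map (map_prod (inv' x) (inv' x)) (rev ps) @ ps"
    have "apply_transps ps \<in> even_perms \<Omega>"
      using ps(1) by (intro apply_transps_even ps(2) ps\<Omega>) simp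
    from commutator_in_conj_pairs[OF this, of x]
    have rsT: "apply_transps rs \<in> conj_pairs \<Omega> x"
      by (simp only: commutator_transps[OF x] rs_def)
    have "inv' x ` B \<inter> B = {}"
    proof (rule ccontr)
      assume "inv' x ` B \<inter> B \<noteq> {}"
      then obtain b where b: "b \<in> B" "inv' x b \<in> B" by blast
      then have "x (inv' x b) \<in> x ` B" by (intro imageI)
      then show False using b(1) B(2) permutes_inverses(1)[OF x, of b] by auto
    qed
    then have disj: "inv' x ` set (pts ps) \<inter> set (pts ps) = {}" using ps(3) by blast
    have "inv' x ` \<Omega> = \<Omega>" by (rule permutes_image[OF permutes_inv[OF x]])
    then have "inv' x ` set (pts ps) \<subseteq> \<Omega>" using ps\<Omega> by blast
    then have rs: "distinct (pts rs)" "set (pts rs) \<subseteq> \<Omega>"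
      using ps(2) ps\<Omega> disj permutes_inj_on[OF permutes_inv[OF x]]
      by (simp_all add: rs_def pts_append pts_map_prod pts_rev distinct_map)
    have len: "length rs = length qs" using ps(1) a by (simp add: rs_def)
    have "2 * length rs + 2 \<le> card \<Omega>" using len qs(4) s(1) card\<Omega> by linarith
    from conj_pairs_transps_transfer[OF fin x rsT rs qs(1,2) len this]
    have "apply_transps qs \<in> prods (conj_pairs \<Omega> x) (Suc 0)" by (rule prods_one)
    from prods_mono[OF conj_pairs_id[OF x] _ this, of 4] show ?thesis by simp
  qed
  have "absorbs \<Omega> x (4 * s)" unfolding absorbs_def using main by blast
  \<comment> \<open>The estimates give \<open>3 * (4 * s + 4) \<le> 6 * (4 * s)\<close>; 20 is a
    generous rounding.\<close>
  moreover have "card (moved x) \<le> 20 * (4 * s)" using B(3) s by linarith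
  ultimately show ?thesis using s(3) by (intro exI[of _ "4 * s"]) simp
qed

text \<open>For a moved point \<open>p\<close> and fixed points \<open>q\<close>, \<open>r\<close>,
  \<open>s\<close>, take the commutator of \<open>x\<close> with \<open>(p q)(r s)\<close>. The
  factor \<open>(r s)\<close> makes this product even and cancels in the commutator, which leaves a
  three-cycle on \<open>inv' x p\<close>, \<open>q\<close>, \<open>p\<close>. An even permutation
  then carries five points to prescribed places, which takes degree 7.\<close>

lemma three_cycle_in_conj_pairs:
  assumes fin: "finite \<Omega>" and x: "x permutes \<Omega>" and ne: "moved x \<noteq> {}"
    and room: "card (moved x) + 3 \<le> card \<Omega>" "7 \<le> card \<Omega>"
    and abc: "a \<in> \<Omega>" "b \<in> \<Omega>" "c \<in> \<Omega>" "a \<noteq> b" "a \<noteq> c" "b \<noteq> c"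
  shows "Transposition.transpose a c \<circ> Transposition.transpose b c \<in> conj_pairs \<Omega> x"
proof -
  obtain p where p: "p \<in> moved x" using ne by blast
  have mv: "moved x \<subseteq> \<Omega>" using x by (rule moved_subset)
  have "card (\<Omega> - moved x) = card \<Omega> - card (moved x)"
    using mv fin by (intro card_Diff_subset) (auto intro: finite_subset)
  then have "3 \<le> card (\<Omega> - moved x)" using room by linarith
  then obtain l where l: "length l = 3" "distinct l" "set l \<subseteq> \<Omega> - moved x"
    using ex_distinct_list[of "\<Omega> - moved x" 3] fin by blast
  then obtain q r s where qrs: "l = [q, r, s]"
    by (auto simp: numeral_3_eq_3 length_Suc_conv)
  have mem: "q \<in> \<Omega>" "r \<in> \<Omega>" "s \<in> \<Omega>" "q \<notin> moved x" "r \<notin> moved x" "s \<notin> moved x"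
    "q \<noteq> r" "q \<noteq> s" "r \<noteq> s" using l qrs by auto
  define p' where "p' = inv' x p"
  have xp': "x p' = p" unfolding p'_def by (rule permutes_inverses(1)[OF x])
  have xp: "x p \<noteq> p" using p by (simp add: moved_def)
  have p'p: "p' \<noteq> p" using xp xp' by metis
  then have p'm: "p' \<in> moved x" "p' \<noteq> p" unfolding moved_def mem_Collect_eq xp' by simp_all
  have fx: "inv' x q = q" "inv' x r = r" "inv' x s = s"
    using mem permutes_inv_eq[OF x] by (auto simp: moved_def)
  have pne: "p \<noteq> q" "p \<noteq> r" "p \<noteq> s" "p' \<noteq> q" "p' \<noteq> r" "p' \<noteq> s"
    using p p'm mem by auto
  have pin: "p \<in> \<Omega>" "p' \<in> \<Omega>" using p p'm mv by auto
  define ps where "ps = [(p, q), (r, s)]"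
  have "apply_transps ps \<in> even_perms \<Omega>"
    by (rule apply_transps_even) (use mem pne pin in \<open>auto simp: ps_def pts_def\<close>)
  from commutator_in_conj_pairs[OF this, of x]
  have T: "apply_transps [(r, s), (p', q), (p, q), (r, s)] \<in> conj_pairs \<Omega> x"
    unfolding commutator_transps[OF x] by (simp add: ps_def fx p'_def)
  have "card (\<Omega> - {a, b, c}) = card \<Omega> - 3"
    using abc fin by (subst card_Diff_subset) auto
  then have "2 \<le> card (\<Omega> - {a, b, c})" using room by linarith
  then obtain l' where l': "length l' = 2" "distinct l'" "set l' \<subseteq> \<Omega> - {a, b, c}"
    using ex_distinct_list[of "\<Omega> - {a, b, c}" 2] fin by blast
  then obtain e f where "l' = [e, f]"
    by (auto simp: numeral_2_eq_2 length_Suc_conv)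
  then have ef: "e \<in> \<Omega>" "f \<in> \<Omega>" "e \<noteq> f" "e \<noteq> a" "e \<noteq> b" "e \<noteq> c" "f \<noteq> a" "f \<noteq> b" "f \<noteq> c"
    using l' by auto
  have "\<exists>g \<in> even_perms \<Omega>. map g [p', q, p, r, s] = [a, c, b, e, f]"
    by (rule ex_even_perm_move_list) (use fin room abc ef pne p'm mem pin in auto)
  then obtain g where g: "g \<in> even_perms \<Omega>" "map g [p', q, p, r, s] = [a, c, b, e, f]" by (elim bexE)
  have "bij g" using g(1) permutes_bij[of g \<Omega>] by (simp add: even_perms_def)
  from conj_apply_transps[OF this, of "[(r, s), (p', q), (p, q), (r, s)]"]
  have "g \<circ> apply_transps [(r, s), (p', q), (p, q), (r, s)] \<circ> inv' g =
      apply_transps [(e, f), (a, c), (b, c), (e, f)]"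
    using g(2) by (simp only: list.map map_prod_simp list.inject)
  also have "\<dots> = Transposition.transpose a c \<circ> Transposition.transpose b c"
    using ef abc(4-6) by (auto simp: fun_eq_iff transpose_def)
  finally show ?thesis
    using conj_pairs_conj[OF fin x T g(1)] by (simp only:)
qed

lemma absorbs_small_support:
  assumes fin: "finite \<Omega>" and x: "x permutes \<Omega>" and ne: "moved x \<noteq> {}"
    and room: "card (moved x) + 3 \<le> card \<Omega>" "7 \<le> card \<Omega>"
  shows "absorbs \<Omega> x 4"
proof -
  let ?T = "conj_pairs \<Omega> x"
  \<comment> \<open>The inner transpositions of the two three-cycles coincide and cancel.\<close>
  have double: "Transposition.transpose a b \<circ> Transposition.transpose c d \<in> prods ?T (Suc 0 + Suc 0)"
    if d: "distinct [a, b, c, d]" "set [a, b, c, d] \<subseteq> \<Omega>" for a b c d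
  proof -
    have "Transposition.transpose a b \<circ> Transposition.transpose c b \<in> ?T"
      "Transposition.transpose b c \<circ> Transposition.transpose d c \<in> ?T"
      by (rule three_cycle_in_conj_pairs[OF fin x ne room];
          use d in force)+
    then have "(Transposition.transpose a b \<circ> Transposition.transpose c b) \<circ>
        (Transposition.transpose b c \<circ> Transposition.transpose d c) \<in> prods ?T (Suc 0 + Suc 0)"
      by (intro prods_append prods_one)
    also have "(Transposition.transpose a b \<circ> Transposition.transpose c b) \<circ>
        (Transposition.transpose b c \<circ> Transposition.transpose d c) =
        Transposition.transpose a b \<circ> Transposition.transpose c d"
      using d by (auto simp: fun_eq_iff transpose_def)
    finally show ?thesis .
  qed
  show ?thesis unfolding absorbs_def
  proof (intro allI impI)
    fix qs :: "('a \<times> 'a) list"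
    assume qs: "distinct (pts qs)" "set (pts qs) \<subseteq> \<Omega>" "4 dvd length qs" "length qs \<le> 4"
    then have "length qs = 0 \<or> length qs = 4" by presburger
    then consider "qs = []" | "length qs = 4" by auto
    then show "apply_transps qs \<in> prods ?T 4"
    proof cases
      case 1
      have "id \<in> prods ?T 0" by simp
      from prods_mono[OF conj_pairs_id[OF x] _ this, of 4] 1 show ?thesis by simp
    next
      case 2
      then obtain a b c d e f g h where q: "qs = [(a, b), (c, d), (e, f), (g, h)]"
        by (auto simp: eval_nat_numeral length_Suc_conv)
      have "(Transposition.transpose a b \<circ> Transposition.transpose c d) \<circ>
          (Transposition.transpose e f \<circ> Transposition.transpose g h) \<in> prods ?T (Suc 0 + Suc 0 + (Suc 0 + Suc 0))"
        by (intro prods_append double) (use qs(1,2) in \<open>auto simp: q pts_def\<close>)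
      then show ?thesis by (simp add: q comp_assoc eval_nat_numeral del: prods.simps)
    qed
  qed
qed

text \<open>Origin of the bound 15: a support of at most 12 points then leaves the three fixed
  points that the three-cycle construction uses.\<close>

lemma ex_absorbs:
  assumes "finite \<Omega>" "x permutes \<Omega>" "moved x \<noteq> {}" "15 \<le> card \<Omega>"
  shows "\<exists>j. 4 dvd j \<and> 4 \<le> j \<and> card (moved x) \<le> 20 * j \<and> absorbs \<Omega> x j"
proof (cases "13 \<le> card (moved x)")
  case True
  then show ?thesis using absorbs_large_support[OF assms(1,2)] by blast
next
  case False
  then have "absorbs \<Omega> x 4" using assms by (intro absorbs_small_support) auto
  then show ?thesis using False by (intro exI[of _ 4]) simp
qed

lemma absorbs_multiple:
  assumes x: "x permutes \<Omega>" and j: "absorbs \<Omega> x j" "4 dvd j"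
    and "distinct (pts qs)" "set (pts qs) \<subseteq> \<Omega>" "4 dvd length qs" "length qs \<le> N * j"
  shows "apply_transps qs \<in> prods (conj_pairs \<Omega> x) (4 * N)"
  using assms(4-7)
proof (induction N arbitrary: qs)
  case 0
  then have "qs = []" by simp
  then show ?case by (simp only: apply_transps_Nil mult_0_right prods.simps singletonI)
next
  case (Suc N)
  have split: "take j qs @ drop j qs = qs" by simp
  have d: "distinct (pts (take j qs))" "distinct (pts (drop j qs))"
      "set (pts (take j qs)) \<subseteq> \<Omega>" "set (pts (drop j qs)) \<subseteq> \<Omega>"
    using Suc.prems(1,2) pts_append[of "take j qs" "drop j qs"] unfolding split by blast+
  have "4 dvd length (take j qs)" "4 dvd length (drop j qs)" "length (drop j qs) \<le> N * j"
    using Suc.prems(3,4) j(2) by (auto simp: min_def)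
  then have "apply_transps (take j qs) \<in> prods (conj_pairs \<Omega> x) 4"
    "apply_transps (drop j qs) \<in> prods (conj_pairs \<Omega> x) (4 * N)"
    using d by (auto intro!: absorbsD[OF j(1)] Suc.IH)
  from prods_append[OF this] have "apply_transps (take j qs @ drop j qs) \<in> prods (conj_pairs \<Omega> x) (4 + 4 * N)"
    by (simp only: apply_transps_append)
  then show ?case unfolding split by (simp only: mult_Suc_right)
qed

text \<open>The Klein four-group writes a product of two disjoint transpositions as a product of two
  elements of type $2^4$, after multiplying both factors by the same two further transpositions.\<close>

lemma absorbs_two_transps:
  assumes fin: "finite \<Omega>" and x: "x permutes \<Omega>" and j: "absorbs \<Omega> x j" "4 \<le> j" and room: "10 \<le> card \<Omega>"
    and abcd: "{a, b, c, d} \<subseteq> \<Omega>" "a \<noteq> b" "c \<noteq> d"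
  shows "Transposition.transpose a b \<circ> Transposition.transpose c d \<in> prods (conj_pairs \<Omega> x) 16"
proof -
  let ?T = "conj_pairs \<Omega> x"
  have fresh: "\<exists>l. length l = 2 * n \<and> distinct l \<and> set l \<subseteq> \<Omega> - A" if "A \<subseteq> \<Omega>" "card A + 2 * n \<le> 10" for A n
  proof -
    have "card (\<Omega> - A) = card \<Omega> - card A"
      using that(1) fin by (intro card_Diff_subset) (auto intro: finite_subset)
    then show ?thesis using that(2) room fin by (intro ex_distinct_list) auto
  qed
  have disjoint: "Transposition.transpose a b \<circ> Transposition.transpose c d \<in> prods ?T (4 + 4)"
    if abcd': "{a, b, c, d} \<subseteq> \<Omega>" and dist: "distinct [a, b, c, d]" for a b c d
  proof -
    have four: "card {a, b, c, d} = 4" using dist by simp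
    obtain l where l: "length l = 4" "distinct l" "set l \<subseteq> \<Omega> - {a, b, c, d}"
      using fresh[OF abcd', of 2] four by auto
    then obtain e f g h where efgh: "l = [e, f, g, h]"
      by (auto simp: eval_nat_numeral length_Suc_conv)
    have dvd4: "(4::nat) dvd Suc (Suc (Suc (Suc 0)))" by presburger
    have k1: "apply_transps [(a, c), (b, d), (e, f), (g, h)] \<in> prods ?T 4"
      by (rule absorbsD[OF j(1)]) (use abcd' dist l efgh j(2) in \<open>auto simp: pts_def dvd4\<close>)
    have k2: "apply_transps [(a, d), (b, c), (e, f), (g, h)] \<in> prods ?T 4"
      by (rule absorbsD[OF j(1)]) (use abcd' dist l efgh j(2) in \<open>auto simp: pts_def dvd4\<close>)
    from prods_append[OF k1 k2]
    have "apply_transps [(a, c), (b, d), (e, f), (g, h)] \<circ> apply_transps [(a, d), (b, c), (e, f), (g, h)]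
      \<in> prods ?T (4 + 4)" .
    also have "apply_transps [(a, c), (b, d), (e, f), (g, h)] \<circ> apply_transps [(a, d), (b, c), (e, f), (g, h)] =
      (Transposition.transpose a c \<circ> Transposition.transpose b d \<circ> (Transposition.transpose a d \<circ> Transposition.transpose b c)) \<circ>
      (Transposition.transpose e f \<circ> Transposition.transpose g h \<circ> (Transposition.transpose e f \<circ> Transposition.transpose g h))"
    proof -
      have "set l \<inter> {a, b, c, d} = {}" using l(3) by blast
      then have ne: "e \<notin> {a, b, c, d}" "f \<notin> {a, b, c, d}" "g \<notin> {a, b, c, d}" "h \<notin> {a, b, c, d}"
        using efgh by auto
      have comm: "Transposition.transpose p q (Transposition.transpose u v k) = Transposition.transpose u v (Transposition.transpose p q k)"
        if "p \<notin> {u, v}" "q \<notin> {u, v}" for p q u v k :: 'a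
        using that by (auto simp: transpose_def)
      have "Transposition.transpose a d (Transposition.transpose e f k) = Transposition.transpose e f (Transposition.transpose a d k)" for k
        by (rule comm) (use ne in auto)
      moreover have "Transposition.transpose b c (Transposition.transpose e f k) = Transposition.transpose e f (Transposition.transpose b c k)" for k
        by (rule comm) (use ne in auto)
      moreover have "Transposition.transpose a d (Transposition.transpose g h k) = Transposition.transpose g h (Transposition.transpose a d k)" for k
        by (rule comm) (use ne in auto)
      moreover have "Transposition.transpose b c (Transposition.transpose g h k) = Transposition.transpose g h (Transposition.transpose b c k)" for k
        by (rule comm) (use ne in auto)
      ultimately show ?thesis by (simp add: fun_eq_iff)
    qed
    also have "Transposition.transpose e f \<circ> Transposition.transpose g h \<circ> (Transposition.transpose e f \<circ> Transposition.transpose g h) = id"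
      using l(2) efgh by (auto simp: fun_eq_iff transpose_def)
    also have "Transposition.transpose a c \<circ> Transposition.transpose b d \<circ> (Transposition.transpose a d \<circ> Transposition.transpose b c) =
      Transposition.transpose a b \<circ> Transposition.transpose c d"
      using dist by (auto simp: fun_eq_iff transpose_def)
    finally show ?thesis by (simp only: comp_id)
  qed
  \<comment> \<open>The two transpositions may share points. Inserting twice a transposition
    disjoint from both reduces to the disjoint case, at the price of 8 + 8 factors.\<close>
  have "card {a, b, c, d} \<le> 4" by (intro card_insert_le_m1; simp)+
  then obtain l where l: "length l = 2" "distinct l" "set l \<subseteq> \<Omega> - {a, b, c, d}"
    using fresh[OF abcd(1), of 1] by auto
  then obtain e f where ef: "l = [e, f]"
    by (auto simp: eval_nat_numeral length_Suc_conv)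
  have "Transposition.transpose a b \<circ> Transposition.transpose e f \<in> prods ?T (4 + 4)"
    "Transposition.transpose e f \<circ> Transposition.transpose c d \<in> prods ?T (4 + 4)"
    by (rule disjoint; use abcd l ef in force)+
  from prods_append[OF this] have "Transposition.transpose a b \<circ> Transposition.transpose e f \<circ>
    (Transposition.transpose e f \<circ> Transposition.transpose c d) \<in> prods ?T 16" by (simp del: prods.simps)
  also have "Transposition.transpose a b \<circ> Transposition.transpose e f \<circ>
    (Transposition.transpose e f \<circ> Transposition.transpose c d) = Transposition.transpose a b \<circ> Transposition.transpose c d"
    by (simp add: fun_eq_iff)
  finally show ?thesis .
qed

lemma absorbs_even_transps:
  assumes fin: "finite \<Omega>" and x: "x permutes \<Omega>" and j: "absorbs \<Omega> x j" "4 \<le> j" and room: "10 \<le> card \<Omega>"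
    and "length qs = 2 * n" "\<forall>(a, b)\<in>set qs. a \<noteq> b \<and> a \<in> \<Omega> \<and> b \<in> \<Omega>"
  shows "apply_transps qs \<in> prods (conj_pairs \<Omega> x) (16 * n)"
  using assms(6,7)
proof (induction n arbitrary: qs)
  case 0
  then have "qs = []" by simp
  then show ?case by (simp only: apply_transps_Nil mult_0_right prods.simps singletonI)
next
  case (Suc n)
  then obtain a b c d rs where qs: "qs = (a, b) # (c, d) # rs" "length rs = 2 * n"
    by (auto simp: length_Suc_conv)
  have "Transposition.transpose a b \<circ> Transposition.transpose c d \<in> prods (conj_pairs \<Omega> x) 16"
    by (rule absorbs_two_transps[OF fin x j room]) (use Suc.prems(2) qs(1) in auto)
  moreover have "apply_transps rs \<in> prods (conj_pairs \<Omega> x) (16 * n)"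
    by (rule Suc.IH) (use Suc.prems(2) qs in auto)
  ultimately have "Transposition.transpose a b \<circ> Transposition.transpose c d \<circ> apply_transps rs
    \<in> prods (conj_pairs \<Omega> x) (16 + 16 * n)" by (rule prods_append)
  then show ?case by (simp only: qs(1) apply_transps_Cons fst_conv snd_conv comp_assoc mult_Suc_right)
qed

text \<open>Each of two involutions with product \<open>\<sigma>\<close> consists of at most
  \<open>10 * L * j\<close> disjoint transpositions. Cut down to a multiple of 4, it costs
  \<open>4 * (10 * L)\<close> factors. The at most 3 + 3 transpositions left over are even in number
  because \<open>\<sigma>\<close> is even, hence at most three pairs at 16 factors each.\<close>

lemma even_perm_in_prods_conj_pairs:
  assumes fin: "finite \<Omega>" and x: "x permutes \<Omega>" and \<sigma>: "\<sigma> \<in> even_perms \<Omega>" and room: "15 \<le> card \<Omega>"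
    and le: "card (moved \<sigma>) \<le> L * card (moved x)"
  shows "\<sigma> \<in> prods (conj_pairs \<Omega> x) (80 * L + 48)"
proof (cases "moved x = {}")
  case True
  have "finite (moved \<sigma>)"
    using \<sigma> fin moved_subset[of \<sigma> \<Omega>] by (auto simp: even_perms_def intro: finite_subset)
  then have "\<sigma> = id" using le True by (auto simp: moved_def fun_eq_iff)
  then have "\<sigma> \<in> prods (conj_pairs \<Omega> x) 0" by simp
  then show ?thesis by (rule prods_mono[OF conj_pairs_id[OF x], rotated]) simp
next
  case False
  let ?T = "conj_pairs \<Omega> x"
  obtain j where j: "4 dvd j" "4 \<le> j" "card (moved x) \<le> 20 * j" "absorbs \<Omega> x j"
    using ex_absorbs[OF fin x False room] by blast
  have \<sigma>p: "\<sigma> permutes \<Omega>" "evenperm \<sigma>" using \<sigma> by (simp_all add: even_perms_def)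
  have ms: "moved \<sigma> \<subseteq> \<Omega>" using \<sigma>p(1) by (rule moved_subset)
  then have fm: "finite (moved \<sigma>)" using fin by (rule finite_subset)
  have "\<sigma> permutes moved \<sigma>"
    by (rule permutes_superset[OF \<sigma>p(1)]) (auto simp: moved_def)
  then obtain i k where ik: "i permutes moved \<sigma>" "k permutes moved \<sigma>" "i \<circ> i = id" "k \<circ> k = id" "\<sigma> = i \<circ> k"
    using perm_eq_two_involutions[OF fm] by blast
  have "\<exists>as. w = apply_transps as \<and> distinct (pts as) \<and> set (pts as) \<subseteq> moved \<sigma>"
    if w: "w permutes moved \<sigma>" "w \<circ> w = id" for w
  proof -
    obtain ps where "w = apply_transps ps" "distinct (pts ps)" "set (pts ps) \<subseteq> moved w"
      using involution_transps[OF fm w] by metis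
    moreover from this(3) moved_subset[OF that(1)] have "set (pts ps) \<subseteq> moved \<sigma>" by (rule order.trans)
    ultimately show ?thesis by metis
  qed
  then obtain as bs where as: "i = apply_transps as" "distinct (pts as)" "set (pts as) \<subseteq> moved \<sigma>"
    and bs: "k = apply_transps bs" "distinct (pts bs)" "set (pts bs) \<subseteq> moved \<sigma>"
    using ik by metis
  have len: "length cs \<le> 10 * L * j" if "distinct (pts cs)" "set (pts cs) \<subseteq> moved \<sigma>" for cs
  proof -
    have "2 * length cs = card (set (pts cs))" using distinct_card[OF that(1)] by simp
    also have "\<dots> \<le> card (moved \<sigma>)" using that(2) fm by (intro card_mono)
    also have "\<dots> \<le> L * (20 * j)" using le mult_le_mono2[OF j(3), of L] by linarith
    finally show ?thesis by simp
  qed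
  define as1 as2 where "as1 = take (4 * (length as div 4)) as" and "as2 = drop (4 * (length as div 4)) as"
  \<comment> \<open>The second list is cut at its front, so that the two remainders are adjacent in
    \<open>as @ bs\<close>.\<close>
  define bs1 bs2 where "bs1 = drop (length bs mod 4) bs" and "bs2 = take (length bs mod 4) bs"
  have as12: "as = as1 @ as2" and bs12: "bs = bs2 @ bs1"
    by (simp_all add: as1_def as2_def bs1_def bs2_def)
  have "apply_transps as1 \<in> prods ?T (4 * (10 * L))"
  proof (rule absorbs_multiple[OF x j(4,1)])
    show "distinct (pts as1)" "set (pts as1) \<subseteq> \<Omega>"
      using as(2,3) ms unfolding as12 pts_append by blast+
    have "length as1 = 4 * (length as div 4)" by (simp add: as1_def)
    then show "4 dvd length as1" by simp
    show "length as1 \<le> 10 * L * j" using len[OF as(2,3)] by (simp add: as12)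
  qed
  moreover have "apply_transps bs1 \<in> prods ?T (4 * (10 * L))"
  proof (rule absorbs_multiple[OF x j(4,1)])
    show "distinct (pts bs1)" "set (pts bs1) \<subseteq> \<Omega>"
      using bs(2,3) ms unfolding bs12 pts_append by blast+
    show "4 dvd length bs1" by (simp add: bs1_def minus_mod_eq_mult_div)
    show "length bs1 \<le> 10 * L * j" using len[OF bs(2,3)] by (simp add: bs12)
  qed
  moreover have "apply_transps (as2 @ bs2) \<in> prods ?T 48"
  proof -
    have sub: "set (as2 @ bs2) \<subseteq> set (as @ bs)" by (auto simp: as12 bs12)
    have pairs: "\<forall>(a, b)\<in>set (as @ bs). a \<noteq> b \<and> a \<in> \<Omega> \<and> b \<in> \<Omega>"
    proof (rule ballI)
      fix p assume "p \<in> set (as @ bs)"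
      then have "(fst p, snd p) \<in> set as \<or> (fst p, snd p) \<in> set bs" by simp
      then have "fst p \<noteq> snd p \<and> fst p \<in> moved \<sigma> \<and> snd p \<in> moved \<sigma>"
        using pts_pairD[of "fst p" "snd p" as] pts_pairD[of "fst p" "snd p" bs] as(2,3) bs(2,3) by blast
      then show "case p of (a, b) \<Rightarrow> a \<noteq> b \<and> a \<in> \<Omega> \<and> b \<in> \<Omega>"
        using ms by (auto simp: case_prod_beta)
    qed
    have "\<sigma> = apply_transps (as @ bs)" by (simp only: ik(5) as(1) bs(1) apply_transps_append)
    moreover have "\<forall>(a, b)\<in>set (as @ bs). a \<noteq> b" using pairs by blast
    ultimately have "even (length (as @ bs))"
      using \<sigma>p(2) evenperm_apply_transps_iff[of "as @ bs"] by simp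
    then have "even (length as + length bs)" by simp
    then have "even (length (as2 @ bs2))"
      by (simp add: as2_def bs2_def minus_mult_div_eq_mod min_def) presburger
    then obtain n where n: "length (as2 @ bs2) = 2 * n" by (elim evenE)
    have "length as2 \<le> 3" "length bs2 \<le> 3"
      by (simp_all add: as2_def bs2_def minus_mult_div_eq_mod)
    then have n3: "n \<le> 3" using n by simp
    have "apply_transps (as2 @ bs2) \<in> prods ?T (16 * n)"
    proof (rule absorbs_even_transps[OF fin x j(4,2) _ n])
      show "10 \<le> card \<Omega>" using room by simp
      show "\<forall>(a, b)\<in>set (as2 @ bs2). a \<noteq> b \<and> a \<in> \<Omega> \<and> b \<in> \<Omega>"
        by (rule ballI, rule bspec[OF pairs]) (rule subsetD[OF sub])
    qed
    then show ?thesis by (rule prods_mono[OF conj_pairs_id[OF x], rotated]) (use n3 in simp)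
  qed
  ultimately have "apply_transps as1 \<circ> (apply_transps (as2 @ bs2) \<circ> apply_transps bs1)
      \<in> prods ?T (4 * (10 * L) + (48 + 4 * (10 * L)))"
    by (intro prods_append)
  also have "apply_transps as1 \<circ> (apply_transps (as2 @ bs2) \<circ> apply_transps bs1) = \<sigma>"
    by (simp only: ik(5) as(1) bs(1) as12 bs12 apply_transps_append comp_assoc)
  also have "4 * (10 * L) + (48 + 4 * (10 * L)) = 80 * L + 48" by simp
  finally show ?thesis .
qed

section \<open>Patterns of conjugates of defects\<close>

definition defect :: "('a, 'm) monoid_scheme \<Rightarrow> ('b, 'n) monoid_scheme \<Rightarrow> ('a \<Rightarrow> 'b) \<Rightarrow> 'a \<Rightarrow> 'a \<Rightarrow> 'b" where
  "defect G H \<phi> g h = \<phi> g \<otimes>\<^bsub>H\<^esub> \<phi> h \<otimes>\<^bsub>H\<^esub> inv\<^bsub>H\<^esub> (\<phi> (g \<otimes>\<^bsub>G\<^esub> h))"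

definition letter :: "('a, 'm) monoid_scheme \<Rightarrow> ('b, 'n) monoid_scheme \<Rightarrow> ('a \<Rightarrow> 'b) \<Rightarrow> 'a \<times> 'a \<times> bool \<Rightarrow> 'b" where
  "letter G H \<phi> c = (if snd (snd c) then defect G H \<phi> (fst c) (fst (snd c))
     else inv\<^bsub>H\<^esub> (defect G H \<phi> (fst c) (fst (snd c))))"

text \<open>The defect and its sign are prescribed at each place and only the conjugators vary. For
  finite \<open>\<Phi>\<close>, finitely many of these sets cover the products of \<open>n\<close>
  conjugates of defects.\<close>

primrec pat_set :: "('a, 'm) monoid_scheme \<Rightarrow> ('b, 'n) monoid_scheme \<Rightarrow> ('a \<Rightarrow> 'b) \<Rightarrow> ('a \<times> 'a \<times> bool) list \<Rightarrow> 'b set" where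
  "pat_set G H \<phi> [] = {\<one>\<^bsub>H\<^esub>}"
| "pat_set G H \<phi> (c # s) =
     {(inv\<^bsub>H\<^esub> y \<otimes>\<^bsub>H\<^esub> letter G H \<phi> c \<otimes>\<^bsub>H\<^esub> y) \<otimes>\<^bsub>H\<^esub> p | y p. y \<in> carrier H \<and> p \<in> pat_set G H \<phi> s}"

definition pairs :: "('a, 'm) monoid_scheme \<Rightarrow> 'a set \<Rightarrow> ('a \<times> 'a) set" where
  "pairs G \<Phi> = {(g, h). g \<in> \<Phi> \<and> h \<in> \<Phi> \<and> g \<otimes>\<^bsub>G\<^esub> h \<in> \<Phi>}"

definition patterns :: "('a, 'm) monoid_scheme \<Rightarrow> 'a set \<Rightarrow> ('a \<times> 'a \<times> bool) list set" where
  "patterns G \<Phi> = {s. \<forall>c \<in> set s. (fst c, fst (snd c)) \<in> pairs G \<Phi>}"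

definition unital_map :: "('a, 'm) monoid_scheme \<Rightarrow> 'a set \<Rightarrow> ('b, 'n) monoid_scheme \<Rightarrow> ('a \<Rightarrow> 'b) \<Rightarrow> bool" where
  "unital_map G \<Phi> H \<phi> \<longleftrightarrow> \<phi> \<in> \<Phi> \<rightarrow> carrier H \<and> \<phi> \<one>\<^bsub>G\<^esub> = \<one>\<^bsub>H\<^esub>"

lemma unital_map_in: "unital_map G \<Phi> H \<phi> \<Longrightarrow> g \<in> \<Phi> \<Longrightarrow> \<phi> g \<in> carrier H"
  by (auto simp: unital_map_def)

lemma finite_pairs: "finite \<Phi> \<Longrightarrow> finite (pairs G \<Phi>)"
  by (rule finite_subset[of _ "\<Phi> \<times> \<Phi>"]) (auto simp: pairs_def)

lemma patterns_simps [simp]: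
  "[] \<in> patterns G \<Phi>"
  "(g, h, b) # s \<in> patterns G \<Phi> \<longleftrightarrow> (g, h) \<in> pairs G \<Phi> \<and> s \<in> patterns G \<Phi>"
  "s @ t \<in> patterns G \<Phi> \<longleftrightarrow> s \<in> patterns G \<Phi> \<and> t \<in> patterns G \<Phi>"
  by (auto simp: patterns_def)

context
  fixes G :: "('a, 'm) monoid_scheme" and H :: "('b, 'n) monoid_scheme" and \<Phi> :: "'a set" and \<phi> :: "'a \<Rightarrow> 'b"
  assumes H: "group H" and \<phi>: "unital_map G \<Phi> H \<phi>"
begin

interpretation H: group H by (rule H)

lemma defect_closed: "(g, h) \<in> pairs G \<Phi> \<Longrightarrow> defect G H \<phi> g h \<in> carrier H"
  using unital_map_in[OF \<phi>] by (simp add: pairs_def defect_def)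

lemma letter_closed: "(g, h) \<in> pairs G \<Phi> \<Longrightarrow> letter G H \<phi> (g, h, b) \<in> carrier H"
  using defect_closed by (simp add: letter_def)

lemma pat_set_closed: "s \<in> patterns G \<Phi> \<Longrightarrow> p \<in> pat_set G H \<phi> s \<Longrightarrow> p \<in> carrier H"
proof (induction s arbitrary: p)
  case (Cons c s)
  obtain g h b where c: "c = (g, h, b)" by (cases c)
  with Cons show ?case using letter_closed[of g h b] by auto
qed simp

lemma pat_set_nonempty: "\<exists>p. p \<in> pat_set G H \<phi> s"
proof (induction s)
  case (Cons c s)
  then show ?case using H.one_closed by auto
qed simp

lemma pat_set_append:
  assumes "s \<in> patterns G \<Phi>" "t \<in> patterns G \<Phi>" "p \<in> pat_set G H \<phi> s" "q \<in> pat_set G H \<phi> t"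
  shows "p \<otimes>\<^bsub>H\<^esub> q \<in> pat_set G H \<phi> (s @ t)"
  using assms(1,3)
proof (induction s arbitrary: p)
  case Nil
  then show ?case using assms(4) pat_set_closed[OF assms(2,4)] by simp
next
  case (Cons c s)
  obtain g h b where c: "c = (g, h, b)" by (cases c)
  have s: "s \<in> patterns G \<Phi>" "(g, h) \<in> pairs G \<Phi>" using Cons.prems(1) c by auto
  from Cons.prems(2) obtain y p' where yp: "y \<in> carrier H" "p' \<in> pat_set G H \<phi> s"
    "p = (inv\<^bsub>H\<^esub> y \<otimes>\<^bsub>H\<^esub> letter G H \<phi> c \<otimes>\<^bsub>H\<^esub> y) \<otimes>\<^bsub>H\<^esub> p'" by auto
  have "p \<otimes>\<^bsub>H\<^esub> q = (inv\<^bsub>H\<^esub> y \<otimes>\<^bsub>H\<^esub> letter G H \<phi> c \<otimes>\<^bsub>H\<^esub> y) \<otimes>\<^bsub>H\<^esub> (p' \<otimes>\<^bsub>H\<^esub> q)"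
    unfolding yp(3) using yp(1) letter_closed[OF s(2), of b] pat_set_closed[OF s(1) yp(2)] pat_set_closed[OF assms(2,4)]
    by (simp add: H.m_assoc c)
  with Cons.IH[OF s(1) yp(2)] yp(1) show ?case by auto
qed

lemma pat_set_trivial:
  assumes "s \<in> patterns G \<Phi>" "\<And>g h. (g, h) \<in> pairs G \<Phi> \<Longrightarrow> defect G H \<phi> g h = \<one>\<^bsub>H\<^esub>" "p \<in> pat_set G H \<phi> s"
  shows "p = \<one>\<^bsub>H\<^esub>"
  using assms(1,3)
proof (induction s arbitrary: p)
  case (Cons c s)
  obtain g h b where c: "c = (g, h, b)" by (cases c)
  have l: "letter G H \<phi> c = \<one>\<^bsub>H\<^esub>" using Cons.prems(1) assms(2)[of g h] by (simp add: c letter_def)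
  from Cons.prems(2) obtain y p' where yp: "y \<in> carrier H" "p' \<in> pat_set G H \<phi> s"
    "p = (inv\<^bsub>H\<^esub> y \<otimes>\<^bsub>H\<^esub> letter G H \<phi> c \<otimes>\<^bsub>H\<^esub> y) \<otimes>\<^bsub>H\<^esub> p'" by auto
  have "p' = \<one>\<^bsub>H\<^esub>" using Cons.prems(1) c by (intro Cons.IH yp(2)) simp
  then show ?case using yp(1) by (simp add: yp(3) l)
qed simp

lemma conj_products_pattern:
  assumes "y \<in> conj_products H {\<phi> g \<otimes>\<^bsub>H\<^esub> \<phi> h \<otimes>\<^bsub>H\<^esub> inv\<^bsub>H\<^esub> (\<phi> (g \<otimes>\<^bsub>G\<^esub> h)) | g h. g \<in> \<Phi> \<and> h \<in> \<Phi> \<and> g \<otimes>\<^bsub>G\<^esub> h \<in> \<Phi>} n"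
  shows "\<exists>s \<in> patterns G \<Phi>. length s = n \<and> y \<in> pat_set G H \<phi> s"
  using assms
proof (induction n arbitrary: y)
  case 0
  then show ?case by (intro bexI[of _ "[]"]) auto
next
  case (Suc n)
  define X where "X = {\<phi> g \<otimes>\<^bsub>H\<^esub> \<phi> h \<otimes>\<^bsub>H\<^esub> inv\<^bsub>H\<^esub> (\<phi> (g \<otimes>\<^bsub>G\<^esub> h)) | g h. g \<in> \<Phi> \<and> h \<in> \<Phi> \<and> g \<otimes>\<^bsub>G\<^esub> h \<in> \<Phi>}"
  have XI: "\<exists>g h. (g, h) \<in> pairs G \<Phi> \<and> v = defect G H \<phi> g h" if "v \<in> X" for v
    using that unfolding X_def pairs_def defect_def by auto
  from Suc.prems[folded X_def] obtain k x z where kxz: "k \<in> carrier H" "x \<in> carrier H" "x \<in> X \<or> inv\<^bsub>H\<^esub> x \<in> X"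
    "z \<in> conj_products H X n" "y = (inv\<^bsub>H\<^esub> k \<otimes>\<^bsub>H\<^esub> x \<otimes>\<^bsub>H\<^esub> k) \<otimes>\<^bsub>H\<^esub> z"
    by auto
  obtain s where s: "s \<in> patterns G \<Phi>" "length s = n" "z \<in> pat_set G H \<phi> s"
    using Suc.IH[OF kxz(4)[unfolded X_def]] by metis
  have "\<exists>g h b. (g, h) \<in> pairs G \<Phi> \<and> x = letter G H \<phi> (g, h, b)"
    using kxz(3)
  proof
    assume "x \<in> X"
    then obtain g h where "(g, h) \<in> pairs G \<Phi>" "x = defect G H \<phi> g h" using XI by metis
    then show ?thesis by (intro exI[of _ g] exI[of _ h] exI[of _ True]) (simp add: letter_def)
  next
    assume "inv\<^bsub>H\<^esub> x \<in> X"
    then obtain g h where gh: "(g, h) \<in> pairs G \<Phi>" "inv\<^bsub>H\<^esub> x = defect G H \<phi> g h" using XI by metis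
    then have "x = inv\<^bsub>H\<^esub> (defect G H \<phi> g h)" using kxz(2) by (simp flip: gh(2))
    then show ?thesis using gh(1) by (intro exI[of _ g] exI[of _ h] exI[of _ False]) (simp add: letter_def)
  qed
  then obtain g h b where ghb: "(g, h) \<in> pairs G \<Phi>" "x = letter G H \<phi> (g, h, b)" by metis
  have "y \<in> pat_set G H \<phi> ((g, h, b) # s)"
    using kxz(1,5) ghb(2) s(3) by auto
  then show ?case using s ghb(1) by (intro bexI[of _ "(g, h, b) # s"]) simp_all
qed

lemma pat_set_hom:
  assumes "group_hom H L f" "s \<in> patterns G \<Phi>" "p \<in> pat_set G H \<phi> s"
  shows "f p \<in> pat_set G L (\<lambda>g. f (\<phi> g)) s"
  using assms(2,3)
proof (induction s arbitrary: p)
  interpret f: group_hom H L f by (rule assms(1))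
  case Nil
  then show ?case by simp
next
  interpret f: group_hom H L f by (rule assms(1))
  case (Cons c s)
  obtain g h b where c: "c = (g, h, b)" by (cases c)
  have s: "s \<in> patterns G \<Phi>" "(g, h) \<in> pairs G \<Phi>" using Cons.prems(1) c by auto
  from Cons.prems(2) obtain y p' where yp: "y \<in> carrier H" "p' \<in> pat_set G H \<phi> s"
    "p = (inv\<^bsub>H\<^esub> y \<otimes>\<^bsub>H\<^esub> letter G H \<phi> c \<otimes>\<^bsub>H\<^esub> y) \<otimes>\<^bsub>H\<^esub> p'" by auto
  have "f (defect G H \<phi> g h) = defect G L (\<lambda>g. f (\<phi> g)) g h"
    using s(2) unital_map_in[OF \<phi>] by (simp add: pairs_def defect_def)
  then have "f (letter G H \<phi> c) = letter G L (\<lambda>g. f (\<phi> g)) c"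
    using defect_closed[OF s(2)] by (simp add: letter_def c)
  then have "f p = (inv\<^bsub>L\<^esub> (f y) \<otimes>\<^bsub>L\<^esub> letter G L (\<lambda>g. f (\<phi> g)) c \<otimes>\<^bsub>L\<^esub> f y) \<otimes>\<^bsub>L\<^esub> f p'"
    unfolding yp(3) using yp(1) letter_closed[OF s(2), of b] pat_set_closed[OF s(1) yp(2)] by (simp add: c)
  moreover have "f y \<in> carrier L" using yp(1) by simp
  ultimately show ?case using Cons.IH[OF s(1) yp(2)] unfolding pat_set.simps by blast
qed

lemma unital_map_hom:
  assumes "group_hom H L f"
  shows "unital_map G \<Phi> L (\<lambda>g. f (\<phi> g))"
  using \<phi> group_hom.hom_one[OF assms] group_hom.hom_closed[OF assms] by (auto simp: unital_map_def)

end

lemma pat_set_cong: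
  assumes "s \<in> patterns G \<Phi>" "\<And>g. g \<in> \<Phi> \<Longrightarrow> \<phi> g = \<psi> g"
  shows "pat_set G H \<phi> s = pat_set G H \<psi> s"
  using assms(1)
proof (induction s)
  case (Cons c s)
  obtain g h b where c: "c = (g, h, b)" by (cases c)
  have "letter G H \<phi> c = letter G H \<psi> c"
    using Cons.prems assms(2) by (simp add: c letter_def defect_def pairs_def)
  with Cons c show ?case by simp
qed simp

lemma approximableI:
  assumes "group G" and groups: "\<And>H. H \<in> K \<Longrightarrow> group H"
    and ex: "\<And>\<Phi> n. finite \<Phi> \<Longrightarrow> \<Phi> \<subseteq> carrier G \<Longrightarrow> \<one>\<^bsub>G\<^esub> \<in> \<Phi> \<Longrightarrow>
      \<exists>H\<in>K. \<exists>\<phi>. unital_map G \<Phi> H \<phi> \<and>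
        (\<forall>g \<in> \<Phi> - {\<one>\<^bsub>G\<^esub>}. \<forall>s \<in> patterns G \<Phi>. length s = n \<longrightarrow> \<phi> g \<notin> pat_set G H \<phi> s)"
  shows "approximable K G"
  unfolding approximable_def
proof (intro allI impI, elim conjE)
  fix \<Phi> n assume \<Phi>: "finite \<Phi>" "\<Phi> \<subseteq> carrier G"
  interpret G: group G by fact
  \<comment> \<open>Adjoining the neutral element only adds defects and patterns, so separation over
    \<open>\<Psi>\<close> gives separation over \<open>\<Phi>\<close>.\<close>
  define \<Psi> where "\<Psi> = insert \<one>\<^bsub>G\<^esub> \<Phi>"
  have "finite \<Psi>" "\<Psi> \<subseteq> carrier G" "\<one>\<^bsub>G\<^esub> \<in> \<Psi>" using \<Phi> by (auto simp: \<Psi>_def)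
  from ex[OF this, of n] obtain H \<phi> where H: "H \<in> K" and \<phi>: "unital_map G \<Psi> H \<phi>"
    and sep: "\<And>g s. g \<in> \<Psi> - {\<one>\<^bsub>G\<^esub>} \<Longrightarrow> s \<in> patterns G \<Psi> \<Longrightarrow> length s = n \<Longrightarrow> \<phi> g \<notin> pat_set G H \<phi> s"
    by metis
  have \<phi>': "unital_map G \<Phi> H \<phi>" using \<phi> by (auto simp: unital_map_def \<Psi>_def)
  have sub: "patterns G \<Phi> \<subseteq> patterns G \<Psi>" by (auto simp: patterns_def pairs_def \<Psi>_def)
  let ?X = "{\<phi> g \<otimes>\<^bsub>H\<^esub> \<phi> h \<otimes>\<^bsub>H\<^esub> inv\<^bsub>H\<^esub> (\<phi> (g \<otimes>\<^bsub>G\<^esub> h)) | g h. g \<in> \<Phi> \<and> h \<in> \<Phi> \<and> g \<otimes>\<^bsub>G\<^esub> h \<in> \<Phi>}"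
  have "\<phi> g \<notin> conj_products H ?X n" if "g \<in> \<Phi> - {\<one>\<^bsub>G\<^esub>}" for g
  proof
    assume "\<phi> g \<in> conj_products H ?X n"
    from conj_products_pattern[OF groups[OF H] \<phi>' this]
    obtain s where "s \<in> patterns G \<Phi>" "length s = n" "\<phi> g \<in> pat_set G H \<phi> s" by metis
    then show False using sep[of g s] that sub by (auto simp: \<Psi>_def)
  qed
  then have "separated H n (\<phi> ` (\<Phi> - {\<one>\<^bsub>G\<^esub>})) ?X" unfolding separated_def by blast
  then show "\<exists>H\<in>K. \<exists>\<phi>. \<phi> \<in> \<Phi> \<rightarrow> carrier H \<and> (\<one>\<^bsub>G\<^esub> \<in> \<Phi> \<longrightarrow> \<phi> \<one>\<^bsub>G\<^esub> = \<one>\<^bsub>H\<^esub>) \<and>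
         separated H n (\<phi> ` (\<Phi> - {\<one>\<^bsub>G\<^esub>}))
           {\<phi> g \<otimes>\<^bsub>H\<^esub> \<phi> h \<otimes>\<^bsub>H\<^esub> inv\<^bsub>H\<^esub> (\<phi> (g \<otimes>\<^bsub>G\<^esub> h)) | g h.
              g \<in> \<Phi> \<and> h \<in> \<Phi> \<and> g \<otimes>\<^bsub>G\<^esub> h \<in> \<Phi>}"
    using H \<phi>' by (intro bexI[of _ H] exI[of _ \<phi>]) (auto simp: unital_map_def)
qed

section \<open>Words expressing patterns\<close>

fun cancel_cons :: "'s \<times> bool \<Rightarrow> 's word \<Rightarrow> 's word" where
  "cancel_cons l [] = [l]"
| "cancel_cons l (m # w) = (if fst l = fst m \<and> snd l \<noteq> snd m then w else l # m # w)"

text \<open>Systems consist of reduced words, while the words written down for patterns need not be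
  reduced.\<close>

definition reduce :: "'s word \<Rightarrow> 's word" where
  "reduce w = foldr cancel_cons w []"

lemma reduced_reduce: "reduced (reduce w)"
proof (induction w)
  case Nil
  then show ?case by (simp add: reduce_def reduced_def)
next
  case (Cons l w)
  have "reduced (cancel_cons l u)" if "reduced u" for u
    using that by (cases u) (auto simp: reduced_def successively_Cons)
  with Cons show ?case by (simp add: reduce_def)
qed

lemma set_reduce: "set (reduce w) \<subseteq> set w"
proof (induction w)
  case (Cons l w)
  have "set (cancel_cons l u) \<subseteq> insert l (set u)" for u :: "'a word"
    by (cases u) auto
  with Cons show ?case unfolding reduce_def foldr.simps comp_apply by (auto 4 3)
qed (simp add: reduce_def)

lemma word_val_reduce:
  assumes "group H" "range v \<subseteq> carrier H"
  shows "word_val H v (reduce w) = word_val H v w"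
proof (induction w)
  case (Cons l w)
  interpret group H by fact
  have c: "v s \<in> carrier H" for s using assms(2) by auto
  have cw: "word_val H v u \<in> carrier H" for u
    by (rule word_val_closed[OF assms(1)]) (rule c)
  have "word_val H v (cancel_cons l u) = word_val H v (l # u)" for u
  proof (cases u)
    case (Cons m u')
    show ?thesis
    proof (cases "fst l = fst m \<and> snd l \<noteq> snd m")
      case True
      then show ?thesis using Cons c[of "fst m"] cw[of u'] by (cases "snd m") (simp_all add: flip: m_assoc)
    next
      case False
      with Cons show ?thesis by auto
    qed
  qed simp
  with Cons show ?case by (simp add: reduce_def)
qed (simp add: reduce_def)

definition inv_word :: "'s word \<Rightarrow> 's word" where
  "inv_word w = rev (map (map_prod id Not) w)"

text \<open>The empty word for the neutral element makes every assignment of the constants induce a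
  unital map.\<close>

definition elem_word :: "('a, 'm) monoid_scheme \<Rightarrow> ('a \<Rightarrow> nat) \<Rightarrow> 'a \<Rightarrow> symbol word" where
  "elem_word G e g = (if g = \<one>\<^bsub>G\<^esub> then [] else [(Const (e g), True)])"

definition letter_word :: "('a, 'm) monoid_scheme \<Rightarrow> ('a \<Rightarrow> nat) \<Rightarrow> 'a \<times> 'a \<times> bool \<Rightarrow> symbol word" where
  "letter_word G e c = (let d = elem_word G e (fst c) @ elem_word G e (fst (snd c)) @
     inv_word (elem_word G e (fst c \<otimes>\<^bsub>G\<^esub> fst (snd c))) in if snd (snd c) then d else inv_word d)"

text \<open>Each place has a variable of its own, counted from \<open>i\<close>, because the
  conjugators are independent of each other.\<close>

primrec pattern_word :: "('a, 'm) monoid_scheme \<Rightarrow> ('a \<Rightarrow> nat) \<Rightarrow> nat \<Rightarrow> ('a \<times> 'a \<times> bool) list \<Rightarrow> symbol word" where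
  "pattern_word G e i [] = []"
| "pattern_word G e i (c # s) =
     [(Var i, False)] @ letter_word G e c @ [(Var i, True)] @ pattern_word G e (Suc i) s"

lemma symbols_inv_word [simp]: "fst ` set (inv_word w) = fst ` set w"
  by (force simp: inv_word_def)

lemma symbols_elem_word: "e \<in> \<Phi> \<rightarrow> {..<r} \<Longrightarrow> g \<in> \<Phi> \<Longrightarrow> fst ` set (elem_word G e g) \<subseteq> Const ` {..<r}"
  by (auto simp: elem_word_def)

lemma symbols_letter_word:
  assumes "e \<in> \<Phi> \<rightarrow> {..<r}" "(g, h) \<in> pairs G \<Phi>"
  shows "fst ` set (letter_word G e (g, h, b)) \<subseteq> Const ` {..<r}"
proof -
  have "fst ` set (elem_word G e k) \<subseteq> Const ` {..<r}" if "k \<in> {g, h, g \<otimes>\<^bsub>G\<^esub> h}" for k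
    using assms(2) that by (intro symbols_elem_word[OF assms(1)]) (auto simp: pairs_def)
  then show ?thesis by (simp add: letter_word_def Let_def image_Un)
qed

lemma symbols_pattern_word:
  assumes "e \<in> \<Phi> \<rightarrow> {..<r}" "s \<in> patterns G \<Phi>"
  shows "fst ` set (pattern_word G e i s) \<subseteq> Const ` {..<r} \<union> Var ` {i..<i + length s}"
  using assms(2)
proof (induction s arbitrary: i)
  case (Cons c s)
  obtain g h b where c: "c = (g, h, b)" by (cases c)
  have "fst ` set (letter_word G e c) \<subseteq> Const ` {..<r}"
    unfolding c by (rule symbols_letter_word[OF assms(1)]) (use Cons.prems c in simp)
  moreover have "fst ` set (pattern_word G e (Suc i) s) \<subseteq> Const ` {..<r} \<union> Var ` {Suc i..<Suc i + length s}"
    using Cons.IH[of "Suc i"] Cons.prems by (simp add: c)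
  moreover have "{Suc i..<Suc i + length s} \<subseteq> {i..<i + length (c # s)}" by auto
  ultimately show ?case by (auto simp: image_Un)
qed simp

context
  fixes G :: "('a, 'm) monoid_scheme" and H :: "('b, 'n) monoid_scheme" and e :: "'a \<Rightarrow> nat" and a :: "nat \<Rightarrow> 'b" and \<phi> :: "'a \<Rightarrow> 'b"
  assumes H: "group H" and a: "range a \<subseteq> carrier H"
    and \<phi>_def: "\<And>g. \<phi> g = (if g = \<one>\<^bsub>G\<^esub> then \<one>\<^bsub>H\<^esub> else a (e g))"
begin

interpretation H: group H by (rule H)

lemma range_case_symbol:
  assumes "range x \<subseteq> carrier H"
  shows "range (case_symbol a x) \<subseteq> carrier H"
  using range_subsetD[OF a] range_subsetD[OF assms] by (auto split: symbol.splits)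

lemma \<phi>_closed: "\<phi> g \<in> carrier H"
  using range_subsetD[OF a] by (auto simp: \<phi>_def)

lemma word_val_elem_word: "word_val H (case_symbol a x) (elem_word G e g) = \<phi> g"
  using range_subsetD[OF a] by (auto simp: elem_word_def \<phi>_def)

lemma word_val_letter_word:
  assumes "range x \<subseteq> carrier H"
  shows "word_val H (case_symbol a x) (letter_word G e c) = letter G H \<phi> c"
  using word_val_append[OF H range_case_symbol[OF assms]] word_val_inverse[OF H range_case_symbol[OF assms]] \<phi>_closed
  by (simp add: letter_word_def letter_def defect_def Let_def word_val_elem_word inv_word_def[symmetric] H.m_assoc)

lemma word_val_pattern_word_Cons:
  assumes "range x \<subseteq> carrier H"
  shows "word_val H (case_symbol a x) (pattern_word G e i (c # s)) =
    (inv\<^bsub>H\<^esub> (x i) \<otimes>\<^bsub>H\<^esub> letter G H \<phi> c \<otimes>\<^bsub>H\<^esub> x i) \<otimes>\<^bsub>H\<^esub> word_val H (case_symbol a x) (pattern_word G e (Suc i) s)"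
proof -
  have "word_val H (case_symbol a x) w \<in> carrier H" for w
    using range_case_symbol[OF assms] by (intro word_val_closed H) auto
  moreover from this[of "letter_word G e c"] have "letter G H \<phi> c \<in> carrier H"
    by (simp add: word_val_letter_word[OF assms])
  moreover have "x i \<in> carrier H" using assms by auto
  ultimately show ?thesis
    by (simp add: word_val_append[OF H range_case_symbol[OF assms]] word_val_letter_word[OF assms] H.m_assoc)
qed

lemma word_val_pattern_word_in:
  assumes "range x \<subseteq> carrier H"
  shows "word_val H (case_symbol a x) (pattern_word G e i s) \<in> pat_set G H \<phi> s"
proof (induction s arbitrary: i)
  case (Cons c s)
  moreover have "x i \<in> carrier H" using assms by auto
  ultimately show ?case unfolding word_val_pattern_word_Cons[OF assms] pat_set.simps by blast
qed simp

text \<open>Later places use variables of larger index only, so the conjugator of the first place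
  can still be set after the others.\<close>

lemma ex_word_val_pattern_word:
  assumes "e \<in> \<Phi> \<rightarrow> {..<r}" "s \<in> patterns G \<Phi>" "p \<in> pat_set G H \<phi> s"
  shows "\<exists>x. range x \<subseteq> carrier H \<and> word_val H (case_symbol a x) (pattern_word G e i s) = p"
  using assms(2,3)
proof (induction s arbitrary: i p)
  case Nil
  then show ?case by (intro exI[of _ "\<lambda>_. \<one>\<^bsub>H\<^esub>"]) auto
next
  case (Cons c s)
  obtain g h b where c: "c = (g, h, b)" by (cases c)
  have s: "s \<in> patterns G \<Phi>" using Cons.prems(1) c by simp
  from Cons.prems(2) obtain y p' where yp: "y \<in> carrier H" "p' \<in> pat_set G H \<phi> s"
    "p = (inv\<^bsub>H\<^esub> y \<otimes>\<^bsub>H\<^esub> letter G H \<phi> c \<otimes>\<^bsub>H\<^esub> y) \<otimes>\<^bsub>H\<^esub> p'" by auto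
  from Cons.IH[OF s yp(2), of "Suc i"] obtain x where x: "range x \<subseteq> carrier H"
    "word_val H (case_symbol a x) (pattern_word G e (Suc i) s) = p'" by metis
  have r: "range (x(i := y)) \<subseteq> carrier H" using x(1) yp(1) by auto
  have "word_val H (case_symbol a (x(i := y))) (pattern_word G e (Suc i) s) =
      word_val H (case_symbol a x) (pattern_word G e (Suc i) s)"
  proof (rule word_val_cong)
    fix t assume "t \<in> fst ` set (pattern_word G e (Suc i) s)"
    then have "t \<in> Const ` {..<r} \<union> Var ` {Suc i..<Suc i + length s}"
      using symbols_pattern_word[OF assms(1) s, of "Suc i"] by (rule rev_subsetD)
    then show "case_symbol a (x(i := y)) t = case_symbol a x t" by auto
  qed
  then have "word_val H (case_symbol a (x(i := y))) (pattern_word G e i (c # s)) = p"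
    unfolding word_val_pattern_word_Cons[OF r] yp(3) x(2) by simp
  then show ?case using r by metis
qed

end

lemma ex_unital_map_avoiding_pattern:
  fixes G :: "('a, 'm) monoid_scheme"
  assumes G: "group G" and groups: "\<And>H. H \<in> K \<Longrightarrow> group H"
    and sol: "\<And>S. S \<in> Sys_class K \<Longrightarrow> solvable_over G S"
    and \<Phi>: "finite \<Phi>" "\<Phi> \<subseteq> carrier G" "\<one>\<^bsub>G\<^esub> \<in> \<Phi>" and k: "k \<in> \<Phi> - {\<one>\<^bsub>G\<^esub>}" and s: "s \<in> patterns G \<Phi>"
  shows "\<exists>H\<in>K. \<exists>\<phi>. unital_map G \<Phi> H \<phi> \<and> \<phi> k \<notin> pat_set G H \<phi> s"
proof (rule ccontr)
  assume contr: "\<not> ?thesis"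
  have all: "\<phi> k \<in> pat_set G H \<phi> s" if "H \<in> K" "unital_map G \<Phi> H \<phi>" for H \<phi>
    using contr that by metis
  define r where "r = card \<Phi>"
  obtain e where e: "bij_betw e \<Phi> {..<r}"
    using ex_bij_betw_finite_nat[OF \<Phi>(1)] by (auto simp: r_def atLeast0LessThan)
  then have e\<Phi>: "e \<in> \<Phi> \<rightarrow> {..<r}" by (auto simp: bij_betw_def)
  \<comment> \<open>\<open>w = 1\<close> equates \<open>\<phi> k\<close> with a value of the
    pattern; under the contrary assumption every group in \<open>K\<close> solves it.\<close>
  define w where "w = inv_word (elem_word G e k) @ pattern_word G e 0 s"
  define S where "S = (r, length s, [reduce w])"
  have symw: "fst ` set w \<subseteq> Const ` {..<r} \<union> Var ` {..<length s}"
    using symbols_elem_word[OF e\<Phi>, of k] symbols_pattern_word[OF e\<Phi> s, of 0] k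
    by (auto simp: w_def image_Un atLeast0LessThan)
  have symrw: "fst ` set (reduce w) \<subseteq> Const ` {..<r} \<union> Var ` {..<length s}"
    using image_mono[OF set_reduce[of w], of fst] symw by (rule order.trans)
  have Ssys: "S \<in> systems"
    using symrw reduced_reduce[of w] by (simp add: S_def systems_def free_group_elems_def)
  have "S \<in> Sys_class K"
    unfolding Sys_class_def Sys_def
  proof (intro INT_I CollectI conjI Ssys)
    fix H assume HK: "H \<in> K"
    interpret H: group H by (rule groups[OF HK])
    show "solvable_in H S"
      unfolding solvable_in_def S_def prod.case
    proof (intro ballI)
      fix a assume a: "a \<in> {..<r} \<rightarrow> carrier H"
      \<comment> \<open>Padding with the neutral element gives an assignment whose whole range lies
        in the carrier, as the lemmas on words demand.\<close>
      define a' where "a' i = (if i < r then a i else \<one>\<^bsub>H\<^esub>)" for i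
      define \<phi> where "\<phi> g = (if g = \<one>\<^bsub>G\<^esub> then \<one>\<^bsub>H\<^esub> else a' (e g))" for g
      have a': "range a' \<subseteq> carrier H" using a by (auto simp: a'_def)
      have "unital_map G \<Phi> H \<phi>" using range_subsetD[OF a'] by (auto simp: unital_map_def \<phi>_def)
      from all[OF HK this] obtain x where x: "range x \<subseteq> carrier H"
        "word_val H (case_symbol a' x) (pattern_word G e 0 s) = \<phi> k"
        using ex_word_val_pattern_word[OF H.is_group a' \<phi>_def e\<Phi> s] by metis
      have rg: "range (case_symbol a' x) \<subseteq> carrier H"
        by (rule range_case_symbol[OF H.is_group a' \<phi>_def x(1)])
      have "word_val H (case_symbol a x) (reduce w) = word_val H (case_symbol a' x) (reduce w)"
      proof (rule word_val_cong)
        fix t assume "t \<in> fst ` set (reduce w)"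
        then have "t \<in> Const ` {..<r} \<union> Var ` {..<length s}" using symrw by (rule rev_subsetD)
        then show "case_symbol a x t = case_symbol a' x t" by (auto simp: a'_def)
      qed
      also have "\<dots> = word_val H (case_symbol a' x) w" by (rule word_val_reduce[OF H.is_group rg])
      also have "\<dots> = inv\<^bsub>H\<^esub> \<phi> k \<otimes>\<^bsub>H\<^esub> \<phi> k"
        unfolding w_def word_val_append[OF H.is_group rg] inv_word_def word_val_inverse[OF H.is_group rg]
          word_val_elem_word[OF H.is_group a' \<phi>_def] x(2) ..
      also have "\<dots> = \<one>\<^bsub>H\<^esub>" using \<phi>_closed[OF H.is_group a' \<phi>_def] by simp
      finally have "word_val H (case_symbol a x) (reduce w) = \<one>\<^bsub>H\<^esub>" .
      then show "\<exists>x\<in>{..<length s} \<rightarrow> carrier H. \<forall>w\<in>set [reduce w]. word_val H (case_symbol a x) w = \<one>\<^bsub>H\<^esub>"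
        using x(1) by (intro bexI[of _ x]) auto
    qed
  qed
  from sol[OF this] obtain L :: "('a + nat) monoid" and \<iota> where L: "group L" and \<iota>: "\<iota> \<in> mon G L"
    and solL: "\<And>a. a \<in> {..<r} \<rightarrow> carrier G \<Longrightarrow> \<exists>x \<in> {..<length s} \<rightarrow> carrier L.
      word_val L (case_symbol (\<iota> \<circ> a) x) (reduce w) = \<one>\<^bsub>L\<^esub>"
    unfolding solvable_over_def S_def prod.case by auto
  interpret G: group G by fact
  interpret L: group L by fact
  interpret \<iota>: group_hom G L \<iota>
    using \<iota> by unfold_locales (simp add: mon_def)
  \<comment> \<open>The constants are instantiated with the elements of \<open>\<Phi>\<close> that
    they name. Then \<open>\<phi>\<close> agrees with \<open>\<iota>\<close> on
    \<open>\<Phi>\<close> and all defects vanish.\<close>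
  define b where "b = inv_into \<Phi> e"
  have be: "b (e g) = g" if "g \<in> \<Phi>" for g
    using that e by (simp add: b_def bij_betw_def)
  have b: "b i \<in> \<Phi>" if "i < r" for i
    using that e unfolding b_def by (intro inv_into_into) (auto simp: bij_betw_def)
  have "b \<in> {..<r} \<rightarrow> carrier G" using b \<Phi>(2) by auto
  from solL[OF this] obtain x where x: "x \<in> {..<length s} \<rightarrow> carrier L"
    "word_val L (case_symbol (\<iota> \<circ> b) x) (reduce w) = \<one>\<^bsub>L\<^esub>" by auto
  define a' where "a' i = (if i < r then \<iota> (b i) else \<one>\<^bsub>L\<^esub>)" for i
  define x' where "x' i = (if i < length s then x i else \<one>\<^bsub>L\<^esub>)" for i
  define \<phi> where "\<phi> g = (if g = \<one>\<^bsub>G\<^esub> then \<one>\<^bsub>L\<^esub> else a' (e g))" for g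
  have a': "range a' \<subseteq> carrier L" using \<iota>.hom_closed subsetD[OF \<Phi>(2) b] by (auto simp: a'_def)
  have x': "range x' \<subseteq> carrier L" using x(1) by (auto simp: x'_def)
  have rg: "range (case_symbol a' x') \<subseteq> carrier L"
    by (rule range_case_symbol[OF L a' \<phi>_def x'])
  have \<phi>\<iota>: "\<phi> g = \<iota> g" if "g \<in> \<Phi>" for g
    using that e\<Phi> be by (auto simp: \<phi>_def a'_def)
  have "\<one>\<^bsub>L\<^esub> = word_val L (case_symbol a' x') (reduce w)"
    unfolding x(2)[symmetric]
  proof (rule word_val_cong)
    fix t assume "t \<in> fst ` set (reduce w)"
    then have "t \<in> Const ` {..<r} \<union> Var ` {..<length s}" using symrw by (rule rev_subsetD)
    then show "case_symbol (\<iota> \<circ> b) x t = case_symbol a' x' t" by (auto simp: a'_def x'_def)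
  qed
  also have "\<dots> = word_val L (case_symbol a' x') w" by (rule word_val_reduce[OF L rg])
  also have "\<dots> = inv\<^bsub>L\<^esub> \<phi> k \<otimes>\<^bsub>L\<^esub> word_val L (case_symbol a' x') (pattern_word G e 0 s)"
    unfolding w_def word_val_append[OF L rg] inv_word_def word_val_inverse[OF L rg]
      word_val_elem_word[OF L a' \<phi>_def] ..
  also have "word_val L (case_symbol a' x') (pattern_word G e 0 s) = \<one>\<^bsub>L\<^esub>"
  proof (rule pat_set_trivial[OF L _ s])
    show "unital_map G \<Phi> L \<phi>" using \<phi>_closed[OF L a' \<phi>_def] by (auto simp: unital_map_def \<phi>_def)
    show "defect G L \<phi> g h = \<one>\<^bsub>L\<^esub>" if "(g, h) \<in> pairs G \<Phi>" for g h
      using that \<Phi>(2) by (auto simp: defect_def pairs_def \<phi>\<iota> subset_iff)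
    show "word_val L (case_symbol a' x') (pattern_word G e 0 s) \<in> pat_set G L \<phi> s"
      by (rule word_val_pattern_word_in[OF L a' \<phi>_def x'])
  qed
  finally have "\<one>\<^bsub>L\<^esub> = inv\<^bsub>L\<^esub> \<phi> k" using \<phi>_closed[OF L a' \<phi>_def] by simp
  then have "\<phi> k = \<one>\<^bsub>L\<^esub>" using \<phi>_closed[OF L a' \<phi>_def] by (metis L.inv_inv L.inv_one)
  then have "\<iota> k = \<one>\<^bsub>L\<^esub>" using k \<phi>\<iota>[of k] by simp
  then have "\<iota> k = \<iota> \<one>\<^bsub>G\<^esub>" by simp
  moreover have "inj_on \<iota> (carrier G)" using \<iota> by (simp add: mon_def)
  ultimately show False using k \<Phi>(2) inj_onD[of \<iota> "carrier G" k "\<one>\<^bsub>G\<^esub>"] by auto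
qed

section \<open>From approximations to solutions\<close>

lemma group_hom_proj:
  assumes "\<And>i. i \<in> I \<Longrightarrow> group (H i)" "i \<in> I"
  shows "group_hom (product_group I H) (H i) (\<lambda>p. p i)"
  using assms by (auto simp: group_hom_def group_hom_axioms_def hom_def)

section \<open>Products of conjugates as a normal subgroup\<close>

context
  fixes H :: "('b, 'n) monoid_scheme" and X :: "'b set"
  assumes H: "group H" and X: "X \<subseteq> carrier H"
begin

interpretation H: group H by (rule H)

lemma conj_products_closed: "y \<in> conj_products H X n \<Longrightarrow> y \<in> carrier H"
  by (induction n arbitrary: y) auto

lemma conj_products_append:
  assumes "y \<in> conj_products H X m" "z \<in> conj_products H X n"
  shows "y \<otimes>\<^bsub>H\<^esub> z \<in> conj_products H X (m + n)"
  using assms(1)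
proof (induction m arbitrary: y)
  case 0
  then show ?case using assms(2) conj_products_closed by simp
next
  case (Suc m)
  then obtain g x y' where gx: "g \<in> carrier H" "x \<in> carrier H" "x \<in> X \<or> inv\<^bsub>H\<^esub> x \<in> X"
    "y' \<in> conj_products H X m" "y = (inv\<^bsub>H\<^esub> g \<otimes>\<^bsub>H\<^esub> x \<otimes>\<^bsub>H\<^esub> g) \<otimes>\<^bsub>H\<^esub> y'" by auto
  have "y \<otimes>\<^bsub>H\<^esub> z = (inv\<^bsub>H\<^esub> g \<otimes>\<^bsub>H\<^esub> x \<otimes>\<^bsub>H\<^esub> g) \<otimes>\<^bsub>H\<^esub> (y' \<otimes>\<^bsub>H\<^esub> z)"
    unfolding gx(5) using gx(1,2) conj_products_closed[OF gx(4)] conj_products_closed[OF assms(2)]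
    by (simp add: H.m_assoc)
  then show ?case using gx(1-3) Suc.IH[OF gx(4)] by auto
qed

lemma conj_products_conj:
  assumes "y \<in> conj_products H X n" "k \<in> carrier H"
  shows "k \<otimes>\<^bsub>H\<^esub> y \<otimes>\<^bsub>H\<^esub> inv\<^bsub>H\<^esub> k \<in> conj_products H X n"
  using assms(1)
proof (induction n arbitrary: y)
  case 0
  then show ?case using assms(2) by simp
next
  case (Suc n)
  then obtain g x y' where gx: "g \<in> carrier H" "x \<in> carrier H" "x \<in> X \<or> inv\<^bsub>H\<^esub> x \<in> X"
    "y' \<in> conj_products H X n" "y = (inv\<^bsub>H\<^esub> g \<otimes>\<^bsub>H\<^esub> x \<otimes>\<^bsub>H\<^esub> g) \<otimes>\<^bsub>H\<^esub> y'" by auto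
  let ?l = "g \<otimes>\<^bsub>H\<^esub> inv\<^bsub>H\<^esub> k"
  have "k \<otimes>\<^bsub>H\<^esub> y \<otimes>\<^bsub>H\<^esub> inv\<^bsub>H\<^esub> k =
      (inv\<^bsub>H\<^esub> ?l \<otimes>\<^bsub>H\<^esub> x \<otimes>\<^bsub>H\<^esub> ?l) \<otimes>\<^bsub>H\<^esub> (k \<otimes>\<^bsub>H\<^esub> y' \<otimes>\<^bsub>H\<^esub> inv\<^bsub>H\<^esub> k)"
  proof -
    have "inv\<^bsub>H\<^esub> k \<otimes>\<^bsub>H\<^esub> (k \<otimes>\<^bsub>H\<^esub> u) = u" if "u \<in> carrier H" for u
      using that assms(2) by (simp flip: H.m_assoc)
    then show ?thesis
      unfolding gx(5) using gx(1,2) conj_products_closed[OF gx(4)] assms(2)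
      by (simp add: H.m_assoc H.inv_mult_group)
  qed
  moreover have "?l \<in> carrier H" using gx(1) assms(2) by simp
  ultimately show ?case using gx(2,3) Suc.IH[OF gx(4)] unfolding conj_products.simps mem_Collect_eq by metis
qed

lemma conj_products_inv:
  assumes "y \<in> conj_products H X n"
  shows "inv\<^bsub>H\<^esub> y \<in> conj_products H X n"
  using assms
proof (induction n arbitrary: y)
  case (Suc n)
  then obtain g x y' where gx: "g \<in> carrier H" "x \<in> carrier H" "x \<in> X \<or> inv\<^bsub>H\<^esub> x \<in> X"
    "y' \<in> conj_products H X n" "y = (inv\<^bsub>H\<^esub> g \<otimes>\<^bsub>H\<^esub> x \<otimes>\<^bsub>H\<^esub> g) \<otimes>\<^bsub>H\<^esub> y'" by auto
  have e: "inv\<^bsub>H\<^esub> g \<otimes>\<^bsub>H\<^esub> inv\<^bsub>H\<^esub> x \<otimes>\<^bsub>H\<^esub> g = (inv\<^bsub>H\<^esub> g \<otimes>\<^bsub>H\<^esub> inv\<^bsub>H\<^esub> x \<otimes>\<^bsub>H\<^esub> g) \<otimes>\<^bsub>H\<^esub> \<one>\<^bsub>H\<^esub>"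
    using gx by simp
  have "inv\<^bsub>H\<^esub> x \<in> X \<or> inv\<^bsub>H\<^esub> (inv\<^bsub>H\<^esub> x) \<in> X" using gx(2,3) by auto
  then have "inv\<^bsub>H\<^esub> g \<otimes>\<^bsub>H\<^esub> inv\<^bsub>H\<^esub> x \<otimes>\<^bsub>H\<^esub> g \<in> conj_products H X (Suc 0)"
    unfolding conj_products.simps mem_Collect_eq using gx(1,2) e by (metis H.inv_closed singletonI)
  from conj_products_append[OF Suc.IH[OF gx(4)] this]
  show ?case
    unfolding gx(5) using gx(1,2) conj_products_closed[OF gx(4)]
    by (simp add: H.inv_mult_group H.m_assoc del: conj_products.simps)
qed simp

end

lemma solvable_in_systemsD:
  assumes "solvable_in H (r, k, ws)" "a \<in> {..<r} \<rightarrow> carrier H"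
  shows "\<exists>x \<in> {..<k} \<rightarrow> carrier H. \<forall>w \<in> set ws. word_val H (case_symbol a x) w = \<one>\<^bsub>H\<^esub>"
  using assms by (simp add: solvable_in_def)

lemma word_val_hom_case_symbol:
  assumes "group_hom G H f" "fst ` set w \<subseteq> Const ` {..<r} \<union> Var ` {..<k}"
    and "a \<in> {..<r} \<rightarrow> carrier G" "x \<in> {..<k} \<rightarrow> carrier G"
    and "\<And>i. i < r \<Longrightarrow> b i = f (a i)" "\<And>i. i < k \<Longrightarrow> y i = f (x i)"
  shows "word_val H (case_symbol b y) w = f (word_val G (case_symbol a x) w)"
proof -
  have sym: "(\<exists>i<r. s = Const i) \<or> (\<exists>i<k. s = Var i)" if "s \<in> fst ` set w" for s
    using subsetD[OF assms(2) that] by auto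
  have "word_val H (case_symbol b y) w = word_val H (f \<circ> case_symbol a x) w"
  proof (rule word_val_cong)
    fix s assume "s \<in> fst ` set w"
    from sym[OF this] show "case_symbol b y s = (f \<circ> case_symbol a x) s" using assms(5,6) by auto
  qed
  also have "\<dots> = f (word_val G (case_symbol a x) w)"
  proof (rule word_val_hom[OF assms(1)])
    fix s assume "s \<in> fst ` set w"
    from sym[OF this] show "case_symbol a x s \<in> carrier G" using assms(3,4) by auto
  qed
  finally show ?thesis .
qed

lemma approximable_imp_solvable_over:
  fixes G :: "('a, 'm) monoid_scheme" and K :: "'b monoid set"
  assumes G: "group G" and groups: "\<And>H. H \<in> K \<Longrightarrow> group H"
    and appr: "approximable K G" and S: "S \<in> Sys_class K"
  shows "solvable_over G S"
proof -
  interpret G: group G by fact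
  obtain r k ws where Srk: "S = (r, k, ws)" by (cases S)
  \<comment> \<open>Test data are directed by inclusion and \<open>\<le>\<close>; "eventually" means
    from some pair onward, so no ultrafilter is involved.\<close>
  define I where "I = {(\<Phi>, n :: nat). finite \<Phi> \<and> \<Phi> \<subseteq> carrier G \<and> \<one>\<^bsub>G\<^esub> \<in> \<Phi>}"
  define X where "X H \<phi> \<Phi> = {\<phi> g \<otimes>\<^bsub>H\<^esub> \<phi> h \<otimes>\<^bsub>H\<^esub> inv\<^bsub>H\<^esub> (\<phi> (g \<otimes>\<^bsub>G\<^esub> h)) | g h.
              g \<in> \<Phi> \<and> h \<in> \<Phi> \<and> g \<otimes>\<^bsub>G\<^esub> h \<in> \<Phi>}" for H :: "'b monoid" and \<phi> :: "'a \<Rightarrow> 'b" and \<Phi>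
  have "\<exists>H \<phi>. H \<in> K \<and> unital_map G (fst i) H \<phi> \<and> (\<forall>g \<in> fst i - {\<one>\<^bsub>G\<^esub>}. \<phi> g \<notin> conj_products H (X H \<phi> (fst i)) (snd i))"
    if i: "i \<in> I" for i
  proof -
    have "finite (fst i) \<and> fst i \<subseteq> carrier G" and one: "\<one>\<^bsub>G\<^esub> \<in> fst i" using i by (auto simp: I_def)
    from appr[unfolded approximable_def, rule_format, OF this(1), of "snd i", folded X_def]
    obtain H \<phi> where H: "H \<in> K" "\<phi> \<in> fst i \<rightarrow> carrier H" "\<one>\<^bsub>G\<^esub> \<in> fst i \<longrightarrow> \<phi> \<one>\<^bsub>G\<^esub> = \<one>\<^bsub>H\<^esub>"
      "separated H (snd i) (\<phi> ` (fst i - {\<one>\<^bsub>G\<^esub>})) (X H \<phi> (fst i))" by auto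
    have "unital_map G (fst i) H \<phi>" using H(2,3) one by (simp add: unital_map_def)
    moreover have "\<forall>g \<in> fst i - {\<one>\<^bsub>G\<^esub>}. \<phi> g \<notin> conj_products H (X H \<phi> (fst i)) (snd i)"
      using H(4) unfolding separated_def by blast
    ultimately show ?thesis using H(1) by metis
  qed
  then obtain H \<phi> where H: "\<And>i. i \<in> I \<Longrightarrow> H i \<in> K" and \<phi>: "\<And>i. i \<in> I \<Longrightarrow> unital_map G (fst i) (H i) (\<phi> i)"
    and sep: "\<And>i g. i \<in> I \<Longrightarrow> g \<in> fst i - {\<one>\<^bsub>G\<^esub>} \<Longrightarrow> \<phi> i g \<notin> conj_products (H i) (X (H i) (\<phi> i) (fst i)) (snd i)"
    by metis
  define Y where "Y i = X (H i) (\<phi> i) (fst i)" for i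
  have gH: "group (H i)" if "i \<in> I" for i using groups[OF H[OF that]] .
  have Y: "Y i \<subseteq> carrier (H i)" if "i \<in> I" for i
  proof
    fix v assume "v \<in> Y i"
    then obtain g h where "v = \<phi> i g \<otimes>\<^bsub>H i\<^esub> \<phi> i h \<otimes>\<^bsub>H i\<^esub> inv\<^bsub>H i\<^esub> (\<phi> i (g \<otimes>\<^bsub>G\<^esub> h))" "g \<in> fst i" "h \<in> fst i" "g \<otimes>\<^bsub>G\<^esub> h \<in> fst i"
      by (auto simp: Y_def X_def)
    then show "v \<in> carrier (H i)"
      using unital_map_in[OF \<phi>[OF that]] gH[OF that] by (simp add: group.inv_closed monoid.m_closed group.is_monoid)
  qed
  define P where "P = product_group I H"
  interpret P: group P unfolding P_def using gH by (rule product_group)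
  have proj: "group_hom P (H i) (\<lambda>p. p i)" if "i \<in> I" for i
    unfolding P_def using gH that by (rule group_hom_proj)
  have Pi: "p i \<in> carrier (H i)" if "p \<in> carrier P" "i \<in> I" for p i
    using group_hom.hom_closed[OF proj[OF that(2)] that(1)] .
  have Pmult: "(p \<otimes>\<^bsub>P\<^esub> q) i = p i \<otimes>\<^bsub>H i\<^esub> q i" if "p \<in> carrier P" "q \<in> carrier P" "i \<in> I" for p q i
    using group_hom.hom_mult[OF proj[OF that(3)] that(1,2)] .
  have Pinv: "(inv\<^bsub>P\<^esub> p) i = inv\<^bsub>H i\<^esub> p i" if "p \<in> carrier P" "i \<in> I" for p i
    using group_hom.hom_inv[OF proj[OF that(2)] that(1)] .
  \<comment> \<open>The same \<open>m\<close> is the threshold for the index and the number of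
    factors; in a product of two elements both roles add up to \<open>m + n\<close>.\<close>
  define small where "small p \<Phi> m \<longleftrightarrow> (\<forall>i\<in>I. \<Phi> \<subseteq> fst i \<longrightarrow> m \<le> snd i \<longrightarrow> p i \<in> conj_products (H i) (Y i) m)" for p \<Phi> m
  define N where "N = {p \<in> carrier P. \<exists>\<Phi> m. (\<Phi>, m) \<in> I \<and> small p \<Phi> m}"
  have NI: "p \<in> N" if "p \<in> carrier P" "(\<Phi>, m) \<in> I" "small p \<Phi> m" for p \<Phi> m
    using that unfolding N_def by blast
  have NE: "\<exists>\<Phi> m. (\<Phi>, m) \<in> I \<and> small p \<Phi> m" if "p \<in> N" for p
    using that unfolding N_def by blast
  have base: "({\<one>\<^bsub>G\<^esub>}, 0) \<in> I" by (simp add: I_def)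
  have "subgroup N P"
  proof (rule P.subgroupI)
    show "N \<subseteq> carrier P" by (auto simp: N_def)
    have "small \<one>\<^bsub>P\<^esub> {\<one>\<^bsub>G\<^esub>} 0"
      unfolding small_def using group_hom.hom_one[OF proj] by simp
    then show "N \<noteq> {}" using NI[OF P.one_closed base] by blast
    fix p assume p: "p \<in> N"
    then obtain \<Phi> m where m: "(\<Phi>, m) \<in> I" "small p \<Phi> m" using NE by metis
    have pP: "p \<in> carrier P" using p by (simp add: N_def)
    have "small (inv\<^bsub>P\<^esub> p) \<Phi> m"
      using m(2) Pinv[OF pP] conj_products_inv[OF gH Y] by (simp add: small_def)
    then show "inv\<^bsub>P\<^esub> p \<in> N" using NI[OF P.inv_closed[OF pP] m(1)] by simp
    fix q assume q: "q \<in> N"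
    then obtain \<Psi> n where n: "(\<Psi>, n) \<in> I" "small q \<Psi> n" using NE by metis
    have qP: "q \<in> carrier P" using q by (simp add: N_def)
    have "small (p \<otimes>\<^bsub>P\<^esub> q) (\<Phi> \<union> \<Psi>) (m + n)"
      using m(2) n(2) Pmult[OF pP qP] conj_products_append[OF gH Y] by (simp add: small_def)
    moreover have "(\<Phi> \<union> \<Psi>, m + n) \<in> I" using m(1) n(1) by (simp add: I_def)
    ultimately show "p \<otimes>\<^bsub>P\<^esub> q \<in> N" using NI P.m_closed[OF pP qP] by metis
  qed
  moreover have "q \<otimes>\<^bsub>P\<^esub> p \<otimes>\<^bsub>P\<^esub> inv\<^bsub>P\<^esub> q \<in> N" if q: "q \<in> carrier P" and p: "p \<in> N" for p q
  proof -
    obtain \<Phi> m where m: "(\<Phi>, m) \<in> I" "small p \<Phi> m" using NE p by metis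
    have pP: "p \<in> carrier P" using p by (simp add: N_def)
    have "small (q \<otimes>\<^bsub>P\<^esub> p \<otimes>\<^bsub>P\<^esub> inv\<^bsub>P\<^esub> q) \<Phi> m"
      using m(2) q pP by (simp add: small_def Pmult Pinv Pi conj_products_conj[OF gH Y])
    then show ?thesis using NI q pP m(1) by (metis P.inv_closed P.m_closed)
  qed
  ultimately have N: "N \<lhd> P" by (rule P.normal_invI)
  interpret N: normal N P by (rule N)
  define Q where "Q = P Mod N"
  have Q: "group Q" unfolding Q_def by (rule N.factorgroup_is_group)
  define \<pi> where "\<pi> = (\<lambda>p. N #>\<^bsub>P\<^esub> p)"
  have "\<pi> \<in> hom P Q" unfolding \<pi>_def Q_def by (rule N.r_coset_hom_Mod)
  then have \<pi>: "group_hom P Q \<pi>" using Q P.group_axioms by (simp add: group_hom_def group_hom_axioms_def)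
  have \<pi>_one: "\<pi> p = \<one>\<^bsub>Q\<^esub> \<longleftrightarrow> p \<in> N" if "p \<in> carrier P" for p
    using P.coset_join1[OF _ that N.subgroup_axioms] P.coset_join2[OF that N.subgroup_axioms]
    by (auto simp: \<pi>_def Q_def)
  \<comment> \<open>The default occurs only at indices whose finite set misses \<open>g\<close>; the
    tail conditions used below concern sets that contain the elements in question.\<close>
  define \<psi> where "\<psi> g = (\<lambda>i\<in>I. if g \<in> fst i then \<phi> i g else \<one>\<^bsub>H i\<^esub>)" for g
  have "(if g \<in> fst i then \<phi> i g else \<one>\<^bsub>H i\<^esub>) \<in> carrier (H i)" if "i \<in> I" for g i
    using unital_map_in[OF \<phi>[OF that], of g] monoid.one_closed[OF group.is_monoid[OF gH[OF that]]] by simp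
  then have \<psi>: "\<psi> g \<in> carrier P" for g
    by (simp add: P_def \<psi>_def)
  interpret \<pi>: group_hom P Q \<pi> by (rule \<pi>)
  define \<iota> where "\<iota> g = \<pi> (\<psi> g)" for g
  have "\<iota> (g \<otimes>\<^bsub>G\<^esub> h) = \<iota> g \<otimes>\<^bsub>Q\<^esub> \<iota> h" if g: "g \<in> carrier G" and h: "h \<in> carrier G" for g h
  proof -
    \<comment> \<open>At late indices this is one of the defects in \<open>Y i\<close>, hence a
      product of a single conjugate, and it dies in the quotient.\<close>
    let ?d = "\<psi> g \<otimes>\<^bsub>P\<^esub> \<psi> h \<otimes>\<^bsub>P\<^esub> inv\<^bsub>P\<^esub> \<psi> (g \<otimes>\<^bsub>G\<^esub> h)"
    have "?d i \<in> conj_products (H i) (Y i) (Suc 0)"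
      if i: "i \<in> I" "{\<one>\<^bsub>G\<^esub>, g, h, g \<otimes>\<^bsub>G\<^esub> h} \<subseteq> fst i" for i
    proof -
      interpret Hi: group "H i" using gH[OF i(1)] .
      have d: "?d i = \<phi> i g \<otimes>\<^bsub>H i\<^esub> \<phi> i h \<otimes>\<^bsub>H i\<^esub> inv\<^bsub>H i\<^esub> \<phi> i (g \<otimes>\<^bsub>G\<^esub> h)"
        using i by (simp add: Pmult Pinv \<psi>) (simp add: \<psi>_def)
      then have dY: "?d i \<in> Y i" using i(2) unfolding Y_def X_def by blast
      then have dc: "?d i \<in> carrier (H i)" using Y[OF i(1)] by blast
      then have "?d i = (inv\<^bsub>H i\<^esub> \<one>\<^bsub>H i\<^esub> \<otimes>\<^bsub>H i\<^esub> ?d i \<otimes>\<^bsub>H i\<^esub> \<one>\<^bsub>H i\<^esub>) \<otimes>\<^bsub>H i\<^esub> \<one>\<^bsub>H i\<^esub>" by simp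
      then show ?thesis unfolding conj_products.simps mem_Collect_eq using dY dc by (metis Hi.one_closed singletonI)
    qed
    then have "small ?d {\<one>\<^bsub>G\<^esub>, g, h, g \<otimes>\<^bsub>G\<^esub> h} (Suc 0)" unfolding small_def by blast
    moreover have "({\<one>\<^bsub>G\<^esub>, g, h, g \<otimes>\<^bsub>G\<^esub> h}, Suc 0) \<in> I" using g h by (simp add: I_def)
    moreover have dP: "?d \<in> carrier P" using \<psi> by simp
    ultimately have "?d \<in> N" using NI by metis
    then have "\<pi> ?d = \<one>\<^bsub>Q\<^esub>" by (rule iffD2[OF \<pi>_one[OF dP]])
    then have "\<iota> g \<otimes>\<^bsub>Q\<^esub> \<iota> h \<otimes>\<^bsub>Q\<^esub> inv\<^bsub>Q\<^esub> \<iota> (g \<otimes>\<^bsub>G\<^esub> h) = \<one>\<^bsub>Q\<^esub>"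
      using \<psi> by (simp add: \<iota>_def)
    moreover have "\<iota> k \<in> carrier Q" for k using \<psi> by (simp add: \<iota>_def)
    ultimately show ?thesis by (metis \<pi>.H.inv_closed \<pi>.H.inv_equality \<pi>.H.inv_inv \<pi>.H.m_closed)
  qed
  then have hom: "\<iota> \<in> hom G Q" using \<psi> by (simp add: hom_def \<iota>_def)
  have "g = \<one>\<^bsub>G\<^esub>" if g: "g \<in> carrier G" "\<iota> g = \<one>\<^bsub>Q\<^esub>" for g
  proof (rule ccontr)
    assume ne: "g \<noteq> \<one>\<^bsub>G\<^esub>"
    have "\<psi> g \<in> N" using g(2) \<pi>_one \<psi> by (simp add: \<iota>_def)
    then obtain \<Phi> m where m: "(\<Phi>, m) \<in> I" "small (\<psi> g) \<Phi> m" using NE by metis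
    \<comment> \<open>At this index separation excludes precisely the products of \<open>m\<close>
      conjugates for which \<open>small\<close> vouches.\<close>
    have i: "(insert g \<Phi>, m) \<in> I" using m(1) g(1) by (simp add: I_def)
    have "\<psi> g (insert g \<Phi>, m) \<in> conj_products (H (insert g \<Phi>, m)) (Y (insert g \<Phi>, m)) m"
      using m(2) i unfolding small_def by (metis fst_conv le_refl snd_conv subset_insertI)
    then show False using sep[OF i, of g] ne i by (simp add: \<psi>_def Y_def)
  qed
  then have mon: "\<iota> \<in> mon G Q" using hom by (simp add: mon_iff_hom_one[OF G Q])
  \<comment> \<open>Over an empty \<open>K\<close> the intersection \<open>Sys_class K\<close> would
    contain every triple; a member of \<open>K\<close> certifies that \<open>S\<close> is a
    system.\<close>
  have "\<exists>i. i \<in> I" using base by blast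
  then have sys: "S \<in> systems" using S H unfolding Sys_class_def Sys_def by blast
  have sol: "solvable_in (H i) (r, k, ws)" if "i \<in> I" for i
    using S H[OF that] unfolding Sys_class_def Sys_def Srk by blast
  have sym: "fst ` set w \<subseteq> Const ` {..<r} \<union> Var ` {..<k}" if "w \<in> set ws" for w
    using sys that unfolding Srk systems_def free_group_elems_def by blast
  show ?thesis
    unfolding Srk
  proof (rule solvable_overI[OF sys[unfolded Srk] G Q mon])
    fix a assume a: "a \<in> {..<r} \<rightarrow> carrier G"
    \<comment> \<open>The constants are lifted to \<open>\<psi> (a j)\<close> and the system is
      solved in each coordinate; the quotient map then carries the combined solution to one for
      \<open>\<iota> \<circ> a\<close>.\<close>
    have "\<exists>x. x \<in> {..<k} \<rightarrow> carrier (H i) \<and> (\<forall>w \<in> set ws. word_val (H i) (case_symbol (\<lambda>j. \<psi> (a j) i) x) w = \<one>\<^bsub>H i\<^esub>)"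
      if i: "i \<in> I" for i
      using solvable_in_systemsD[OF sol[OF i], of "\<lambda>j. \<psi> (a j) i"] Pi[OF \<psi> i] by blast
    then obtain x where x: "\<And>i. i \<in> I \<Longrightarrow> x i \<in> {..<k} \<rightarrow> carrier (H i)"
      "\<And>i w. i \<in> I \<Longrightarrow> w \<in> set ws \<Longrightarrow> word_val (H i) (case_symbol (\<lambda>j. \<psi> (a j) i) (x i)) w = \<one>\<^bsub>H i\<^esub>"
      by metis
    define y where "y j = (\<lambda>i\<in>I. x i j)" for j
    have y: "y \<in> {..<k} \<rightarrow> carrier P"
    proof -
      have "x i j \<in> carrier (H i)" if "i \<in> I" "j < k" for i j using x(1)[OF that(1)] that(2) by auto
      then show ?thesis by (simp add: Pi_iff y_def P_def)
    qed
    have \<psi>a: "(\<lambda>j. \<psi> (a j)) \<in> {..<r} \<rightarrow> carrier P" using \<psi> by simp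
    have val: "word_val Q (case_symbol (\<iota> \<circ> a) (\<lambda>j. \<pi> (y j))) w = \<one>\<^bsub>Q\<^esub>" if w: "w \<in> set ws" for w
    proof -
      let ?v = "word_val P (case_symbol (\<lambda>j. \<psi> (a j)) y) w"
      have "?v \<in> carrier P"
      proof (rule word_val_closed[OF P.group_axioms])
        fix s assume "s \<in> fst ` set w"
        then have "s \<in> Const ` {..<r} \<union> Var ` {..<k}" using sym[OF w] by (rule rev_subsetD)
        then show "case_symbol (\<lambda>j. \<psi> (a j)) y s \<in> carrier P" using y \<psi> by auto
      qed
      moreover have "?v i = \<one>\<^bsub>H i\<^esub>" if i: "i \<in> I" for i
        using word_val_hom_case_symbol[OF proj[OF i] sym[OF w] \<psi>a y, of "\<lambda>j. \<psi> (a j) i" "x i"] i x(2)[OF i w]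
        by (simp add: y_def)
      ultimately have "?v = \<one>\<^bsub>P\<^esub>"
        unfolding P_def by (intro PiE_ext[of _ I "\<lambda>i. carrier (H i)"]) (use P.one_closed in \<open>simp_all add: P_def\<close>)
      then show ?thesis
        using word_val_hom_case_symbol[OF \<pi> sym[OF w] \<psi>a y, of "\<iota> \<circ> a" "\<lambda>j. \<pi> (y j)"] by (simp add: \<iota>_def)
    qed
    show "\<exists>x\<in>{..<k} \<rightarrow> carrier Q. \<forall>w\<in>set ws. word_val Q (case_symbol (\<iota> \<circ> a) x) w = \<one>\<^bsub>Q\<^esub>"
    proof (rule bexI)
      show "(\<lambda>j. \<pi> (y j)) \<in> {..<k} \<rightarrow> carrier Q" by (intro Pi_I \<pi>.hom_closed funcset_mem[OF y])
    qed (use val in blast)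
  qed
qed

section \<open>Classes closed under finite products\<close>

lemma iso_imp_group_hom: "group G \<Longrightarrow> group H \<Longrightarrow> f \<in> iso G H \<Longrightarrow> group_hom G H f"
  by (simp add: group_hom_def group_hom_axioms_def iso_def)

text \<open>The classes live at carrier type \<open>nat\<close>, whereas products and permutation
  groups have functions as elements.\<close>

lemma ex_nat_copy:
  assumes "group P" "finite (carrier P)"
  shows "\<exists>(L :: nat monoid) f. group L \<and> f \<in> iso P L"
proof -
  obtain f :: "'a \<Rightarrow> nat" where f: "inj_on f (carrier P)"
    using finite_imp_inj_to_nat_seg[OF assms(2)] by metis
  show ?thesis
    using group.inj_imp_image_group_is_group[OF assms(1) f] inj_imp_image_group_iso[OF f] by metis
qed

lemma pat_set_iso:
  assumes G: "group H" "group L" and f: "f \<in> iso H L" and \<phi>: "unital_map G \<Phi> H \<phi>" and s: "s \<in> patterns G \<Phi>"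
    and k: "k \<in> \<Phi>" and mem: "f (\<phi> k) \<in> pat_set G L (\<lambda>g. f (\<phi> g)) s"
  shows "\<phi> k \<in> pat_set G H \<phi> s"
proof -
  define f' where "f' = inv_into (carrier H) f"
  have inj: "inj_on f (carrier H)" using f by (simp add: iso_def bij_betw_def)
  have f': "f' (f (\<phi> g)) = \<phi> g" if "g \<in> \<Phi>" for g
    unfolding f'_def by (rule inv_into_f_f[OF inj unital_map_in[OF \<phi> that]])
  have "f' \<in> iso L H" unfolding f'_def by (rule group.iso_set_sym[OF G(1) f])
  then have hom: "group_hom L H f'" by (rule iso_imp_group_hom[OF G(2,1)])
  have "unital_map G \<Phi> L (\<lambda>g. f (\<phi> g))"
    by (rule unital_map_hom[OF G(1) \<phi> iso_imp_group_hom[OF G f]])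
  from pat_set_hom[OF G(2) this hom s mem]
  have "f' (f (\<phi> k)) \<in> pat_set G H (\<lambda>g. f' (f (\<phi> g))) s" .
  also have "pat_set G H (\<lambda>g. f' (f (\<phi> g))) s = pat_set G H \<phi> s" by (rule pat_set_cong[OF s f'])
  finally show ?thesis by (simp only: f'[OF k])
qed

lemma group_hom_comp:
  assumes "group_hom A B f" "group_hom B C g"
  shows "group_hom A C (\<lambda>x. g (f x))"
  using assms by (auto simp: group_hom_def group_hom_axioms_def hom_def)

lemma lower_central_subset: "group H \<Longrightarrow> lower_central H n \<subseteq> carrier H"
proof (induction n)
  case (Suc n)
  interpret group H by fact
  show ?case using Suc.IH[OF Suc.prems] unfolding lower_central.simps by (intro generate_incl) auto
qed simp

lemma one_in_lower_central: "group H \<Longrightarrow> \<one>\<^bsub>H\<^esub> \<in> lower_central H n"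
  by (cases n) (simp_all add: generate.one group.is_monoid)

lemma lower_central_hom:
  assumes "group_hom L H f"
  shows "f ` lower_central L n \<subseteq> lower_central H n"
proof (induction n)
  case 0
  then show ?case using group_hom.hom_closed[OF assms] by auto
next
  case (Suc n)
  interpret group_hom L H f by fact
  let ?A = "{x \<otimes>\<^bsub>L\<^esub> y \<otimes>\<^bsub>L\<^esub> inv\<^bsub>L\<^esub> x \<otimes>\<^bsub>L\<^esub> inv\<^bsub>L\<^esub> y | x y. x \<in> lower_central L n \<and> y \<in> carrier L}"
  let ?B = "{x \<otimes>\<^bsub>H\<^esub> y \<otimes>\<^bsub>H\<^esub> inv\<^bsub>H\<^esub> x \<otimes>\<^bsub>H\<^esub> inv\<^bsub>H\<^esub> y | x y. x \<in> lower_central H n \<and> y \<in> carrier H}"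
  have sub: "x \<in> carrier L" if "x \<in> lower_central L n" for x
    using lower_central_subset[of L n] that by auto
  have A: "?A \<subseteq> carrier L" using sub by auto
  have "f ` ?A \<subseteq> ?B"
  proof
    fix v assume "v \<in> f ` ?A"
    then obtain x y where xy: "x \<in> lower_central L n" "y \<in> carrier L"
      "v = f (x \<otimes>\<^bsub>L\<^esub> y \<otimes>\<^bsub>L\<^esub> inv\<^bsub>L\<^esub> x \<otimes>\<^bsub>L\<^esub> inv\<^bsub>L\<^esub> y)" by auto
    have "v = f x \<otimes>\<^bsub>H\<^esub> f y \<otimes>\<^bsub>H\<^esub> inv\<^bsub>H\<^esub> f x \<otimes>\<^bsub>H\<^esub> inv\<^bsub>H\<^esub> f y" using xy sub by simp
    moreover have "f x \<in> lower_central H n" using Suc.IH xy(1) by blast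
    moreover have "f y \<in> carrier H" using xy(2) by simp
    ultimately show "v \<in> ?B" by blast
  qed
  then have "generate H (f ` ?A) \<subseteq> generate H ?B" by (rule H.mono_generate)
  then show ?case unfolding lower_central.simps by (simp only: generate_img[OF A, symmetric])
qed

lemma lower_central_trivial_mono:
  assumes "group H" "lower_central H m = {\<one>\<^bsub>H\<^esub>}" "m \<le> n"
  shows "lower_central H n = {\<one>\<^bsub>H\<^esub>}"
  using assms(3)
proof (induction rule: dec_induct)
  case base
  then show ?case by (rule assms(2))
next
  case (step n)
  interpret group H by fact
  have "lower_central H (Suc n) \<subseteq> generate H {\<one>\<^bsub>H\<^esub>}"
    unfolding lower_central.simps step.IH by (rule mono_generate) auto
  also have "\<dots> = {\<one>\<^bsub>H\<^esub>}" by (rule generate_one)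
  finally show ?case using one_in_lower_central[OF assms(1), of "Suc n"] by (intro equalityI) auto
qed

lemma ex_uniform_bound:
  assumes "finite I" "\<And>i. i \<in> I \<Longrightarrow> \<exists>n :: nat. P i n" "\<And>i m n. P i m \<Longrightarrow> m \<le> n \<Longrightarrow> P i n"
  shows "\<exists>n. \<forall>i\<in>I. P i n"
proof -
  obtain f where f: "\<And>i. i \<in> I \<Longrightarrow> P i (f i)" using assms(2) by metis
  have "\<forall>i\<in>I. P i (Max (f ` I))" using assms(1,3) f by (metis Max_ge finite_imageI imageI)
  then show ?thesis by blast
qed

text \<open>Finitely many nilpotency classes have a common bound \<open>n\<close>, and the
  \<open>n\<close>-th lower central term is then killed by every \<open>q i\<close>. Derived series
  behave in the same way.\<close>

lemma nilpotent_if_jointly_embedded: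
  assumes "group L" "finite I" and hom: "\<And>i. i \<in> I \<Longrightarrow> group_hom L (H i) (q i)"
    and nil: "\<And>i. i \<in> I \<Longrightarrow> nilpotent (H i)"
    and inj: "\<And>x. x \<in> carrier L \<Longrightarrow> (\<And>i. i \<in> I \<Longrightarrow> q i x = \<one>\<^bsub>H i\<^esub>) \<Longrightarrow> x = \<one>\<^bsub>L\<^esub>"
  shows "nilpotent L"
proof -
  have gH: "group (H i)" if "i \<in> I" for i using hom[OF that] by (simp add: group_hom_def)
  \<comment> \<open>The guard makes the property monotone in \<open>n\<close> for every
    \<open>i\<close>, as \<open>ex_uniform_bound\<close> demands also outside
    \<open>I\<close>.\<close>
  have "\<exists>n. \<forall>i\<in>I. group (H i) \<longrightarrow> lower_central (H i) n = {\<one>\<^bsub>H i\<^esub>}"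
  proof (rule ex_uniform_bound[OF assms(2)])
    show "\<exists>n. group (H i) \<longrightarrow> lower_central (H i) n = {\<one>\<^bsub>H i\<^esub>}" if "i \<in> I" for i
      using nil[OF that] unfolding nilpotent_def by blast
  qed (use lower_central_trivial_mono in blast)
  then obtain n where n: "\<And>i. i \<in> I \<Longrightarrow> lower_central (H i) n = {\<one>\<^bsub>H i\<^esub>}" using gH by blast
  have "x = \<one>\<^bsub>L\<^esub>" if x: "x \<in> lower_central L n" for x
  proof (rule inj)
    show "x \<in> carrier L" using lower_central_subset[OF assms(1)] x by blast
    show "q i x = \<one>\<^bsub>H i\<^esub>" if "i \<in> I" for i
      using lower_central_hom[OF hom[OF that], of n] x n[OF that] by blast
  qed
  then have "lower_central L n = {\<one>\<^bsub>L\<^esub>}" using one_in_lower_central[OF assms(1)] by blast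
  then show ?thesis unfolding nilpotent_def by blast
qed

lemma derived_series_trivial_mono:
  assumes "group H" "(derived H ^^ m) (carrier H) = {\<one>\<^bsub>H\<^esub>}" "m \<le> n"
  shows "(derived H ^^ n) (carrier H) = {\<one>\<^bsub>H\<^esub>}"
  using assms(3)
proof (induction rule: dec_induct)
  case base
  then show ?case by (rule assms(2))
next
  case (step n)
  interpret group H by fact
  have "derived H {\<one>\<^bsub>H\<^esub>} \<subseteq> {\<one>\<^bsub>H\<^esub>}" by (rule derived_incl[OF order.refl triv_subgroup])
  moreover have "\<one>\<^bsub>H\<^esub> \<in> derived H {\<one>\<^bsub>H\<^esub>}"
    using subgroup.one_closed[OF derived_is_subgroup[of "{\<one>\<^bsub>H\<^esub>}"]] by simp
  ultimately show ?case using step.IH by auto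
qed

lemma solvable_if_jointly_embedded:
  assumes "group L" "finite I" and hom: "\<And>i. i \<in> I \<Longrightarrow> group_hom L (H i) (q i)"
    and sol: "\<And>i. i \<in> I \<Longrightarrow> solvable (H i)"
    and inj: "\<And>x. x \<in> carrier L \<Longrightarrow> (\<And>i. i \<in> I \<Longrightarrow> q i x = \<one>\<^bsub>H i\<^esub>) \<Longrightarrow> x = \<one>\<^bsub>L\<^esub>"
  shows "solvable L"
proof -
  interpret L: group L by fact
  have gH: "group (H i)" if "i \<in> I" for i using hom[OF that] by (simp add: group_hom_def)
  have "\<exists>n. \<forall>i\<in>I. group (H i) \<longrightarrow> (derived (H i) ^^ n) (carrier (H i)) = {\<one>\<^bsub>H i\<^esub>}"
  proof (rule ex_uniform_bound[OF assms(2)])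
    show "\<exists>n. group (H i) \<longrightarrow> (derived (H i) ^^ n) (carrier (H i)) = {\<one>\<^bsub>H i\<^esub>}" if "i \<in> I" for i
      using sol[OF that] unfolding group.solvable_iff_trivial_derived_seq[OF gH[OF that]] by blast
  qed (use derived_series_trivial_mono in blast)
  then obtain n where n: "\<And>i. i \<in> I \<Longrightarrow> (derived (H i) ^^ n) (carrier (H i)) = {\<one>\<^bsub>H i\<^esub>}" using gH by blast
  have "subgroup ((derived L ^^ n) (carrier L)) L" by (rule L.exp_of_derived_is_subgroup[OF L.subgroup_self])
  note sub = subgroup.subset[OF this] and one = subgroup.one_closed[OF this]
  have "x = \<one>\<^bsub>L\<^esub>" if x: "x \<in> (derived L ^^ n) (carrier L)" for x
  proof (rule inj)
    show "x \<in> carrier L" using sub x by blast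
    show "q i x = \<one>\<^bsub>H i\<^esub>" if i: "i \<in> I" for i
    proof -
      interpret group_hom L "H i" "q i" by (rule hom[OF i])
      have "q i ` ((derived L ^^ n) (carrier L)) = (derived (H i) ^^ n) (q i ` carrier L)"
        by (rule exp_of_derived_img[OF order.refl, symmetric])
      also have "\<dots> \<subseteq> (derived (H i) ^^ n) (carrier (H i))"
        by (rule H.mono_exp_of_derived) auto
      finally show ?thesis using x n[OF i] by blast
    qed
  qed
  then have "(derived L ^^ n) (carrier L) = {\<one>\<^bsub>L\<^esub>}" using one by blast
  then show ?thesis using L.solvable_iff_trivial_derived_seq by blast
qed

lemma product_closed:
  fixes K :: "nat monoid set"
  assumes K: "K \<in> {Nil_groups, Sol_groups, Fin_groups}" and I: "finite I" and H: "\<And>i. i \<in> I \<Longrightarrow> H i \<in> K"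
  shows "\<exists>L\<in>K. \<exists>f. f \<in> iso (product_group I H) L"
proof -
  have gH: "group (H i)" "finite (carrier (H i))" if "i \<in> I" for i
    using H[OF that] K by (auto simp: Nil_groups_def Sol_groups_def Fin_groups_def)
  define P where "P = product_group I H"
  have P: "group P" unfolding P_def using gH(1) by (rule product_group)
  have finP: "finite (carrier P)" unfolding P_def carrier_product_group using I gH(2) by (rule finite_PiE)
  obtain L :: "nat monoid" and f where L: "group L" and f: "f \<in> iso P L"
    using ex_nat_copy[OF P finP] by metis
  have bij: "bij_betw f (carrier P) (carrier L)" using f by (simp add: iso_def)
  then have finL: "finite (carrier L)" using finP bij_betw_finite by blast
  define h where "h = inv_into (carrier P) f"
  have hiso: "h \<in> iso L P" unfolding h_def by (rule group.iso_set_sym[OF P f])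
  then have h: "group_hom L P h" by (rule iso_imp_group_hom[OF L P])
  have proj: "group_hom L (H i) (\<lambda>x. h x i)" if "i \<in> I" for i
    by (rule group_hom_comp[OF h[unfolded P_def] group_hom_proj[of I H, OF gH(1) that]])
  have inj: "x = \<one>\<^bsub>L\<^esub>" if x: "x \<in> carrier L" "\<And>i. i \<in> I \<Longrightarrow> h x i = \<one>\<^bsub>H i\<^esub>" for x
  proof -
    have "h x \<in> carrier P" using group_hom.hom_closed[OF h x(1)] .
    then have "h x = \<one>\<^bsub>P\<^esub>"
      unfolding P_def by (intro PiE_ext[of _ I "\<lambda>i. carrier (H i)"])
        (use monoid.one_closed[OF group.is_monoid[OF P]] x(2) in \<open>simp_all add: P_def\<close>)
    moreover have "inj_on h (carrier L)" using hiso by (simp add: iso_def bij_betw_def)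
    ultimately show ?thesis using group_hom.inj_on_one_iff[OF h] x(1) by blast
  qed
  have "L \<in> K"
    using K
  proof (elim insertE emptyE)
    assume "K = Nil_groups"
    moreover from this have "nilpotent L"
      using nilpotent_if_jointly_embedded[OF L I proj _ inj] H by (auto simp: Nil_groups_def)
    ultimately show ?thesis using L finL by (simp add: Nil_groups_def)
  next
    assume "K = Sol_groups"
    moreover from this have "solvable L"
      using solvable_if_jointly_embedded[OF L I proj _ inj] H by (auto simp: Sol_groups_def)
    ultimately show ?thesis using L finL by (simp add: Sol_groups_def)
  next
    assume "K = Fin_groups"
    then show ?thesis using L finL by (simp add: Fin_groups_def)
  qed
  then show ?thesis using f unfolding P_def by metis
qed

lemma unital_map_product:
  assumes "\<And>i. i \<in> I \<Longrightarrow> unital_map G \<Phi> (H i) (\<phi> i)"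
  shows "unital_map G \<Phi> (product_group I H) (\<lambda>g. \<lambda>i\<in>I. \<phi> i g)"
proof -
  have "\<phi> i \<one>\<^bsub>G\<^esub> = \<one>\<^bsub>H i\<^esub>" if "i \<in> I" for i using assms[OF that] by (simp add: unital_map_def)
  then show ?thesis using unital_map_in[OF assms] by (auto simp: unital_map_def[of G \<Phi> "product_group I H"] fun_eq_iff)
qed

lemma finite_patterns_of_length:
  assumes "finite \<Phi>"
  shows "finite {s \<in> patterns G \<Phi>. length s = n}"
proof (rule finite_subset)
  show "{s \<in> patterns G \<Phi>. length s = n} \<subseteq> {s. set s \<subseteq> \<Phi> \<times> \<Phi> \<times> UNIV \<and> length s = n}"
    by (auto simp: patterns_def pairs_def)
  show "finite {s. set s \<subseteq> \<Phi> \<times> \<Phi> \<times> (UNIV :: bool set) \<and> length s = n}"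
    using assms by (intro finite_lists_length_eq) auto
qed

lemma approximable_product_closed:
  fixes G :: "('a, 'm) monoid_scheme" and K :: "nat monoid set"
  assumes K: "K \<in> {Nil_groups, Sol_groups, Fin_groups}" and G: "group G"
    and sol: "\<And>S. S \<in> Sys_class K \<Longrightarrow> solvable_over G S"
  shows "approximable K G"
proof -
  have groups: "group H" if "H \<in> K" for H
    using K that by (auto simp: Nil_groups_def Sol_groups_def Fin_groups_def)
  show ?thesis
  proof (rule approximableI[OF G groups])
    fix \<Phi> :: "'a set" and n
    assume \<Phi>: "finite \<Phi>" "\<Phi> \<subseteq> carrier G" "\<one>\<^bsub>G\<^esub> \<in> \<Phi>"
    \<comment> \<open>One coordinate for each element and pattern to be avoided: a pattern followed
      in the product would be followed in every coordinate.\<close>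
    define T where "T = (\<Phi> - {\<one>\<^bsub>G\<^esub>}) \<times> {s \<in> patterns G \<Phi>. length s = n}"
    have finT: "finite T" unfolding T_def using \<Phi>(1) finite_patterns_of_length[OF \<Phi>(1), of G n] by (intro finite_cartesian_product) simp_all
    have "\<exists>p. fst p \<in> K \<and> unital_map G \<Phi> (fst p) (snd p) \<and> snd p (fst t) \<notin> pat_set G (fst p) (snd p) (snd t)"
      if "t \<in> T" for t
    proof -
      have "fst t \<in> \<Phi> - {\<one>\<^bsub>G\<^esub>}" "snd t \<in> patterns G \<Phi>" using that by (auto simp: T_def)
      from ex_unital_map_avoiding_pattern[OF G groups sol \<Phi> this] obtain H \<phi> where
        "H \<in> K" "unital_map G \<Phi> H \<phi>" "\<phi> (fst t) \<notin> pat_set G H \<phi> (snd t)" by blast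
      then show ?thesis by (intro exI[of _ "(H, \<phi>)"]) simp
    qed
    then obtain F where F: "\<forall>t\<in>T. fst (F t) \<in> K \<and> unital_map G \<Phi> (fst (F t)) (snd (F t)) \<and>
        snd (F t) (fst t) \<notin> pat_set G (fst (F t)) (snd (F t)) (snd t)"
      using bchoice[of T "\<lambda>t p. fst p \<in> K \<and> unital_map G \<Phi> (fst p) (snd p) \<and>
        snd p (fst t) \<notin> pat_set G (fst p) (snd p) (snd t)"] by blast
    define H \<phi> where "H t = fst (F t)" and "\<phi> t = snd (F t)" for t
    have H: "H t \<in> K" and \<phi>: "unital_map G \<Phi> (H t) (\<phi> t)"
      and avoid: "\<phi> t (fst t) \<notin> pat_set G (H t) (\<phi> t) (snd t)" if "t \<in> T" for t
      using F that by (simp_all add: H_def \<phi>_def)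
    have gH: "group (H t)" if "t \<in> T" for t using groups[OF H[OF that]] .
    define P where "P = product_group T H"
    have P: "group P" unfolding P_def using gH by (rule product_group)
    have "\<exists>L\<in>K. \<exists>f. f \<in> iso P L" unfolding P_def by (rule product_closed[OF K finT H])
    then obtain L f where L: "L \<in> K" and f: "f \<in> iso P L" by (elim bexE exE)
    define \<psi> where "\<psi> g = (\<lambda>t\<in>T. \<phi> t g)" for g
    have \<psi>: "unital_map G \<Phi> P \<psi>" unfolding P_def \<psi>_def using \<phi> by (rule unital_map_product)
    have "f (\<psi> k) \<notin> pat_set G L (\<lambda>g. f (\<psi> g)) s"
      if k: "k \<in> \<Phi> - {\<one>\<^bsub>G\<^esub>}" and s: "s \<in> patterns G \<Phi>" "length s = n" for k s
    proof
      assume "f (\<psi> k) \<in> pat_set G L (\<lambda>g. f (\<psi> g)) s"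
      then have mem: "\<psi> k \<in> pat_set G P \<psi> s"
        using k by (intro pat_set_iso[OF P groups[OF L] f \<psi> s(1)]) auto
      have t: "(k, s) \<in> T" using k s by (simp add: T_def)
      have "group_hom P (H (k, s)) (\<lambda>p. p (k, s))"
        unfolding P_def by (rule group_hom_proj[of T H, OF gH t])
      from pat_set_hom[OF P \<psi> this s(1) mem]
      have "\<psi> k (k, s) \<in> pat_set G (H (k, s)) (\<lambda>g. \<psi> g (k, s)) s" .
      then show False using avoid[OF t] t by (simp add: \<psi>_def)
    qed
    moreover have "unital_map G \<Phi> L (\<lambda>g. f (\<psi> g))"
      by (rule unital_map_hom[OF P \<psi> iso_imp_group_hom[OF P groups[OF L] f]])
    ultimately show "\<exists>H\<in>K. \<exists>\<phi>. unital_map G \<Phi> H \<phi> \<and>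
        (\<forall>g \<in> \<Phi> - {\<one>\<^bsub>G\<^esub>}. \<forall>s \<in> patterns G \<Phi>. length s = n \<longrightarrow> \<phi> g \<notin> pat_set G H \<phi> s)"
      using L by blast
  qed
qed

section \<open>Permutation models\<close>

definition perm_group :: "'c set \<Rightarrow> ('c \<Rightarrow> 'c) monoid" where
  "perm_group \<Omega> = \<lparr>carrier = {p. p permutes \<Omega>}, mult = (\<circ>), one = id\<rparr>"

lemma perm_group_simps [simp]:
  "p \<in> carrier (perm_group \<Omega>) \<longleftrightarrow> p permutes \<Omega>"
  "p \<otimes>\<^bsub>perm_group \<Omega>\<^esub> q = p \<circ> q"
  "\<one>\<^bsub>perm_group \<Omega>\<^esub> = id"
  by (simp_all add: perm_group_def)

lemma group_perm_group: "group (perm_group \<Omega>)"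
proof (rule groupI)
  fix p assume "p \<in> carrier (perm_group \<Omega>)"
  then have p: "p permutes \<Omega>" by simp
  show "\<exists>q\<in>carrier (perm_group \<Omega>). q \<otimes>\<^bsub>perm_group \<Omega>\<^esub> p = \<one>\<^bsub>perm_group \<Omega>\<^esub>"
    using permutes_inv[OF p] permutes_inv_o(2)[OF p] by (intro bexI[of _ "inv' p"]) simp_all
qed (auto simp: permutes_compose comp_assoc)

lemma inv_perm_group:
  assumes "p permutes \<Omega>"
  shows "inv\<^bsub>perm_group \<Omega>\<^esub> p = inv' p"
  using assms permutes_inv[OF assms] permutes_inv_o(2)[OF assms]
  by (intro group.inv_equality[OF group_perm_group]) simp_all

lemma card_moved_comp:
  assumes "finite (moved p)" "finite (moved q)"
  shows "card (moved (p \<circ> q)) \<le> card (moved p) + card (moved q)"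
proof -
  have "moved (p \<circ> q) \<subseteq> moved p \<union> moved q" by (auto simp: moved_def)
  then have "card (moved (p \<circ> q)) \<le> card (moved p \<union> moved q)" using assms by (intro card_mono) auto
  then show ?thesis using card_Un_le[of "moved p" "moved q"] by linarith
qed

lemma card_moved_inv:
  assumes "bij p"
  shows "card (moved (inv' p)) = card (moved p)"
proof -
  have "moved (inv' p) = moved p"
    unfolding moved_def using assms by (metis bij_inv_eq_iff)
  then show ?thesis by simp
qed

lemma card_moved_conj:
  assumes "bij y"
  shows "card (moved (inv' y \<circ> p \<circ> y)) = card (moved p)"
proof -
  have "bij_betw y (moved (inv' y \<circ> p \<circ> y)) (moved p)"
  proof (rule bij_betw_imageI)
    show "inj_on y (moved (inv' y \<circ> p \<circ> y))" using bij_is_inj[OF assms] inj_on_subset by blast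
    have e: "(inv' y \<circ> p \<circ> y) a = a \<longleftrightarrow> p (y a) = y a" for a
      using bij_inv_eq_iff[OF assms, of a "p (y a)"] by auto
    then have "moved (inv' y \<circ> p \<circ> y) = {a. y a \<in> moved p}" by (simp only: moved_def mem_Collect_eq)
    moreover have "b \<in> y ` {a. y a \<in> moved p}" if "b \<in> moved p" for b
      using that surj_f_inv_f[OF bij_is_surj[OF assms], of b] by (intro image_eqI[of _ _ "inv' y b"]) simp_all
    ultimately show "y ` moved (inv' y \<circ> p \<circ> y) = moved p" by auto
  qed
  then show ?thesis by (rule bij_betw_same_card)
qed

text \<open>Applied both ways: it bounds the support of a chosen value of a pattern, and it excludes
  elements with larger support.\<close>

lemma card_moved_pat_set:
  assumes fin: "finite \<Omega>" and \<phi>: "unital_map G \<Phi> (perm_group \<Omega>) \<phi>" and s: "s \<in> patterns G \<Phi>"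
    and p: "p \<in> pat_set G (perm_group \<Omega>) \<phi> s"
    and B: "\<And>g h. (g, h) \<in> pairs G \<Phi> \<Longrightarrow> card (moved (defect G (perm_group \<Omega>) \<phi> g h)) \<le> B"
  shows "card (moved p) \<le> length s * B"
  using s p
proof (induction s arbitrary: p)
  case Nil
  then show ?case by (simp add: moved_def)
next
  case (Cons c s)
  let ?P = "perm_group \<Omega>"
  have fm: "finite (moved q)" if "q permutes \<Omega>" for q
    using moved_subset[OF that] fin by (rule finite_subset)
  obtain g h b where c: "c = (g, h, b)" by (cases c)
  have s: "s \<in> patterns G \<Phi>" "(g, h) \<in> pairs G \<Phi>" using Cons.prems(1) c by auto
  from Cons.prems(2) obtain y q where yq: "y \<in> carrier ?P" "q \<in> pat_set G ?P \<phi> s"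
    "p = (inv\<^bsub>?P\<^esub> y \<otimes>\<^bsub>?P\<^esub> letter G ?P \<phi> c \<otimes>\<^bsub>?P\<^esub> y) \<otimes>\<^bsub>?P\<^esub> q" unfolding pat_set.simps by blast
  define l where "l = letter G ?P \<phi> c"
  have y: "y permutes \<Omega>" using yq(1) by simp
  have l: "l permutes \<Omega>" using letter_closed[OF group_perm_group \<phi> s(2), of b] by (simp add: l_def c)
  have q: "q permutes \<Omega>" using pat_set_closed[OF group_perm_group \<phi> s(1) yq(2)] by simp
  have d: "defect G ?P \<phi> g h permutes \<Omega>" using defect_closed[OF group_perm_group \<phi> s(2)] by simp
  have "card (moved l) = card (moved (defect G ?P \<phi> g h))"
    using card_moved_inv[OF permutes_bij[OF d]] by (simp add: l_def c letter_def inv_perm_group[OF d])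
  then have lB: "card (moved l) \<le> B" using B[OF s(2)] by simp
  have "p = (inv' y \<circ> l \<circ> y) \<circ> q" by (simp only: yq(3) l_def perm_group_simps inv_perm_group[OF y])
  moreover have "inv' y \<circ> l \<circ> y permutes \<Omega>" using y l by (intro permutes_compose permutes_inv)
  ultimately have "card (moved p) \<le> card (moved (inv' y \<circ> l \<circ> y)) + card (moved q)"
    using card_moved_comp[OF fm fm[OF q], of "inv' y \<circ> l \<circ> y"] by simp
  then show ?case
    using card_moved_conj[OF permutes_bij[OF y], of l] lB Cons.IH[OF s(1) yq(2)] by simp
qed

section \<open>Models that move one element much more than the defects\<close>

lemma defect_hom:
  assumes "group H" "group_hom H L f" "unital_map G \<Phi> H \<phi>" "(g, h) \<in> pairs G \<Phi>"
  shows "defect G L (\<lambda>g. f (\<phi> g)) g h = f (defect G H \<phi> g h)"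
proof -
  interpret group_hom H L f by fact
  show ?thesis using unital_map_in[OF assms(3)] assms(4) by (simp add: pairs_def defect_def)
qed

text \<open>The strict inequality keeps \<open>\<psi> k\<close> nontrivial even where a defect is
  trivial. Acting on \<open>{1..N}\<close> gives the models for all \<open>k\<close> a common type,
  so that they can be combined.\<close>

definition outruns :: "('a, 'm) monoid_scheme \<Rightarrow> 'a set \<Rightarrow> 'a \<Rightarrow> nat \<Rightarrow> bool" where
  "outruns G \<Phi> k L \<longleftrightarrow> (\<exists>N \<psi>. unital_map G \<Phi> (perm_group {1..N :: nat}) \<psi> \<and>
     (\<forall>(g, h) \<in> pairs G \<Phi>. L * card (moved (defect G (perm_group {1..N}) \<psi> g h)) < card (moved (\<psi> k))))"

lemma map_permutation_group_hom:
  assumes "bij_betw f A B"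
  shows "group_hom (perm_group A) (perm_group B) (map_permutation A f)"
proof -
  have "map_permutation A f \<in> hom (perm_group A) (perm_group B)"
    using map_permutation_permutes[OF assms] map_permutation_compose'[OF bij_betw_imp_inj_on[OF assms]]
    by (simp add: hom_def)
  then show ?thesis by (simp add: group_hom_def group_hom_axioms_def group_perm_group)
qed

lemma card_moved_map_permutation:
  assumes f: "bij_betw f A B" and p: "p permutes A"
  shows "card (moved (map_permutation A f p)) = card (moved p)"
proof -
  have inj: "inj_on f A" and im: "f ` A = B" using f by (auto simp: bij_betw_def)
  have ap: "map_permutation A f p (f x) = f (p x)" if "x \<in> A" for x
    by (rule map_permutation_apply[OF inj that])
  have pA: "p x \<in> A" if "x \<in> A" for x using permutes_in_image[OF p] that by simp
  have fix_iff: "f (p x) = f x \<longleftrightarrow> p x = x" if "x \<in> A" for x using inj_on_eq_iff[OF inj pA[OF that] that] .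
  have "moved (map_permutation A f p) = f ` moved p"
  proof (intro equalityI subsetI)
    fix b assume b: "b \<in> moved (map_permutation A f p)"
    then have "b \<in> f ` A" using moved_subset[OF map_permutation_permutes[OF f p]] im by blast
    then obtain x where x: "x \<in> A" "b = f x" by blast
    then have "x \<in> moved p" using b ap[OF x(1)] by (auto simp: moved_def)
    then show "b \<in> f ` moved p" using x(2) by blast
  next
    fix b assume "b \<in> f ` moved p"
    then obtain x where x: "x \<in> moved p" "b = f x" by blast
    then have "x \<in> A" using moved_subset[OF p] by blast
    then show "b \<in> moved (map_permutation A f p)"
      using x ap[of x] fix_iff[of x] by (simp add: moved_def)
  qed
  then show ?thesis using card_image[of f "moved p"] inj_on_subset[OF inj moved_subset[OF p]] by simp
qed

text \<open>In the left regular representation the defects move no point and \<open>\<phi> k\<close>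
  moves some, whatever the factor \<open>L\<close>.\<close>

lemma outruns_if_trivial_defects:
  assumes Q: "group Q" "finite (carrier Q)" and \<phi>: "unital_map G \<Phi> Q \<phi>" and k: "k \<in> \<Phi>" "\<phi> k \<noteq> \<one>\<^bsub>Q\<^esub>"
    and d: "\<And>g h. (g, h) \<in> pairs G \<Phi> \<Longrightarrow> defect G Q \<phi> g h = \<one>\<^bsub>Q\<^esub>"
  shows "outruns G \<Phi> k L"
proof -
  interpret Q: group Q by fact
  let ?A = "carrier Q"
  define \<tau> where "\<tau> q = (\<lambda>x. if x \<in> ?A then q \<otimes>\<^bsub>Q\<^esub> x else x)" for q
  have perm: "\<tau> q permutes ?A" if "q \<in> ?A" for q
  proof (rule inj_imp_permutes)
    show "inj_on (\<tau> q) ?A" using that by (auto simp: inj_on_def \<tau>_def)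
  qed (use Q(2) that in \<open>auto simp: \<tau>_def\<close>)
  have "\<tau> \<in> hom Q (perm_group ?A)"
    using perm by (auto simp: hom_def fun_eq_iff \<tau>_def Q.m_assoc)
  then have hom1: "group_hom Q (perm_group ?A) \<tau>"
    using Q(1) by (simp add: group_hom_def group_hom_axioms_def group_perm_group)
  obtain f where f: "bij_betw f ?A {1..card ?A}"
    using ex_bij_betw_nat_finite_1[OF Q(2)] bij_betw_inv by blast
  define F where "F q = map_permutation ?A f (\<tau> q)" for q
  have F: "group_hom Q (perm_group {1..card ?A}) F"
    unfolding F_def by (rule group_hom_comp[OF hom1 map_permutation_group_hom[OF f]])
  have kQ: "\<phi> k \<in> ?A" using unital_map_in[OF \<phi> k(1)] .
  have "\<tau> (\<phi> k) \<one>\<^bsub>Q\<^esub> \<noteq> \<one>\<^bsub>Q\<^esub>" using k(2) kQ by (simp add: \<tau>_def)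
  then have "moved (\<tau> (\<phi> k)) \<noteq> {}" by (auto simp: moved_def)
  moreover have "finite (moved (\<tau> (\<phi> k)))" using moved_subset[OF perm[OF kQ]] Q(2) by (rule finite_subset)
  ultimately have "0 < card (moved (F (\<phi> k)))"
    unfolding F_def card_moved_map_permutation[OF f perm[OF kQ]] by (simp add: card_gt_0_iff)
  moreover have "defect G (perm_group {1..card ?A}) (\<lambda>g. F (\<phi> g)) g h = id" if "(g, h) \<in> pairs G \<Phi>" for g h
    using defect_hom[OF Q(1) F \<phi> that] d[OF that] group_hom.hom_one[OF F] by simp
  ultimately show ?thesis
    unfolding outruns_def using unital_map_hom[OF Q(1) \<phi> F]
    by (intro exI[of _ "card ?A"] exI[of _ "\<lambda>g. F (\<phi> g)"]) (auto simp: moved_def)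
qed

text \<open>The products of conjugates of defects form a normal subgroup. If it contains
  \<open>\<phi> k\<close>, some pattern yields \<open>\<phi> k\<close>; otherwise the quotient by it
  has trivial defects and keeps \<open>\<phi> k\<close> nontrivial.\<close>

lemma pattern_or_outruns:
  assumes P: "group P" "finite (carrier P)" and \<phi>: "unital_map G \<Phi> P \<phi>" and k: "k \<in> \<Phi>" and one: "\<one>\<^bsub>G\<^esub> \<in> \<Phi>" "group G"
  shows "(\<exists>s \<in> patterns G \<Phi>. \<phi> k \<in> pat_set G P \<phi> s) \<or> (\<forall>L. outruns G \<Phi> k L)"
proof -
  interpret P: group P by fact
  interpret G: group G by fact
  define X where "X = {\<phi> g \<otimes>\<^bsub>P\<^esub> \<phi> h \<otimes>\<^bsub>P\<^esub> inv\<^bsub>P\<^esub> (\<phi> (g \<otimes>\<^bsub>G\<^esub> h)) | g h. g \<in> \<Phi> \<and> h \<in> \<Phi> \<and> g \<otimes>\<^bsub>G\<^esub> h \<in> \<Phi>}"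
  have XI: "defect G P \<phi> g h \<in> X" if "(g, h) \<in> pairs G \<Phi>" for g h
    using that unfolding X_def defect_def pairs_def by blast
  have X: "X \<subseteq> carrier P"
    using defect_closed[OF P(1) \<phi>] by (auto simp: X_def defect_def pairs_def)
  define N where "N = (\<Union>n. conj_products P X n)"
  have "subgroup N P"
  proof (rule P.subgroupI)
    show "N \<subseteq> carrier P" using conj_products_closed[OF P(1) X] by (auto simp: N_def)
    have "\<one>\<^bsub>P\<^esub> \<in> conj_products P X 0" by simp
    then show "N \<noteq> {}" unfolding N_def by blast
    show "inv\<^bsub>P\<^esub> a \<in> N" if "a \<in> N" for a
      using that conj_products_inv[OF P(1) X] unfolding N_def by blast
    show "a \<otimes>\<^bsub>P\<^esub> b \<in> N" if "a \<in> N" "b \<in> N" for a b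
      using that conj_products_append[OF P(1) X] unfolding N_def by blast
  qed
  moreover have "x \<otimes>\<^bsub>P\<^esub> a \<otimes>\<^bsub>P\<^esub> inv\<^bsub>P\<^esub> x \<in> N" if "x \<in> carrier P" "a \<in> N" for x a
    using that conj_products_conj[OF P(1) X] unfolding N_def by blast
  ultimately have "N \<lhd> P" by (rule P.normal_invI)
  then interpret N: normal N P .
  show ?thesis
  proof (cases "\<phi> k \<in> N")
    case True
    then obtain n where "\<phi> k \<in> conj_products P X n" by (auto simp: N_def)
    from conj_products_pattern[OF P(1) \<phi> this[unfolded X_def]] show ?thesis by blast
  next
    case False
    define Q where "Q = P Mod N"
    have Q: "group Q" unfolding Q_def by (rule N.factorgroup_is_group)
    have "(#>\<^bsub>P\<^esub>) N \<in> hom P Q" unfolding Q_def by (rule N.r_coset_hom_Mod)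
    then have \<pi>: "group_hom P Q ((#>\<^bsub>P\<^esub>) N)" using Q P(1) by (simp add: group_hom_def group_hom_axioms_def)
    have \<pi>_one: "N #>\<^bsub>P\<^esub> p = \<one>\<^bsub>Q\<^esub> \<longleftrightarrow> p \<in> N" if "p \<in> carrier P" for p
      using P.coset_join1[OF _ that N.subgroup_axioms] P.coset_join2[OF that N.subgroup_axioms]
      by (auto simp: Q_def)
    have "finite (carrier Q)"
      using P(2) by (simp add: Q_def FactGroup_def RCOSETS_def)
    moreover have "N #>\<^bsub>P\<^esub> \<phi> k \<noteq> \<one>\<^bsub>Q\<^esub>" using False \<pi>_one[OF unital_map_in[OF \<phi> k]] by simp
    moreover have "defect G Q (\<lambda>g. N #>\<^bsub>P\<^esub> \<phi> g) g h = \<one>\<^bsub>Q\<^esub>" if gh: "(g, h) \<in> pairs G \<Phi>" for g h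
    proof -
      let ?d = "defect G P \<phi> g h"
      have d: "?d \<in> carrier P" using defect_closed[OF P(1) \<phi> gh] .
      then have "?d = (inv\<^bsub>P\<^esub> \<one>\<^bsub>P\<^esub> \<otimes>\<^bsub>P\<^esub> ?d \<otimes>\<^bsub>P\<^esub> \<one>\<^bsub>P\<^esub>) \<otimes>\<^bsub>P\<^esub> \<one>\<^bsub>P\<^esub>" by simp
      then have "?d \<in> conj_products P X (Suc 0)"
        unfolding conj_products.simps mem_Collect_eq using d XI[OF gh] by (metis P.one_closed singletonI)
      then have "?d \<in> N" unfolding N_def by blast
      then show ?thesis using defect_hom[OF P(1) \<pi> \<phi> gh] \<pi>_one[OF d] by simp
    qed
    ultimately show ?thesis
      using outruns_if_trivial_defects[OF Q _ unital_map_hom[OF P(1) \<phi> \<pi>] k] by blast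
  qed
qed

section \<open>Signs and patterns made of blocks\<close>

lemma perm_group_inv_comp: "p permutes \<Omega> \<Longrightarrow> q permutes \<Omega> \<Longrightarrow> p \<circ> (inv' p \<circ> q) = q"
  using permutes_inv_o(1)[of p \<Omega>] by (simp add: comp_assoc[symmetric])

text \<open>Conjugators have no effect in a commutative group. Applied to signs, this makes the sign
  of a pattern value independent of their choice.\<close>

lemma pat_set_comm_unique:
  assumes H: "group H" and comm: "\<And>x y. x \<in> carrier H \<Longrightarrow> y \<in> carrier H \<Longrightarrow> x \<otimes>\<^bsub>H\<^esub> y = y \<otimes>\<^bsub>H\<^esub> x"
    and \<phi>: "unital_map G \<Phi> H \<phi>" and "s \<in> patterns G \<Phi>" "p \<in> pat_set G H \<phi> s" "q \<in> pat_set G H \<phi> s"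
  shows "p = q"
  using assms(4-6)
proof (induction s arbitrary: p q)
  case Nil
  then show ?case by simp
next
  case (Cons c s)
  interpret group H by fact
  obtain g h b where c: "c = (g, h, b)" by (cases c)
  have s: "s \<in> patterns G \<Phi>" "(g, h) \<in> pairs G \<Phi>" using Cons.prems(1) c by auto
  have l: "letter G H \<phi> c \<in> carrier H" unfolding c by (rule letter_closed[OF H \<phi> s(2)])
  have conj: "inv\<^bsub>H\<^esub> y \<otimes>\<^bsub>H\<^esub> letter G H \<phi> c \<otimes>\<^bsub>H\<^esub> y = letter G H \<phi> c" if "y \<in> carrier H" for y
    using comm[OF inv_closed[OF that] l] that l by (simp add: m_assoc)
  obtain y p' where "y \<in> carrier H" "p' \<in> pat_set G H \<phi> s"
    "p = (inv\<^bsub>H\<^esub> y \<otimes>\<^bsub>H\<^esub> letter G H \<phi> c \<otimes>\<^bsub>H\<^esub> y) \<otimes>\<^bsub>H\<^esub> p'" using Cons.prems(2) unfolding pat_set.simps by blast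
  moreover obtain z q' where "z \<in> carrier H" "q' \<in> pat_set G H \<phi> s"
    "q = (inv\<^bsub>H\<^esub> z \<otimes>\<^bsub>H\<^esub> letter G H \<phi> c \<otimes>\<^bsub>H\<^esub> z) \<otimes>\<^bsub>H\<^esub> q'" using Cons.prems(3) unfolding pat_set.simps by blast
  ultimately show ?case using Cons.IH[OF s(1)] conj by metis
qed

text \<open>The sign in the guise of a permutation of degree 2, so that knowledge about maps into
  degree 2 controls signs in every degree.\<close>

definition parity_perm :: "(nat \<Rightarrow> nat) \<Rightarrow> nat \<Rightarrow> nat" where
  "parity_perm p = (if evenperm p then id else Transposition.transpose 1 2)"

lemma parity_perm_hom: "group_hom (sym_group n) (sym_group 2) parity_perm"
proof -
  have "parity_perm \<in> hom (sym_group n) (sym_group 2)"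
  proof (rule homI)
    fix p assume "p \<in> carrier (sym_group n)"
    show "parity_perm p \<in> carrier (sym_group 2)"
      using permutes_swap_id[of 1 "{1..2}" "2::nat"] by (simp add: parity_perm_def sym_group_carrier)
    fix q assume "q \<in> carrier (sym_group n)"
    then show "parity_perm (p \<otimes>\<^bsub>sym_group n\<^esub> q) = parity_perm p \<otimes>\<^bsub>sym_group 2\<^esub> parity_perm q"
      using sym_group_carrier'[OF \<open>p \<in> _\<close>] sym_group_carrier'[of q n]
      by (simp add: parity_perm_def sym_group_mult evenperm_comp)
  qed
  then show ?thesis by (simp add: group_hom_def group_hom_axioms_def sym_group_is_group)
qed

lemma sign_parity_perm: "sign (parity_perm p) = sign p"
  by (simp add: parity_perm_def sign_def evenperm_swap)

text \<open>An inverse defect followed by the defect is the shape of an element of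
  \<open>conj_pairs\<close>; \<open>M\<close> such pairs match a product of \<open>M\<close> of
  them.\<close>

definition block :: "nat \<Rightarrow> 'a \<times> 'a \<Rightarrow> ('a \<times> 'a \<times> bool) list" where
  "block M c = concat (replicate M [(fst c, snd c, False), (fst c, snd c, True)])"

lemma block_Suc: "block (Suc M) (g, h) = (g, h, False) # (g, h, True) # block M (g, h)"
  by (simp add: block_def)

lemma block_pattern: "(g, h) \<in> pairs G \<Phi> \<Longrightarrow> block M (g, h) \<in> patterns G \<Phi>"
  by (induction M) (simp_all add: block_Suc, simp add: block_def)

text \<open>With trivial conjugators each inverse defect cancels the defect after it, so any block
  can be switched off.\<close>

lemma one_in_pat_set_block:
  assumes "group H" "unital_map G \<Phi> H \<phi>" "(g, h) \<in> pairs G \<Phi>"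
  shows "\<one>\<^bsub>H\<^esub> \<in> pat_set G H \<phi> (block M (g, h))"
proof (induction M)
  case 0
  then show ?case by (simp add: block_def)
next
  case (Suc M)
  interpret group H by fact
  let ?d = "defect G H \<phi> g h"
  have d: "?d \<in> carrier H" by (rule defect_closed[OF assms])
  have "\<one>\<^bsub>H\<^esub> = (inv\<^bsub>H\<^esub> \<one>\<^bsub>H\<^esub> \<otimes>\<^bsub>H\<^esub> inv\<^bsub>H\<^esub> ?d \<otimes>\<^bsub>H\<^esub> \<one>\<^bsub>H\<^esub>) \<otimes>\<^bsub>H\<^esub> ((inv\<^bsub>H\<^esub> \<one>\<^bsub>H\<^esub> \<otimes>\<^bsub>H\<^esub> ?d \<otimes>\<^bsub>H\<^esub> \<one>\<^bsub>H\<^esub>) \<otimes>\<^bsub>H\<^esub> \<one>\<^bsub>H\<^esub>)"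
    using d by simp
  then show ?case
    using Suc one_closed unfolding block_Suc pat_set.simps letter_def mem_Collect_eq fst_conv snd_conv if_True if_False
    by metis
qed

lemma concat_block_pattern:
  "set cs \<subseteq> pairs G \<Phi> \<Longrightarrow> concat (map (block M) cs) \<in> patterns G \<Phi>"
  by (induction cs) (auto simp: block_pattern)

lemma one_in_pat_set_concat_block:
  assumes "group H" "unital_map G \<Phi> H \<phi>" "set cs \<subseteq> pairs G \<Phi>"
  shows "\<one>\<^bsub>H\<^esub> \<in> pat_set G H \<phi> (concat (map (block M) cs))"
  using assms(3)
proof (induction cs)
  case (Cons c cs)
  interpret group H by fact
  obtain g h where c: "c = (g, h)" by (cases c)
  have gh: "(g, h) \<in> pairs G \<Phi>" and cs: "set cs \<subseteq> pairs G \<Phi>" using Cons.prems c by auto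
  from pat_set_append[OF assms(1,2) block_pattern[OF gh] concat_block_pattern[OF cs]
      one_in_pat_set_block[OF assms(1,2) gh] Cons.IH[OF cs]]
  show ?case by (simp add: c)
qed simp

text \<open>The pattern is fixed before the map, when it is not yet known which defect will move the
  most points. It therefore has a block for every pair, and all but one are switched off.\<close>

lemma pat_set_concat_block:
  assumes "group H" "unital_map G \<Phi> H \<phi>" "set cs \<subseteq> pairs G \<Phi>" "(g, h) \<in> set cs"
    "p \<in> pat_set G H \<phi> (block M (g, h))"
  shows "p \<in> pat_set G H \<phi> (concat (map (block M) cs))"
  using assms(3,4)
proof (induction cs)
  case (Cons c cs)
  interpret group H by fact
  obtain g' h' where c: "c = (g', h')" by (cases c)
  have gh: "(g', h') \<in> pairs G \<Phi>" and cs: "set cs \<subseteq> pairs G \<Phi>" using Cons.prems(1) c by auto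
  have p: "p \<in> carrier H"
    using pat_set_closed[OF assms(1,2) block_pattern assms(5)] assms(3,4) by blast
  note app = pat_set_append[OF assms(1,2) block_pattern[OF gh] concat_block_pattern[OF cs]]
  show ?case
  proof (cases "(g, h) = c")
    case True
    then have "p \<in> pat_set G H \<phi> (block M (g', h'))" using assms(5) c by simp
    from app[OF this one_in_pat_set_concat_block[OF assms(1,2) cs]] show ?thesis using p by (simp add: c)
  next
    case False
    then have "p \<in> pat_set G H \<phi> (concat (map (block M) cs))" using Cons cs by auto
    from app[OF one_in_pat_set_block[OF assms(1,2) gh] this] show ?thesis using p by (simp add: c)
  qed
qed simp

section \<open>Alternating and symmetric groups in parallel\<close>

context
  fixes Q :: "nat \<Rightarrow> (nat \<Rightarrow> nat) monoid"
  assumes Q: "Q \<in> {alt_group, sym_group}"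
begin

lemma group_Q: "group (Q n)"
  using Q alt_group_is_group sym_group_is_group by auto

lemma mult_Q: "x \<otimes>\<^bsub>Q n\<^esub> y = x \<circ> y"
  using Q alt_group_mult sym_group_mult by auto

lemma one_Q: "\<one>\<^bsub>Q n\<^esub> = id"
  using Q alt_group_one sym_group_one by auto

lemma carrier_Q: "p \<in> carrier (Q n) \<Longrightarrow> p permutes {1..n}" "p \<in> even_perms {1..n} \<Longrightarrow> p \<in> carrier (Q n)"
  using Q alt_group_carrier sym_group_carrier by (auto simp: even_perms_def)

lemma inv_Q: "p \<in> carrier (Q n) \<Longrightarrow> inv\<^bsub>Q n\<^esub> p = inv' p"
  using Q alt_group_inv_equality sym_group_inv_equality by auto

lemma finite_carrier_Q: "finite (carrier (Q n))"
  by (rule finite_subset[of _ "{p. p permutes {1..n}}"]) (use carrier_Q(1) finite_permutations[of "{1..n}"] in auto)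

lemma incl_Q: "group_hom (Q n) (perm_group {1..n}) id"
  using carrier_Q(1) by (auto simp: group_hom_def group_hom_axioms_def hom_def mult_Q group_Q group_perm_group)

lemma prods_in_pat_set_block:
  assumes \<phi>: "unital_map G \<Phi> (Q n) \<phi>" and gh: "(g, h) \<in> pairs G \<Phi>"
    and p: "p \<in> prods (conj_pairs {1..n} (defect G (Q n) \<phi> g h)) M"
  shows "p \<in> pat_set G (Q n) \<phi> (block M (g, h))"
  using p
proof (induction M arbitrary: p)
  case 0
  then have "p = id" by (simp only: prods.simps singleton_iff)
  then show ?case by (simp only: block_def replicate_0 concat.simps pat_set.simps one_Q singletonI)
next
  case (Suc M)
  let ?d = "defect G (Q n) \<phi> g h"
  have d: "?d \<in> carrier (Q n)" by (rule defect_closed[OF group_Q \<phi> gh])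
  from Suc.prems obtain t q where t: "t \<in> conj_pairs {1..n} ?d" and q: "q \<in> prods (conj_pairs {1..n} ?d) M"
    and p: "p = t \<circ> q" unfolding prods.simps by blast
  from t obtain y z where yz: "y \<in> even_perms {1..n}" "z \<in> even_perms {1..n}"
    and t: "t = inv' z \<circ> inv' ?d \<circ> z \<circ> (inv' y \<circ> ?d \<circ> y)" unfolding conj_pairs_def by blast
  have c: "y \<in> carrier (Q n)" "z \<in> carrier (Q n)" using yz carrier_Q(2) by auto
  have "p = (inv\<^bsub>Q n\<^esub> z \<otimes>\<^bsub>Q n\<^esub> inv\<^bsub>Q n\<^esub> ?d \<otimes>\<^bsub>Q n\<^esub> z) \<otimes>\<^bsub>Q n\<^esub> ((inv\<^bsub>Q n\<^esub> y \<otimes>\<^bsub>Q n\<^esub> ?d \<otimes>\<^bsub>Q n\<^esub> y) \<otimes>\<^bsub>Q n\<^esub> q)"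
    unfolding p t mult_Q inv_Q[OF d] inv_Q[OF c(1)] inv_Q[OF c(2)] by (simp only: comp_assoc)
  then show ?case
    using Suc.IH[OF q] c unfolding block_Suc pat_set.simps letter_def mem_Collect_eq fst_conv snd_conv if_True if_False
    by metis
qed

text \<open>For symmetric groups, the parity map turns \<open>\<phi>\<close> into a map of degree 2,
  where \<open>s\<close> is known to yield the image of \<open>k\<close>. Thus the signs of
  \<open>\<phi> k\<close> and of \<open>\<tau>\<close> are both values of \<open>s\<close> in a
  commutative group, hence equal.\<close>

lemma evenperm_quotient_pattern:
  assumes s: "s \<in> patterns G \<Phi>" and k: "k \<in> \<Phi>"
    and small: "\<And>\<psi>. unital_map G \<Phi> (Q 2) \<psi> \<Longrightarrow> \<psi> k \<in> pat_set G (Q 2) \<psi> s"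
    and \<phi>: "unital_map G \<Phi> (Q n) \<phi>" and \<tau>: "\<tau> \<in> pat_set G (Q n) \<phi> s"
  shows "evenperm \<tau> = evenperm (\<phi> k)"
  using Q
proof (elim insertE emptyE)
  assume A: "Q = alt_group"
  have "\<tau> \<in> carrier (Q n)" "\<phi> k \<in> carrier (Q n)"
    using pat_set_closed[OF group_Q \<phi> s \<tau>] unital_map_in[OF \<phi> k] by auto
  then show ?thesis by (simp add: A alt_group_carrier)
next
  assume S: "Q = sym_group"
  have \<phi>S: "unital_map G \<Phi> (sym_group n) \<phi>" using \<phi> by (simp add: S)
  have \<psi>: "unital_map G \<Phi> (sym_group 2) (\<lambda>g. parity_perm (\<phi> g))"
    by (rule unital_map_hom[OF sym_group_is_group \<phi>S parity_perm_hom])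
  then have "parity_perm (\<phi> k) \<in> pat_set G (sym_group 2) (\<lambda>g. parity_perm (\<phi> g)) s"
    using small[of "\<lambda>g. parity_perm (\<phi> g)"] by (simp add: S)
  from pat_set_hom[OF sym_group_is_group \<psi> sign_group_hom s this]
  have 1: "sign (\<phi> k) \<in> pat_set G sign_img (\<lambda>g. sign (\<phi> g)) s" by (simp add: sign_parity_perm)
  have 2: "sign \<tau> \<in> pat_set G sign_img (\<lambda>g. sign (\<phi> g)) s"
    by (rule pat_set_hom[OF sym_group_is_group \<phi>S sign_group_hom s]) (use \<tau> in \<open>simp add: S\<close>)
  have "sign (\<phi> k) = sign \<tau>"
    by (rule pat_set_comm_unique[OF sign_img_is_group _ unital_map_hom[OF sym_group_is_group \<phi>S sign_group_hom] s 1 2])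
      (auto simp: sign_img_def)
  then show ?thesis by (simp add: sign_def split: if_splits)
qed

lemma defect_Q:
  assumes "unital_map G \<Phi> (Q n) \<phi>" "(g, h) \<in> pairs G \<Phi>"
  shows "defect G (perm_group {1..n}) \<phi> g h = defect G (Q n) \<phi> g h"
  using defect_hom[OF group_Q incl_Q assms] by simp

text \<open>The pattern \<open>s0\<close> of the proof settles all degrees below 15, where bounded generation is not available;
  it also fixes the sign of \<open>\<phi> k\<close> in every degree, through degree 2.\<close>

lemma outruns_if_avoiding_patterns:
  assumes G: "group G" and \<Phi>: "finite \<Phi>" "\<one>\<^bsub>G\<^esub> \<in> \<Phi>" and k: "k \<in> \<Phi>"
    and avoid: "\<And>s. s \<in> patterns G \<Phi> \<Longrightarrow> \<exists>n \<phi>. unital_map G \<Phi> (Q n) \<phi> \<and> \<phi> k \<notin> pat_set G (Q n) \<phi> s"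
  shows "outruns G \<Phi> k L"
proof -
  interpret G: group G by fact
  \<comment> \<open>Extensional functions on the finite set \<open>\<Phi>\<close> make all maps into
    degrees below 15 finitely many coordinates of one product.\<close>
  define I where "I = (SIGMA n : {..<15 :: nat}. {\<phi> \<in> \<Phi> \<rightarrow>\<^sub>E carrier (Q n). \<phi> \<one>\<^bsub>G\<^esub> = \<one>\<^bsub>Q n\<^esub>})"
  have finI: "finite I"
    unfolding I_def using finite_PiE[OF \<Phi>(1) finite_carrier_Q] by (intro finite_SigmaI) auto
  define P where "P = product_group I (\<lambda>i. Q (fst i))"
  have P: "group P" unfolding P_def using group_Q by (intro product_group)
  have finP: "finite (carrier P)"
    unfolding P_def carrier_product_group using finI finite_carrier_Q by (rule finite_PiE)
  define \<phi>0 where "\<phi>0 g = (\<lambda>i\<in>I. snd i g)" for g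
  have \<phi>0: "unital_map G \<Phi> P \<phi>0"
    unfolding P_def \<phi>0_def by (rule unital_map_product) (auto simp: I_def unital_map_def)
  consider s0 where "s0 \<in> patterns G \<Phi>" "\<phi>0 k \<in> pat_set G P \<phi>0 s0" | "outruns G \<Phi> k L"
    using pattern_or_outruns[OF P finP \<phi>0 k \<Phi>(2) G] by blast
  then show ?thesis
  proof cases
    case (1 s0)
    have small: "\<psi> k \<in> pat_set G (Q n) \<psi> s0" if n: "n < 15" and \<psi>: "unital_map G \<Phi> (Q n) \<psi>" for n \<psi>
    proof -
      define i where "i = (n, restrict \<psi> \<Phi>)"
      have i: "i \<in> I" using n \<psi> \<Phi>(2) by (auto simp: i_def I_def unital_map_def)
      have "group_hom P (Q (fst i)) (\<lambda>p. p i)"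
        unfolding P_def by (rule group_hom_proj[of I "\<lambda>i. Q (fst i)", OF group_Q i])
      from pat_set_hom[OF P \<phi>0 this 1] have "\<psi> k \<in> pat_set G (Q n) (\<lambda>g. \<phi>0 g i) s0"
        using i k by (simp add: \<phi>0_def i_def)
      also have "pat_set G (Q n) (\<lambda>g. \<phi>0 g i) s0 = pat_set G (Q n) \<psi> s0"
        using i by (intro pat_set_cong[OF 1(1)]) (simp add: \<phi>0_def i_def)
      finally show ?thesis .
    qed
    obtain cs where cs: "set cs = pairs G \<Phi>" using finite_list[OF finite_pairs[OF \<Phi>(1)]] by blast
    then have csp: "set cs \<subseteq> pairs G \<Phi>" by simp
    \<comment> \<open>The blocks will have to produce \<open>inv' \<tau> \<circ> \<phi> k\<close>
      for a value \<open>\<tau>\<close> of \<open>s0\<close>. If the claim fails, it moves at most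
      \<open>L + length s0\<close> times as many points as the largest defect.\<close>
    define M where "M = 80 * (L + length s0) + 48"
    define W where "W = concat (map (block M) cs)"
    have W: "W \<in> patterns G \<Phi>" unfolding W_def by (rule concat_block_pattern[OF csp])
    obtain n \<phi> where \<phi>: "unital_map G \<Phi> (Q n) \<phi>" and not: "\<phi> k \<notin> pat_set G (Q n) \<phi> (s0 @ W)"
      using avoid[of "s0 @ W"] 1(1) W by auto
    interpret Qn: group "Q n" by (rule group_Q)
    have \<phi>k: "\<phi> k \<in> carrier (Q n)" by (rule unital_map_in[OF \<phi> k])
    \<comment> \<open>In smaller degrees \<open>s0\<close> alone yields \<open>\<phi> k\<close> and
      all blocks of \<open>W\<close> can be switched off.\<close>
    have n: "15 \<le> n"
    proof (rule ccontr)
      assume "\<not> 15 \<le> n"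
      then have "\<phi> k \<in> pat_set G (Q n) \<phi> s0" using small[OF _ \<phi>] by simp
      from pat_set_append[OF group_Q \<phi> 1(1) W this, of "\<one>\<^bsub>Q n\<^esub>"] one_in_pat_set_concat_block[OF group_Q \<phi> csp, of M]
      have "\<phi> k \<otimes>\<^bsub>Q n\<^esub> \<one>\<^bsub>Q n\<^esub> \<in> pat_set G (Q n) \<phi> (s0 @ W)" by (simp add: W_def)
      then show False using not \<phi>k by simp
    qed
    have \<phi>P: "unital_map G \<Phi> (perm_group {1..n}) \<phi>"
      using unital_map_hom[OF group_Q \<phi> incl_Q] by simp
    let ?d = "\<lambda>g h. defect G (Q n) \<phi> g h"
    have "L * card (moved (?d g h)) < card (moved (\<phi> k))" if gh: "(g, h) \<in> pairs G \<Phi>" for g h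
    proof (rule ccontr)
      assume contr: "\<not> ?thesis"
      let ?F = "(\<lambda>c. card (moved (?d (fst c) (snd c)))) ` pairs G \<Phi>"
      have "finite ?F" "?F \<noteq> {}" using finite_pairs[OF \<Phi>(1)] gh by auto
      then have "Max ?F \<in> ?F" and max: "\<And>v. v \<in> ?F \<Longrightarrow> v \<le> Max ?F" by (auto intro: Max_in)
      then obtain c where c: "c \<in> pairs G \<Phi>" "card (moved (?d (fst c) (snd c))) = Max ?F" by force
      \<comment> \<open>A defect with largest support: comparing with it bounds both
        \<open>\<phi> k\<close>, by the contrary assumption, and \<open>\<tau>\<close>, whose
        factors are conjugates of defects and their inverses.\<close>
      define x where "x = ?d (fst c) (snd c)"
      have le: "card (moved (?d g h)) \<le> card (moved x)" if "(g, h) \<in> pairs G \<Phi>" for g h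
        unfolding x_def c(2) by (rule max) (use that in force)
      have "card (moved (\<phi> k)) \<le> L * card (moved (?d g h))" using contr by simp
      also have "\<dots> \<le> L * card (moved x)" using le[OF gh] by simp
      finally have \<phi>kx: "card (moved (\<phi> k)) \<le> L * card (moved x)" .
      have xQ: "x \<in> carrier (Q n)" unfolding x_def using defect_closed[OF group_Q \<phi>] c(1) by simp
      then have x: "x permutes {1..n}" by (rule carrier_Q(1))
      obtain \<tau> where \<tau>: "\<tau> \<in> pat_set G (Q n) \<phi> s0" using pat_set_nonempty[OF group_Q \<phi>] by blast
      have \<tau>Q: "\<tau> \<in> carrier (Q n)" by (rule pat_set_closed[OF group_Q \<phi> 1(1) \<tau>])
      have perms: "\<tau> permutes {1..n}" "\<phi> k permutes {1..n}" using carrier_Q(1) \<tau>Q \<phi>k by auto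
      have "\<tau> \<in> pat_set G (perm_group {1..n}) \<phi> s0"
        using pat_set_hom[OF group_Q \<phi> incl_Q 1(1) \<tau>] by simp
      from card_moved_pat_set[OF _ \<phi>P 1(1) this, of "card (moved x)"]
      have \<tau>x: "card (moved \<tau>) \<le> length s0 * card (moved x)" using le defect_Q[OF \<phi>] by simp
      \<comment> \<open>Any value \<open>\<tau>\<close> of \<open>s0\<close> has the sign of
        \<open>\<phi> k\<close>, so this remainder is even and within reach of the blocks.\<close>
      define \<sigma> where "\<sigma> = inv' \<tau> \<circ> \<phi> k"
      have fm: "finite (moved p)" if "p permutes {1..n}" for p
        using moved_subset[OF that] by (rule finite_subset) simp
      have "card (moved \<sigma>) \<le> card (moved (inv' \<tau>)) + card (moved (\<phi> k))"
        unfolding \<sigma>_def by (rule card_moved_comp[OF fm[OF permutes_inv[OF perms(1)]] fm[OF perms(2)]])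
      also have "\<dots> \<le> (L + length s0) * card (moved x)"
        using \<phi>kx \<tau>x card_moved_inv[OF permutes_bij[OF perms(1)]] by (simp add: algebra_simps)
      finally have \<sigma>x: "card (moved \<sigma>) \<le> (L + length s0) * card (moved x)" .
      have "evenperm \<tau> = evenperm (\<phi> k)"
        by (rule evenperm_quotient_pattern[OF 1(1) k _ \<phi> \<tau>]) (rule small, simp_all)
      then have "\<sigma> \<in> even_perms {1..n}"
        using perms permutes_imp_permutation[OF _ perms(1)] permutes_imp_permutation[OF _ perms(2)]
          permutes_imp_permutation[OF _ permutes_inv[OF perms(1)]]
        unfolding \<sigma>_def even_perms_def mem_Collect_eq
        by (intro conjI permutes_compose permutes_inv) (simp_all add: evenperm_comp evenperm_inv)
      from even_perm_in_prods_conj_pairs[OF _ x this _ \<sigma>x] n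
      have "\<sigma> \<in> prods (conj_pairs {1..n} (?d (fst c) (snd c))) M" by (simp add: M_def x_def)
      then have "\<sigma> \<in> pat_set G (Q n) \<phi> (block M (fst c, snd c))"
        by (intro prods_in_pat_set_block[OF \<phi>]) (use c(1) in simp)
      moreover have "(fst c, snd c) \<in> set cs" using c(1) cs by simp
      ultimately have "\<sigma> \<in> pat_set G (Q n) \<phi> W"
        unfolding W_def by (intro pat_set_concat_block[OF group_Q \<phi> csp])
      from pat_set_append[OF group_Q \<phi> 1(1) W \<tau> this] have "\<tau> \<circ> \<sigma> \<in> pat_set G (Q n) \<phi> (s0 @ W)" by (simp only: mult_Q)
      moreover have "\<tau> \<circ> \<sigma> = \<phi> k" unfolding \<sigma>_def by (rule perm_group_inv_comp[OF perms])
      ultimately show False using not by simp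
    qed
    then show ?thesis
      unfolding outruns_def using \<phi>P defect_Q[OF \<phi>] by (intro exI[of _ n] exI[of _ \<phi>]) auto
  qed
qed

end

section \<open>Combining permutation models\<close>

definition doubled :: "('c \<Rightarrow> 'c) \<Rightarrow> 'c \<times> bool \<Rightarrow> 'c \<times> bool" where
  "doubled p = map_prod p id"

lemma doubled_eq:
  assumes p: "p permutes A"
  shows "doubled p = map_permutation A (\<lambda>x. (x, True)) p \<circ> map_permutation A (\<lambda>x. (x, False)) p"
proof
  fix v :: "'a \<times> bool"
  obtain x b where v: "v = (x, b)" by (cases v)
  have inj: "inj_on (\<lambda>x. (x, c :: bool)) A" for c by (auto simp: inj_on_def)
  have in_A: "map_permutation A (\<lambda>x. (x, c)) p (x, c) = (p x, c)" if "x \<in> A" for x and c :: bool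
    by (rule map_permutation_apply[OF inj that])
  have out: "map_permutation A (\<lambda>x. (x, c)) p (x, d) = (x, d)" if "x \<notin> A \<or> d \<noteq> c" for x and c d :: bool
    using that by (auto simp: map_permutation_def restrict_id_def)
  have pA: "p x \<in> A \<longleftrightarrow> x \<in> A" by (rule permutes_in_image[OF p])
  show "doubled p v = (map_permutation A (\<lambda>x. (x, True)) p \<circ> map_permutation A (\<lambda>x. (x, False)) p) v"
  proof (cases "x \<in> A")
    case True
    then show ?thesis using pA by (cases b) (simp_all add: v doubled_def in_A out)
  next
    case False
    then show ?thesis by (simp add: v doubled_def out permutes_not_in[OF p])
  qed
qed

text \<open>The two copies contribute the same sign, and signs square to one.\<close>

lemma doubled_even:
  assumes fin: "finite A" and p: "p permutes A"
  shows "doubled p \<in> even_perms (A \<times> UNIV)"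
proof -
  have "bij_betw (\<lambda>x. (x, c)) A (A \<times> {c})" for c :: bool
    by (auto simp: bij_betw_def inj_on_def)
  from map_permutation_permutes[OF this p]
  have perm: "map_permutation A (\<lambda>x. (x, c)) p permutes A \<times> {c}" for c :: bool .
  have perm': "map_permutation A (\<lambda>x. (x, c)) p permutes A \<times> UNIV" for c :: bool
    by (rule permutes_subset[OF perm]) auto
  have "finite (A \<times> {c})" for c :: bool using fin by simp
  from permutes_imp_permutation[OF this perm]
  have "permutation (map_permutation A (\<lambda>x. (x, c)) p)" for c :: bool .
  moreover have "evenperm (map_permutation A (\<lambda>x. (x, c)) p) = evenperm p" for c :: bool
    by (rule evenperm_map_permutation[OF _ p fin]) (auto simp: inj_on_def)
  ultimately have "evenperm (doubled p)"
    unfolding doubled_eq[OF p] by (simp add: evenperm_comp)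
  moreover have "doubled p permutes A \<times> UNIV"
    unfolding doubled_eq[OF p] by (intro permutes_compose perm')
  ultimately show ?thesis by (simp add: even_perms_def)
qed

lemma doubled_group_hom:
  assumes "finite A"
  shows "group_hom (perm_group A) (perm_group (A \<times> UNIV)) doubled"
proof -
  have "doubled \<in> hom (perm_group A) (perm_group (A \<times> UNIV))"
    using doubled_even[OF assms] by (auto simp: hom_def even_perms_def) (auto simp: doubled_def fun_eq_iff)
  then show ?thesis by (simp add: group_hom_def group_hom_axioms_def group_perm_group)
qed

lemma card_moved_doubled:
  "card (moved (doubled p)) = 2 * card (moved p)"
proof -
  have "moved (doubled p) = moved p \<times> UNIV" by (auto simp: moved_def doubled_def)
  then show ?thesis by (simp add: card_cartesian_product)
qed

definition disjoint_sum :: "'i set \<Rightarrow> ('i \<Rightarrow> nat) \<Rightarrow> ('i \<Rightarrow> 'c \<Rightarrow> 'c) \<Rightarrow> 'i \<times> nat \<times> 'c \<Rightarrow> 'i \<times> nat \<times> 'c" where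
  "disjoint_sum T w p = (\<lambda>(i, j, x). if i \<in> T \<and> j < w i then (i, j, p i x) else (i, j, x))"

lemma disjoint_sum_permutes:
  assumes fin: "finite T" "\<And>i. i \<in> T \<Longrightarrow> finite (\<Omega> i)" and p: "\<And>i. i \<in> T \<Longrightarrow> p i permutes \<Omega> i"
  shows "disjoint_sum T w p permutes (SIGMA i:T. {..<w i} \<times> \<Omega> i)"
proof (rule inj_imp_permutes)
  let ?A = "SIGMA i:T. {..<w i} \<times> \<Omega> i"
  show "inj_on (disjoint_sum T w p) ?A"
  proof (rule inj_onI)
    fix u v assume uv: "u \<in> ?A" "v \<in> ?A" "disjoint_sum T w p u = disjoint_sum T w p v"
    obtain i j x where u: "u = (i, j, x)" "i \<in> T" "j < w i" using uv(1) by blast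
    obtain i' j' y where v: "v = (i', j', y)" "i' \<in> T" "j' < w i'" using uv(2) by blast
    have eq: "i = i' \<and> j = j' \<and> p i x = p i' y" using uv(3) u v by (auto simp: disjoint_sum_def)
    then have "i = i'" "j = j'" "p i x = p i y" by auto
    moreover from this(3) have "x = y" by (rule injD[OF permutes_inj[OF p[OF u(2)]]])
    ultimately show "u = v" using u(1) v(1) by simp
  qed
  show "finite ?A" using fin by auto
  show "disjoint_sum T w p v \<in> ?A" if "v \<in> ?A" for v
    using that permutes_in_image[OF p] by (auto simp: disjoint_sum_def)
  show "disjoint_sum T w p v = v" if "v \<notin> ?A" for v
    using that permutes_not_in[OF p] by (auto simp: disjoint_sum_def split: prod.splits)
qed

lemma disjoint_sum_group_hom:
  assumes fin: "finite T" "\<And>i. i \<in> T \<Longrightarrow> finite (\<Omega> i)"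
  shows "group_hom (product_group T (\<lambda>i. perm_group (\<Omega> i))) (perm_group (SIGMA i:T. {..<w i} \<times> \<Omega> i)) (disjoint_sum T w)"
proof -
  have "disjoint_sum T w \<in> hom (product_group T (\<lambda>i. perm_group (\<Omega> i))) (perm_group (SIGMA i:T. {..<w i} \<times> \<Omega> i))"
  proof (rule homI)
    fix p assume p: "p \<in> carrier (product_group T (\<lambda>i. perm_group (\<Omega> i)))"
    then have "p i permutes \<Omega> i" if "i \<in> T" for i using that PiE_mem by fastforce
    from disjoint_sum_permutes[OF fin this, where w = w]
    show "disjoint_sum T w p \<in> carrier (perm_group (SIGMA i:T. {..<w i} \<times> \<Omega> i))" by simp
    fix q
    show "disjoint_sum T w (p \<otimes>\<^bsub>product_group T (\<lambda>i. perm_group (\<Omega> i))\<^esub> q) =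
      disjoint_sum T w p \<otimes>\<^bsub>perm_group (SIGMA i:T. {..<w i} \<times> \<Omega> i)\<^esub> disjoint_sum T w q"
      by (auto simp: disjoint_sum_def fun_eq_iff)
  qed
  then show ?thesis by (simp add: group_hom_def group_hom_axioms_def group_perm_group)
qed

lemma card_moved_disjoint_sum:
  assumes "finite T" "\<And>i. i \<in> T \<Longrightarrow> finite (moved (p i))"
  shows "card (moved (disjoint_sum T w p)) = (\<Sum>i\<in>T. w i * card (moved (p i)))"
proof -
  have "moved (disjoint_sum T w p) = (SIGMA i:T. {..<w i} \<times> moved (p i))"
    by (auto simp: moved_def disjoint_sum_def split: if_splits)
  then show ?thesis using assms by (simp add: card_cartesian_product)
qed

text \<open>The disjoint sum takes each model with a multiplicity inversely proportional to the number
  of points that its distinguished element moves, and twice, so that all permutations are even.\<close>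

lemma ex_even_balanced_sum:
  fixes G :: "('a, 'm) monoid_scheme"
  assumes fin: "finite \<Phi>" and T: "T \<subseteq> \<Phi>" and one: "(\<one>\<^bsub>G\<^esub>, \<one>\<^bsub>G\<^esub>) \<in> pairs G \<Phi>"
    and out: "\<And>k L. k \<in> T \<Longrightarrow> outruns G \<Phi> k L"
  shows "\<exists>N \<psi>. unital_map G \<Phi> (perm_group {1..N :: nat}) \<psi> \<and> (\<forall>g\<in>\<Phi>. evenperm (\<psi> g)) \<and>
    (\<forall>k \<in> T. \<forall>s \<in> patterns G \<Phi>. length s = n \<longrightarrow> \<psi> k \<notin> pat_set G (perm_group {1..N}) \<psi> s)"
proof -
  have finT: "finite T" using T fin by (rule finite_subset)
  \<comment> \<open>In the sum each distinguished element will move at least \<open>2 * D\<close>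
    points and a defect at most \<open>2 * card T * D / L\<close>. For \<open>n\<close> factors to
    fall short, \<open>L\<close> must exceed \<open>n * card T\<close>.\<close>
  define L where "L = n * card T + 1"
  have "\<exists>p. unital_map G \<Phi> (perm_group {1..fst p :: nat}) (snd p) \<and>
      (\<forall>(g, h) \<in> pairs G \<Phi>. L * card (moved (defect G (perm_group {1..fst p}) (snd p) g h)) < card (moved (snd p k)))"
    if k: "k \<in> T" for k
    using out[OF k, of L] unfolding outruns_def by auto
  then obtain F where F: "\<forall>k\<in>T. unital_map G \<Phi> (perm_group {1..fst (F k) :: nat}) (snd (F k)) \<and>
      (\<forall>(g, h) \<in> pairs G \<Phi>. L * card (moved (defect G (perm_group {1..fst (F k)}) (snd (F k)) g h)) < card (moved (snd (F k) k)))"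
    using bchoice[of T "\<lambda>k p. unital_map G \<Phi> (perm_group {1..fst p :: nat}) (snd p) \<and>
      (\<forall>(g, h) \<in> pairs G \<Phi>. L * card (moved (defect G (perm_group {1..fst p}) (snd p) g h)) < card (moved (snd p k)))"]
    by blast
  define \<Omega> \<psi> where "\<Omega> k = {1..fst (F k)}" and "\<psi> k = snd (F k)" for k
  define \<delta> where "\<delta> k = card (moved (\<psi> k k))" for k
  have \<psi>: "unital_map G \<Phi> (perm_group (\<Omega> k)) (\<psi> k)" if "k \<in> T" for k
    using F that unfolding \<Omega>_def \<psi>_def by blast
  have small: "L * card (moved (defect G (perm_group (\<Omega> k)) (\<psi> k) g h)) < \<delta> k" if "k \<in> T" "(g, h) \<in> pairs G \<Phi>" for k g h
    using bspec[OF conjunct2[OF bspec[OF F that(1)]] that(2)] by (simp add: \<Omega>_def \<psi>_def \<delta>_def)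
  \<comment> \<open>The strict inequality is available only through a pair, which the neutral
    element supplies.\<close>
  have \<delta>0: "0 < \<delta> k" if "k \<in> T" for k
    using small[OF that one] by simp
  \<comment> \<open>A common multiple of all \<open>\<delta> k\<close>: over its \<open>w k\<close>
    copies, the element \<open>\<psi> k k\<close> moves exactly \<open>D\<close> points for each
    \<open>k\<close>.\<close>
  define D where "D = (\<Prod>k\<in>T. \<delta> k)"
  have D0: "0 < D" unfolding D_def using \<delta>0 by (intro prod_pos) auto
  define w where "w k = D div \<delta> k" for k
  have w: "w k * \<delta> k = D" if "k \<in> T" for k
    using dvd_prodI[OF finT that, of \<delta>] by (simp add: w_def D_def)
  define P where "P = product_group T (\<lambda>k. perm_group (\<Omega> k))"
  have P: "group P" unfolding P_def by (intro product_group group_perm_group)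
  define \<Psi> where "\<Psi> g = (\<lambda>k\<in>T. \<psi> k g)" for g
  have \<Psi>: "unital_map G \<Phi> P \<Psi>" unfolding P_def \<Psi>_def using \<psi> by (rule unital_map_product)
  define A where "A = (SIGMA k:T. {..<w k} \<times> \<Omega> k)"
  have fin\<Omega>: "finite (\<Omega> k)" for k by (simp add: \<Omega>_def)
  have finA: "finite A" unfolding A_def using finT fin\<Omega> by auto
  define N where "N = card (A \<times> (UNIV :: bool set))"
  have "\<exists>f. bij_betw f (A \<times> (UNIV :: bool set)) {1..N}"
    using finA by (subst bij_betw_iff_card) (simp_all add: N_def)
  then obtain f where f: "bij_betw f (A \<times> (UNIV :: bool set)) {1..N}" by (elim exE)
  define E where "E p = map_permutation (A \<times> UNIV) f (doubled (disjoint_sum T w p))" for p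
  have hom1: "group_hom P (perm_group A) (disjoint_sum T w)"
    unfolding P_def A_def using finT fin\<Omega> by (rule disjoint_sum_group_hom)
  have E: "group_hom P (perm_group {1..N}) E"
    unfolding E_def
    by (rule group_hom_comp[OF group_hom_comp[OF hom1 doubled_group_hom[OF finA]] map_permutation_group_hom[OF f]])
  have permA: "disjoint_sum T w p permutes A" if "p \<in> carrier P" for p
    using group_hom.hom_closed[OF hom1 that] by simp
  have even: "doubled (disjoint_sum T w p) \<in> even_perms (A \<times> UNIV)" if "p \<in> carrier P" for p
    by (rule doubled_even[OF finA permA[OF that]])
  have evenE: "evenperm (E p)" if "p \<in> carrier P" for p
  proof -
    have "finite (A \<times> (UNIV :: bool set))" using finA by simp
    then show ?thesis
      unfolding E_def using evenperm_map_permutation[OF bij_betw_imp_inj_on[OF f]] even[OF that]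
      by (simp add: even_perms_def)
  qed
  have Pk: "p k permutes \<Omega> k" if "p \<in> carrier P" "k \<in> T" for p k
    using that PiE_mem[of p T "\<lambda>k. carrier (perm_group (\<Omega> k))" k] by (simp add: P_def)
  have cardE: "card (moved (E p)) = 2 * (\<Sum>k\<in>T. w k * card (moved (p k)))" if p: "p \<in> carrier P" for p
  proof -
    have "doubled (disjoint_sum T w p) permutes A \<times> UNIV" using even[OF p] by (simp add: even_perms_def)
    from card_moved_map_permutation[OF f this]
    have "card (moved (E p)) = 2 * card (moved (disjoint_sum T w p))" by (simp add: E_def card_moved_doubled)
    moreover have "finite (moved (p k))" if "k \<in> T" for k
      using moved_subset[OF Pk[OF p that]] fin\<Omega> by (rule finite_subset)
    from card_moved_disjoint_sum[OF finT this]
    have "card (moved (disjoint_sum T w p)) = (\<Sum>k\<in>T. w k * card (moved (p k)))" .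
    ultimately show ?thesis by (simp only:)
  qed
  have unital: "unital_map G \<Phi> (perm_group {1..N}) (\<lambda>g. E (\<Psi> g))"
    by (rule unital_map_hom[OF P \<Psi> E])
  define B where "B = 2 * card T * D div L"
  have LB: "card (moved (defect G (perm_group {1..N}) (\<lambda>g. E (\<Psi> g)) g h)) \<le> B"
    if gh: "(g, h) \<in> pairs G \<Phi>" for g h
  proof -
    let ?d = "defect G P \<Psi> g h"
    have d: "?d \<in> carrier P" by (rule defect_closed[OF P \<Psi> gh])
    have dk: "?d k = defect G (perm_group (\<Omega> k)) (\<psi> k) g h" if k: "k \<in> T" for k
    proof -
      have "group_hom P (perm_group (\<Omega> k)) (\<lambda>p. p k)"
        unfolding P_def by (rule group_hom_proj[of T "\<lambda>k. perm_group (\<Omega> k)", OF group_perm_group k])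
      from defect_hom[OF P this \<Psi> gh] show ?thesis using k by (simp add: \<Psi>_def)
    qed
    have "L * (\<Sum>k\<in>T. w k * card (moved (?d k))) = (\<Sum>k\<in>T. w k * (L * card (moved (?d k))))"
      by (simp add: sum_distrib_left algebra_simps)
    also have "\<dots> \<le> (\<Sum>k\<in>T. w k * \<delta> k)"
      using small gh dk by (intro sum_mono mult_le_mono2) (simp add: less_imp_le)
    also have "\<dots> = card T * D" using w by simp
    finally have "L * card (moved (E ?d)) \<le> 2 * card T * D" unfolding cardE[OF d] by simp
    then have "card (moved (E ?d)) \<le> B"
      unfolding B_def by (simp add: less_eq_div_iff_mult_less_eq L_def mult.commute)
    then show ?thesis using defect_hom[OF P E \<Psi> gh] by simp
  qed
  have "E (\<Psi> k) \<notin> pat_set G (perm_group {1..N}) (\<lambda>g. E (\<Psi> g)) s"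
    if k: "k \<in> T" and s: "s \<in> patterns G \<Phi>" "length s = n" for k s
  proof
    assume mem: "E (\<Psi> k) \<in> pat_set G (perm_group {1..N}) (\<lambda>g. E (\<Psi> g)) s"
    have kP: "\<Psi> k \<in> carrier P" using unital_map_in[OF \<Psi>] k T by blast
    have "card (moved (E (\<Psi> k))) \<le> n * B"
      using card_moved_pat_set[OF _ unital s(1) mem LB] s(2) by simp
    moreover have "2 * D \<le> card (moved (E (\<Psi> k)))"
    proof -
      have "w k * card (moved (\<Psi> k k)) \<le> (\<Sum>j\<in>T. w j * card (moved (\<Psi> k j)))"
        using finT k by (intro member_le_sum) auto
      then show ?thesis using w[OF k] k unfolding cardE[OF kP] by (simp add: \<Psi>_def \<delta>_def)
    qed
    moreover have "n * B < 2 * D"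
    proof -
      have "L * B \<le> 2 * card T * D" unfolding B_def by simp
      then have "n * (L * B) \<le> n * (2 * card T * D)" by (rule mult_le_mono2)
      then have "L * (n * B) \<le> (n * card T) * (2 * D)" by (simp add: algebra_simps)
      also have "\<dots> < L * (2 * D)" unfolding L_def using D0 by simp
      finally show ?thesis by simp
    qed
    ultimately show False by linarith
  qed
  moreover have "evenperm (E (\<Psi> g))" if "g \<in> \<Phi>" for g using evenE unital_map_in[OF \<Psi> that] by blast
  ultimately show ?thesis using unital by (intro exI[of _ N] exI[of _ "\<lambda>g. E (\<Psi> g)"]) blast
qed

lemma approximable_permutation_groups:
  fixes G :: "('a, 'm) monoid_scheme" and K :: "nat monoid set"
  assumes Q: "Q \<in> {alt_group, sym_group}" and K: "K = {H. group H \<and> (\<exists>n. H \<cong> Q n)}" and G: "group G"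
    and sol: "\<And>S. S \<in> Sys_class K \<Longrightarrow> solvable_over G S"
  shows "approximable K G"
proof -
  have groups: "group H" if "H \<in> K" for H using that K by simp
  interpret G: group G by fact
  note gQ = group_Q[OF Q]
  show ?thesis
  proof (rule approximableI[OF G groups])
    fix \<Phi> :: "'a set" and n
    assume \<Phi>: "finite \<Phi>" "\<Phi> \<subseteq> carrier G" "\<one>\<^bsub>G\<^esub> \<in> \<Phi>"
    have "outruns G \<Phi> k L" if k: "k \<in> \<Phi> - {\<one>\<^bsub>G\<^esub>}" for k L
    proof (rule outruns_if_avoiding_patterns[OF Q G \<Phi>(1,3)])
      show k\<Phi>: "k \<in> \<Phi>" using k by simp
      fix s assume s: "s \<in> patterns G \<Phi>"
      from ex_unital_map_avoiding_pattern[OF G groups sol \<Phi> k s] obtain H \<phi> where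
        H: "H \<in> K" "unital_map G \<Phi> H \<phi>" "\<phi> k \<notin> pat_set G H \<phi> s" by blast
      then obtain m f where f: "f \<in> iso H (Q m)" unfolding K is_iso_def by blast
      have "unital_map G \<Phi> (Q m) (\<lambda>g. f (\<phi> g))"
        by (rule unital_map_hom[OF groups[OF H(1)] H(2) iso_imp_group_hom[OF groups[OF H(1)] gQ f]])
      moreover have "f (\<phi> k) \<notin> pat_set G (Q m) (\<lambda>g. f (\<phi> g)) s"
        using pat_set_iso[OF groups[OF H(1)] gQ f H(2) s k\<Phi>] H(3) by blast
      ultimately show "\<exists>n \<phi>. unital_map G \<Phi> (Q n) \<phi> \<and> \<phi> k \<notin> pat_set G (Q n) \<phi> s"
        by (intro exI[of _ m] exI[of _ "\<lambda>g. f (\<phi> g)"]) simp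
    qed
    moreover have "(\<one>\<^bsub>G\<^esub>, \<one>\<^bsub>G\<^esub>) \<in> pairs G \<Phi>" using \<Phi>(3) by (simp add: pairs_def)
    ultimately obtain N \<psi> where \<psi>: "unital_map G \<Phi> (perm_group {1..N :: nat}) \<psi>" "\<And>g. g \<in> \<Phi> \<Longrightarrow> evenperm (\<psi> g)"
      and avoid: "\<And>k s. k \<in> \<Phi> - {\<one>\<^bsub>G\<^esub>} \<Longrightarrow> s \<in> patterns G \<Phi> \<Longrightarrow> length s = n \<Longrightarrow> \<psi> k \<notin> pat_set G (perm_group {1..N}) \<psi> s"
      using ex_even_balanced_sum[OF \<Phi>(1), of "\<Phi> - {\<one>\<^bsub>G\<^esub>}" G n] by blast
    have \<psi>Q: "unital_map G \<Phi> (Q N) \<psi>"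
    proof -
      have "\<psi> g \<in> carrier (Q N)" if "g \<in> \<Phi>" for g
        using carrier_Q(2)[OF Q, of "\<psi> g" N] \<psi>(2)[OF that] unital_map_in[OF \<psi>(1) that] by (simp add: even_perms_def)
      moreover have "\<psi> \<one>\<^bsub>G\<^esub> = \<one>\<^bsub>Q N\<^esub>" using \<psi>(1) by (simp add: unital_map_def one_Q[OF Q])
      ultimately show ?thesis by (simp add: unital_map_def)
    qed
    \<comment> \<open>A pattern followed in \<open>Q N\<close> is also followed in the full
      permutation group, so avoidance there is the stronger statement.\<close>
    have avoidQ: "\<psi> k \<notin> pat_set G (Q N) \<psi> s" if "k \<in> \<Phi> - {\<one>\<^bsub>G\<^esub>}" "s \<in> patterns G \<Phi>" "length s = n" for k s
      using avoid[OF that] pat_set_hom[OF gQ \<psi>Q incl_Q[OF Q] that(2)] by auto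
    obtain H :: "nat monoid" and f where H: "group H" and f: "f \<in> iso (Q N) H"
      using ex_nat_copy[OF gQ finite_carrier_Q[OF Q]] by metis
    have "H \<cong> Q N" using group.iso_set_sym[OF gQ f] unfolding is_iso_def by blast
    then have HK: "H \<in> K" using H unfolding K by blast
    have "unital_map G \<Phi> H (\<lambda>g. f (\<psi> g))"
      by (rule unital_map_hom[OF gQ \<psi>Q iso_imp_group_hom[OF gQ H f]])
    moreover have "f (\<psi> k) \<notin> pat_set G H (\<lambda>g. f (\<psi> g)) s"
      if k: "k \<in> \<Phi> - {\<one>\<^bsub>G\<^esub>}" and s: "s \<in> patterns G \<Phi>" "length s = n" for k s
      using pat_set_iso[OF gQ H f \<psi>Q s(1), of k] avoidQ[OF k s] k by blast
    ultimately show "\<exists>H\<in>K. \<exists>\<phi>. unital_map G \<Phi> H \<phi> \<and>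
        (\<forall>g \<in> \<Phi> - {\<one>\<^bsub>G\<^esub>}. \<forall>s \<in> patterns G \<Phi>. length s = n \<longrightarrow> \<phi> g \<notin> pat_set G H \<phi> s)"
      using HK by (intro bexI[of _ H] exI[of _ "\<lambda>g. f (\<psi> g)"]) auto
  qed
qed

theorem mainTheorem5:
  fixes K :: "nat monoid set" and G :: "'a monoid"
  assumes "K \<in> {Nil_groups, Sol_groups, Fin_groups, Alt_groups, Sym_groups}"
    and "group G"
  shows "approximable K G \<longleftrightarrow> (\<forall>S \<in> Sys_class K. solvable_over G S)"
proof
  have groups: "group H" if "H \<in> K" for H
    using assms(1) that by (auto simp: Nil_groups_def Sol_groups_def Fin_groups_def Alt_groups_def Sym_groups_def)
  show "\<forall>S \<in> Sys_class K. solvable_over G S" if "approximable K G"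
    using approximable_imp_solvable_over[OF assms(2) groups that] by blast
  assume "\<forall>S \<in> Sys_class K. solvable_over G S"
  then have sol: "solvable_over G S" if "S \<in> Sys_class K" for S using that by blast
  consider "K \<in> {Nil_groups, Sol_groups, Fin_groups}" | "K = Alt_groups" | "K = Sym_groups"
    using assms(1) by blast
  then show "approximable K G"
  proof cases
    case 1
    then show ?thesis using assms(2) sol by (rule approximable_product_closed)
  next
    case 2
    show ?thesis
      by (rule approximable_permutation_groups[OF _ _ assms(2) sol, where Q = alt_group]) (simp_all add: 2 Alt_groups_def)
  next
    case 3
    show ?thesis
      by (rule approximable_permutation_groups[OF _ _ assms(2) sol, where Q = sym_group]) (simp_all add: 3 Sym_groups_def)
  qed
qed

end
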